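(* Let $\mathbf{H} = L^2((0,1), dt)$, regarded as a closed subspace of $L^2((0,\infty), dt)$ (functions vanishing on $(1,\infty)$). For $0<\alpha<1$ define $\rho_\alpha(t) = \left\{\frac{\alpha}{t}\right\} - \alpha\left\{\frac{1}{t}\right\}$ for $t>0$, where $\{u\}$ denotes the fractional part of the real number $u$ (so $\rho_\alpha$ vanishes on $(1,\infty)$ and is bounded on $(0,1]$). Let $\mathbf{NB}$ be the closed subspace of $\mathbf{H}$ spanned by the functions $\rho_\alpha$, $0<\alpha<1$, and let $\mathbf{P}$ be the orthogonal projection onto $\mathbf{NB}$. Let $\mathbf{1}$ be the function equal to $1$ on $(0,1]$ and $0$ on $(1,\infty)$. Then $$\Vert \mathbf{P}(\mathbf{1})\Vert = \prod_{\zeta(\rho)=0,\ \mathrm{Re}(\rho)>\frac12}\left|\frac{1-\rho}{\rho}\right|,$$ where the product runs over the zeros $\rho$ of the Riemann zeta function with real part strictly greater than $\frac12$, counted with multiplicity (the empty product being $1$), and $\Vert\cdot\Vert$ is the $L^2((0,1),dt)$ norm.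
   Context: $\zeta$ denotes the Riemann zeta function. *)

theory Defs
  imports "HOL-Complex_Analysis.Complex_Analysis"
begin

text \<open>
  The Riemann zeta function as the analytic continuation of its Dirichlet series to the plane
  without \<open>1\<close>. The value at the pole \<open>1\<close> carries no meaning; it is fixed only so
  that the description is unique, and \<open>1\<close> has to be excluded wherever zeros are collected.
\<close>

definition riemann_zeta :: "complex \<Rightarrow> complex" where
  "riemann_zeta = (THE f. f holomorphic_on - {1} \<and>
     (\<forall>s. Re s > 1 \<longrightarrow> (\<lambda>n. 1 / of_nat (Suc n) powr s) sums f s) \<and> f 1 = 0)"

definition zeta_zeros_right :: "complex set" where
  "zeta_zeros_right = {\<rho>. \<rho> \<noteq> 1 \<and> riemann_zeta \<rho> = 0 \<and> Re \<rho> > 1 / 2}"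

text \<open>
  Elements of the complex Hilbert space \<open>L\<^sup>2(M)\<close> are represented by functions;
  two functions that agree almost everywhere represent the same element.
\<close>

definition L2_space :: "'a measure \<Rightarrow> ('a \<Rightarrow> complex) set" where
  "L2_space M = {f \<in> borel_measurable M. integrable M (\<lambda>x. (cmod (f x))\<^sup>2)}"

definition L2_inner :: "'a measure \<Rightarrow> ('a \<Rightarrow> complex) \<Rightarrow> ('a \<Rightarrow> complex) \<Rightarrow> complex" where
  "L2_inner M f g = (LINT x|M. f x * cnj (g x))"

definition L2_norm :: "'a measure \<Rightarrow> ('a \<Rightarrow> complex) \<Rightarrow> real" where
  "L2_norm M f = sqrt (LINT x|M. (cmod (f x))\<^sup>2)"

definition lin_span :: "('a \<Rightarrow> complex) set \<Rightarrow> ('a \<Rightarrow> complex) set" where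
  "lin_span S = {\<lambda>x. \<Sum>h\<in>F. c h * h x | c F. finite F \<and> F \<subseteq> S}"

definition L2_closed_span :: "'a measure \<Rightarrow> ('a \<Rightarrow> complex) set \<Rightarrow> ('a \<Rightarrow> complex) set" where
  "L2_closed_span M S =
     {f \<in> L2_space M. \<forall>\<epsilon>>0. \<exists>g\<in>lin_span S. L2_norm M (\<lambda>x. f x - g x) < \<epsilon>}"

text \<open>
  For a closed subspace \<open>V\<close> the orthogonal projection of \<open>f\<close> is determined up to
  equality almost everywhere; the choice operator picks one representative.
\<close>

definition L2_proj ::
  "'a measure \<Rightarrow> ('a \<Rightarrow> complex) set \<Rightarrow> ('a \<Rightarrow> complex) \<Rightarrow> ('a \<Rightarrow> complex)" where
  "L2_proj M V f = (SOME p. p \<in> V \<and> (\<forall>g\<in>V. L2_inner M (\<lambda>x. f x - p x) g = 0))"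

definition unit_lborel :: "real measure" where
  "unit_lborel = restrict_space lborel {0<..<1}"

definition rho :: "real \<Rightarrow> real \<Rightarrow> complex" where
  "rho \<alpha> t = complex_of_real (frac (\<alpha> / t) - \<alpha> * frac (1 / t))"

definition NB :: "(real \<Rightarrow> complex) set" where
  "NB = L2_closed_span unit_lborel (rho ` {0<..<1})"

end

theory Submission
  imports Defs "HOL-Real_Asymp.Real_Asymp"
begin

text \<open>
  Put \<open>T f (z) = s \<integral> f(t) t\<^sup>s\<^sup>-\<^sup>1 dt\<close> with \<open>s = 1 / (1 - z)\<close>. The Laguerre functions
  \<open>L\<^sub>n(- ln t)\<close> form an orthonormal basis of \<open>L\<^sup>2(0, 1)\<close> which \<open>T\<close> maps to the powers \<open>z\<^sup>n\<close>,
  so \<open>T\<close> is an isometry onto the Hardy space of the disc. It maps \<open>1\<close> to \<open>1\<close>, turns pairing with \<open>1\<close>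
  into evaluation at \<open>0\<close>, and sends \<open>\<rho>\<^sub>\<alpha>\<close> to \<open>(\<alpha> - \<alpha>\<^sup>s) \<zeta>(s)\<close>. A zero \<open>\<rho>\<close> with
  \<open>Re \<rho> > 1/2\<close> corresponds to the point \<open>1 - 1/\<rho>\<close> of the disc, of modulus \<open>|1 - \<rho>| / |\<rho>|\<close>.

  Upper bound: for \<open>g\<close> in the span of the \<open>\<rho>\<^sub>\<alpha>\<close> a finite Blaschke product divides \<open>T g\<close> without
  changing its norm, so \<open>|\<langle>g, 1\<rangle>| = |T g (0)|\<close> is at most the value of the product at \<open>0\<close> times \<open>\<parallel>g\<parallel>\<close>.

  Lower bound: \<open>NB\<close> is invariant under dilations, hence every \<open>q G\<close> with a polynomial \<open>q\<close> and
  \<open>G(z) = (s - 1) \<zeta>(s) / s\<^sup>3\<close> is the transform of a function \<open>f\<close> orthogonal to \<open>1 - P(1)\<close>, and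
  \<open>|q(0)| = |\<langle>f, P(1)\<rangle>| \<le> \<parallel>P(1)\<parallel> \<parallel>f\<parallel>\<close>. It remains to choose \<open>q\<close> with \<open>|q G| \<le> 1\<close> on the disc and \<open>|q(0)|\<close>
  almost equal to the Blaschke product. Take \<open>q\<close> close to \<open>exp (- Q)\<close>, where \<open>Re Q\<close> approximates
  \<open>ln (max |G| \<delta>)\<close> on the circle. By Jensen's formula on circles of radius \<open>r < 1\<close> this succeeds once
  the negative part of \<open>ln |G|\<close> is uniformly integrable on these circles. Near a boundary point \<open>e\<close>
  this follows from the Poisson-Jensen inequality at \<open>(1 - \<eta>) e\<close>, because \<open>\<eta> ln |G((1 - \<eta>) e)|\<close> tends
  to \<open>0\<close>. No singular inner factor can therefore occur, not even at \<open>z = 1\<close>, that is \<open>s = \<infinity>\<close>.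
\<close>

section \<open>The Hilbert space of square-integrable functions\<close>

text \<open>No boundary values of general Hardy functions and no infinite products are formed: apart
  from polynomials, only G, continuous on the closed disc, is used on the unit circle. Polynomials
  are available because multiplication by 1 - z = 1/s is an average of dilations, which preserves
  the property that all dilates are orthogonal to a given function. A single \<open>rho a\<close>
  does not suffice as generator: a - a^s has further zeros on the line Re s = 1. Averaging over da/a
  replaces it by 1 - 1/s, whose only zero cancels the pole of zeta. Two more factors 1/s explain the
  exponent 3 of G: (s - 1) zeta(s) is O(|s|^2) on Re s >= 1/2, so G is continuous up to the circle,
  with value 0 at z = 1. Zeros of zeta on the critical line become zeros of G on the circle, which
  can accumulate only at z = 1. One arc round 1 leaves finitely many of them. There G is
  holomorphic; at z = 1 the bound zeta(x) >= 1 for real x > 1 takes the place of a power series. The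
  lower bound is proved for every positive number below all finite products, which covers an
  infinite product 0 as well.\<close>

lemma L2_space_measurable: "f \<in> L2_space M \<Longrightarrow> f \<in> borel_measurable M"
  by (simp add: L2_space_def)

lemma L2_space_integrable: "f \<in> L2_space M \<Longrightarrow> integrable M (\<lambda>x. (cmod (f x))\<^sup>2)"
  by (simp add: L2_space_def)

lemma L2_prod_integrable:
  assumes f: "f \<in> L2_space M" and g: "g \<in> L2_space M"
  shows "integrable M (\<lambda>x. f x * cnj (g x))"
proof (rule Bochner_Integration.integrable_bound)
  show "integrable M (\<lambda>x. (cmod (f x))\<^sup>2 + (cmod (g x))\<^sup>2)"
    using f g by (intro Bochner_Integration.integrable_add L2_space_integrable)
  note [measurable] = L2_space_measurable[OF f] L2_space_measurable[OF g]
  have [measurable]: "cnj \<in> borel_measurable borel"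
    by (intro borel_measurable_continuous_onI continuous_intros)
  show "(\<lambda>x. f x * cnj (g x)) \<in> borel_measurable M"
    by measurable
  have "a * b \<le> a\<^sup>2 + b\<^sup>2" if "a \<ge> 0" "b \<ge> 0" for a b :: real
  proof -
    have "2 * (a * b) \<le> a\<^sup>2 + b\<^sup>2" using sum_squares_bound[of a b] by simp
    moreover have "a * b \<ge> 0" using that by simp
    ultimately show ?thesis by linarith
  qed
  thus "AE x in M. norm (f x * cnj (g x)) \<le> norm ((cmod (f x))\<^sup>2 + (cmod (g x))\<^sup>2)"
    by (intro AE_I2) (simp add: norm_mult)
qed

lemma L2_space_add:
  assumes f: "f \<in> L2_space M" and g: "g \<in> L2_space M"
  shows "(\<lambda>x. f x + g x) \<in> L2_space M"
  unfolding L2_space_def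
proof (safe)
  note [measurable] = L2_space_measurable[OF f] L2_space_measurable[OF g]
  show m: "(\<lambda>x. f x + g x) \<in> borel_measurable M" by measurable
  show "integrable M (\<lambda>x. (cmod (f x + g x))\<^sup>2)"
  proof (rule Bochner_Integration.integrable_bound)
    show "integrable M (\<lambda>x. 2 * (cmod (f x))\<^sup>2 + 2 * (cmod (g x))\<^sup>2)"
      using f g by (intro Bochner_Integration.integrable_add integrable_mult_right L2_space_integrable)
    have "(cmod (a + b))\<^sup>2 \<le> 2 * (cmod a)\<^sup>2 + 2 * (cmod b)\<^sup>2" for a b
    proof -
      have "(cmod (a + b))\<^sup>2 \<le> (cmod a + cmod b)\<^sup>2"
        by (intro power_mono norm_triangle_ineq) auto
      also have "\<dots> \<le> 2 * (cmod a)\<^sup>2 + 2 * (cmod b)\<^sup>2"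
        using sum_squares_bound[of "cmod a" "cmod b"] by (simp add: power2_sum)
      finally show ?thesis .
    qed
    thus "AE x in M. norm ((cmod (f x + g x))\<^sup>2) \<le> norm (2 * (cmod (f x))\<^sup>2 + 2 * (cmod (g x))\<^sup>2)"
      by (intro AE_I2) simp
  qed measurable
qed

lemma L2_space_cmult: "f \<in> L2_space M \<Longrightarrow> (\<lambda>x. c * f x) \<in> L2_space M"
  by (auto simp: L2_space_def norm_mult power_mult_distrib)

lemma L2_space_diff:
  assumes "f \<in> L2_space M" "g \<in> L2_space M"
  shows "(\<lambda>x. f x - g x) \<in> L2_space M"
  using L2_space_add[OF assms(1) L2_space_cmult[OF assms(2), of "-1"]] by simp

lemma L2_space_zero [simp]: "(\<lambda>x. 0) \<in> L2_space M"
  by (simp add: L2_space_def)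

lemma L2_space_sum: "(\<And>i. i \<in> I \<Longrightarrow> f i \<in> L2_space M) \<Longrightarrow> (\<lambda>x. \<Sum>i\<in>I. f i x) \<in> L2_space M"
  by (induction I rule: infinite_finite_induct) (auto intro: L2_space_add)

lemma L2_inner_add_left:
  "f \<in> L2_space M \<Longrightarrow> g \<in> L2_space M \<Longrightarrow> h \<in> L2_space M \<Longrightarrow>
    L2_inner M (\<lambda>x. f x + g x) h = L2_inner M f h + L2_inner M g h"
  unfolding L2_inner_def
  by (subst Bochner_Integration.integral_add[symmetric]) (auto intro: L2_prod_integrable simp: algebra_simps)

lemma L2_inner_diff_left:
  "f \<in> L2_space M \<Longrightarrow> g \<in> L2_space M \<Longrightarrow> h \<in> L2_space M \<Longrightarrow>
    L2_inner M (\<lambda>x. f x - g x) h = L2_inner M f h - L2_inner M g h"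
  unfolding L2_inner_def
  by (subst Bochner_Integration.integral_diff[symmetric]) (auto intro: L2_prod_integrable simp: algebra_simps)

lemma L2_inner_cmult_left: "L2_inner M (\<lambda>x. c * f x) h = c * L2_inner M f h"
  unfolding L2_inner_def by (simp add: mult.assoc)

lemma L2_inner_commute: "L2_inner M g f = cnj (L2_inner M f g)"
  unfolding L2_inner_def by (simp add: Bochner_Integration.integral_cnj[symmetric] mult.commute del: Bochner_Integration.integral_cnj)

lemma L2_inner_sum_left:
  "(\<And>i. i \<in> I \<Longrightarrow> f i \<in> L2_space M) \<Longrightarrow> h \<in> L2_space M \<Longrightarrow>
    L2_inner M (\<lambda>x. \<Sum>i\<in>I. f i x) h = (\<Sum>i\<in>I. L2_inner M (f i) h)"
proof (induction I rule: infinite_finite_induct)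
  case (insert i I)
  then show ?case by (simp add: L2_inner_add_left L2_space_sum)
qed (auto simp: L2_inner_def)

lemma L2_norm_power2: "(L2_norm M f)\<^sup>2 = (LINT x|M. (cmod (f x))\<^sup>2)"
  unfolding L2_norm_def by (simp add: integral_nonneg_AE)

lemma L2_norm_nonneg [simp]: "L2_norm M f \<ge> 0"
  unfolding L2_norm_def by (simp add: integral_nonneg_AE)

lemma L2_inner_self: "L2_inner M f f = of_real ((L2_norm M f)\<^sup>2)"
  unfolding L2_norm_power2 L2_inner_def
  by (subst complex_norm_square[symmetric]) (simp flip: of_real_power)

lemma L2_norm_cmult: "L2_norm M (\<lambda>x. c * f x) = cmod c * L2_norm M f"
  unfolding L2_norm_def by (simp add: norm_mult power_mult_distrib real_sqrt_mult)

lemma L2_norm_diff_commute: "L2_norm M (\<lambda>x. f x - g x) = L2_norm M (\<lambda>x. g x - f x)"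
  unfolding L2_norm_def by (simp add: norm_minus_commute)

lemma L2_norm_diff_power2:
  assumes "f \<in> L2_space M" "g \<in> L2_space M"
  shows "(L2_norm M (\<lambda>x. f x - g x))\<^sup>2 =
    (L2_norm M f)\<^sup>2 + (L2_norm M g)\<^sup>2 - 2 * Re (L2_inner M f g)"
proof -
  have "Re (L2_inner M (\<lambda>x. f x - g x) (\<lambda>x. f x - g x)) =
        Re (L2_inner M f f + L2_inner M g g - L2_inner M f g - L2_inner M g f)"
    using assms
    by (subst (1 2) L2_inner_commute)
       (simp add: L2_inner_diff_left L2_space_diff, subst (1 2 3 4) L2_inner_commute,
        simp add: L2_inner_diff_left L2_space_diff)
  also have "\<dots> = Re (L2_inner M f f) + Re (L2_inner M g g) - 2 * Re (L2_inner M f g)"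
    by (subst (4) L2_inner_commute) simp
  finally show ?thesis by (simp add: L2_inner_self)
qed

text \<open>Moving from \<open>f\<close> along the multiple \<open>L2_inner M f g\<close> of
  \<open>g\<close> makes the cross term real. The quadratic in \<open>t\<close> yields both the
  Cauchy-Schwarz inequality and the orthogonality of a minimiser.\<close>

lemma L2_norm_diff_inner:
  assumes f: "f \<in> L2_space M" and g: "g \<in> L2_space M"
  shows "(L2_norm M (\<lambda>x. f x - (of_real t * L2_inner M f g) * g x))\<^sup>2 =
    (L2_norm M f)\<^sup>2 + t\<^sup>2 * (cmod (L2_inner M f g))\<^sup>2 * (L2_norm M g)\<^sup>2 - 2 * t * (cmod (L2_inner M f g))\<^sup>2"
proof -
  define a where "a = L2_inner M f g"
  have "(L2_norm M (\<lambda>x. f x - (of_real t * a) * g x))\<^sup>2 =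
      (L2_norm M f)\<^sup>2 + (L2_norm M (\<lambda>x. (of_real t * a) * g x))\<^sup>2
        - 2 * Re (L2_inner M f (\<lambda>x. (of_real t * a) * g x))"
    by (rule L2_norm_diff_power2[OF f L2_space_cmult[OF g]])
  also have "L2_inner M f (\<lambda>x. (of_real t * a) * g x) = of_real t * (cnj a * a)"
    by (subst L2_inner_commute) (simp add: L2_inner_cmult_left, subst L2_inner_commute, simp add: a_def)
  also have "cnj a * a = of_real ((cmod a)\<^sup>2)"
    by (simp add: complex_norm_square mult.commute del: of_real_power)
  finally show ?thesis
    by (simp add: L2_norm_cmult norm_mult power_mult_distrib a_def del: of_real_power)
qed

lemma L2_Cauchy_Schwarz:
  assumes f: "f \<in> L2_space M" and g: "g \<in> L2_space M"
  shows "cmod (L2_inner M f g) \<le> L2_norm M f * L2_norm M g"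
proof -
  define a where "a = L2_inner M f g"
  define A where "A = L2_norm M f"
  define B where "B = L2_norm M g"
  have pos: "0 \<le> A\<^sup>2 + t\<^sup>2 * (cmod a)\<^sup>2 * B\<^sup>2 - 2 * t * (cmod a)\<^sup>2" for t :: real
    unfolding a_def A_def B_def L2_norm_diff_inner[OF f g, symmetric] by simp
  have "(cmod a)\<^sup>2 \<le> (A * B)\<^sup>2"
  proof (cases "B = 0")
    \<comment> \<open>The norm of \<open>g\<close> may vanish without \<open>g\<close> being 0. Then
      the quadratic is linear in \<open>t\<close>, and a large \<open>t\<close> makes it negative
      unless the inner product is 0.\<close>
    case True
    have "cmod a = 0"
    proof (rule ccontr)
      assume "cmod a \<noteq> 0"
      hence c: "(cmod a)\<^sup>2 > 0" by simp
      have "0 \<le> A\<^sup>2 - 2 * ((A\<^sup>2 + 1) / (cmod a)\<^sup>2) * (cmod a)\<^sup>2"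
        using pos[of "(A\<^sup>2 + 1) / (cmod a)\<^sup>2"] True by simp
      also have "\<dots> = A\<^sup>2 - 2 * (A\<^sup>2 + 1)" using c by simp
      finally have "A\<^sup>2 + 2 \<le> 0" by simp
      thus False using zero_le_power2[of A] by linarith
    qed
    thus ?thesis using True by simp
  next
    case False
    hence B: "B\<^sup>2 > 0" by simp
    have "(1 / B\<^sup>2)\<^sup>2 * (cmod a)\<^sup>2 * B\<^sup>2 = (cmod a)\<^sup>2 / B\<^sup>2"
      using False by (simp add: field_simps power2_eq_square)
    hence "0 \<le> A\<^sup>2 - (cmod a)\<^sup>2 / B\<^sup>2"
      using pos[of "1 / B\<^sup>2"] by simp
    thus ?thesis using B by (simp add: field_simps)
  qed
  hence "cmod a \<le> A * B"
    by (rule power2_le_imp_le) (simp add: A_def B_def)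
  thus ?thesis by (simp add: a_def A_def B_def)
qed

lemma L2_norm_triangle:
  assumes f: "f \<in> L2_space M" and g: "g \<in> L2_space M"
  shows "L2_norm M (\<lambda>x. f x + g x) \<le> L2_norm M f + L2_norm M g"
proof -
  have "(L2_norm M (\<lambda>x. f x - (-1) * g x))\<^sup>2 = (L2_norm M f)\<^sup>2 + (L2_norm M (\<lambda>x. (-1) * g x))\<^sup>2
    - 2 * Re (L2_inner M f (\<lambda>x. (-1) * g x))"
    by (rule L2_norm_diff_power2[OF f L2_space_cmult[OF g]])
  also have "Re (L2_inner M f (\<lambda>x. (-1) * g x)) = - Re (L2_inner M f g)"
    by (subst L2_inner_commute) (simp only: L2_inner_cmult_left, subst L2_inner_commute, simp)
  also have "L2_norm M (\<lambda>x. (-1) * g x) = L2_norm M g" by (simp only: L2_norm_cmult) simp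
  finally have "(L2_norm M (\<lambda>x. f x + g x))\<^sup>2 =
      (L2_norm M f)\<^sup>2 + (L2_norm M g)\<^sup>2 + 2 * Re (L2_inner M f g)" by simp
  also have "Re (L2_inner M f g) \<le> L2_norm M f * L2_norm M g"
    using L2_Cauchy_Schwarz[OF f g] complex_Re_le_cmod order_trans by blast
  finally have "(L2_norm M (\<lambda>x. f x + g x))\<^sup>2 \<le> (L2_norm M f + L2_norm M g)\<^sup>2"
    by (simp add: power2_sum)
  thus ?thesis by (rule power2_le_imp_le) simp
qed

lemma L2_norm_triangle_diff:
  assumes f: "f \<in> L2_space M" and g: "g \<in> L2_space M" and h: "h \<in> L2_space M"
  shows "L2_norm M (\<lambda>x. f x - h x) \<le> L2_norm M (\<lambda>x. f x - g x) + L2_norm M (\<lambda>x. g x - h x)"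
  using L2_norm_triangle[OF L2_space_diff[OF f g] L2_space_diff[OF g h]] by simp

lemma lin_span_L2:
  assumes "S \<subseteq> L2_space M" "g \<in> lin_span S" shows "g \<in> L2_space M"
  using assms by (force simp: lin_span_def intro!: L2_space_sum L2_space_cmult)

lemma lin_span_zero: "(\<lambda>x. 0) \<in> lin_span S"
  unfolding lin_span_def by (intro CollectI exI[of _ "\<lambda>_. 0"] exI[of _ "{}"]) auto

lemma lin_span_base: "h \<in> S \<Longrightarrow> h \<in> lin_span S"
  unfolding lin_span_def by (intro CollectI exI[of _ "\<lambda>_. 1"] exI[of _ "{h}"]) auto

lemma lin_span_cmult: assumes "f \<in> lin_span S" shows "(\<lambda>x. a * f x) \<in> lin_span S"
proof -
  from assms obtain c F where f: "f = (\<lambda>x. \<Sum>h\<in>F. c h * h x)" "finite F" "F \<subseteq> S"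
    by (auto simp: lin_span_def)
  show ?thesis unfolding lin_span_def
    by (intro CollectI exI[of _ "\<lambda>h. a * c h"] exI[of _ F]) (auto simp: f sum_distrib_left mult.assoc)
qed

lemma lin_span_add:
  assumes "f \<in> lin_span S" "g \<in> lin_span S" shows "(\<lambda>x. f x + g x) \<in> lin_span S"
proof -
  from assms obtain c F d G where f: "f = (\<lambda>x. \<Sum>h\<in>F. c h * h x)" "finite F" "F \<subseteq> S"
    and g: "g = (\<lambda>x. \<Sum>h\<in>G. d h * h x)" "finite G" "G \<subseteq> S"
    by (auto simp: lin_span_def)
  define c' d' where "c' = (\<lambda>h. if h \<in> F then c h else 0)" and "d' = (\<lambda>h. if h \<in> G then d h else 0)"
  have "(\<Sum>h\<in>F. c h * h x) = (\<Sum>h\<in>F \<union> G. c' h * h x)" for x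
    using f g by (intro sum.mono_neutral_cong_left) (auto simp: c'_def)
  moreover have "(\<Sum>h\<in>G. d h * h x) = (\<Sum>h\<in>F \<union> G. d' h * h x)" for x
    using f g by (intro sum.mono_neutral_cong_left) (auto simp: d'_def)
  ultimately have "(\<lambda>x. f x + g x) = (\<lambda>x. \<Sum>h\<in>F \<union> G. (c' h + d' h) * h x)"
    by (simp add: f(1) g(1) sum.distrib algebra_simps)
  thus ?thesis unfolding lin_span_def using f g
    by (intro CollectI exI[of _ "\<lambda>h. c' h + d' h"] exI[of _ "F \<union> G"]) auto
qed

lemma nn_integral_cmod_square:
  assumes "f \<in> L2_space M"
  shows "(\<integral>\<^sup>+x. ennreal ((cmod (f x))\<^sup>2) \<partial>M) = ennreal ((L2_norm M f)\<^sup>2)"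
  unfolding L2_norm_power2 by (rule nn_integral_eq_integral[OF L2_space_integrable[OF assms]]) simp

lemma L2_spaceI_nn_integral:
  assumes [measurable]: "f \<in> borel_measurable M"
    and le: "(\<integral>\<^sup>+x. ennreal ((cmod (f x))\<^sup>2) \<partial>M) \<le> ennreal (B\<^sup>2)" and B: "B \<ge> 0"
  shows "f \<in> L2_space M" "L2_norm M f \<le> B"
proof -
  have "integrable M (\<lambda>x. (cmod (f x))\<^sup>2)"
    by (intro integrableI_bounded) (use le in \<open>auto simp: less_top[symmetric] top_unique\<close>)
  thus f: "f \<in> L2_space M" by (simp add: L2_space_def)
  have "ennreal ((L2_norm M f)\<^sup>2) \<le> ennreal (B\<^sup>2)"
    using le nn_integral_cmod_square[OF f] by simp
  hence "(L2_norm M f)\<^sup>2 \<le> B\<^sup>2" by (subst (asm) ennreal_le_iff) auto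
  thus "L2_norm M f \<le> B" using B by (rule power2_le_imp_le)
qed

text \<open>Riesz-Fischer. Along a subsequence with steps of norm at most 2^-j the sum of 2^j times
  the squared steps has finite integral, which gives convergence almost everywhere; Fatou's lemma
  then transfers the Cauchy bound to the limit.\<close>

theorem L2_complete:
  assumes f: "\<And>n. f n \<in> L2_space M"
    and cauchy: "\<And>e. e > 0 \<Longrightarrow> \<exists>N. \<forall>m\<ge>N. \<forall>n\<ge>N. L2_norm M (\<lambda>x. f m x - f n x) < e"
  obtains F where "F \<in> L2_space M" "(\<lambda>n. L2_norm M (\<lambda>x. f n x - F x)) \<longlonglongrightarrow> 0"
proof -
  have [measurable]: "f n \<in> borel_measurable M" for n using f L2_space_measurable by blast
  have "\<exists>N. \<forall>m\<ge>N. \<forall>n\<ge>N. L2_norm M (\<lambda>x. f m x - f n x) < (1/2) ^ j" for j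
    by (rule cauchy) simp
  then obtain N where N: "\<And>j m n. m \<ge> N j \<Longrightarrow> n \<ge> N j \<Longrightarrow> L2_norm M (\<lambda>x. f m x - f n x) < (1/2) ^ j"
    by metis
  \<comment> \<open>The sum makes \<open>k\<close> increasing, so consecutive indices both lie above
    \<open>N j\<close>; the summand \<open>j\<close> makes it unbounded.\<close>
  define k where "k = (\<lambda>j. (\<Sum>i\<le>j. N i) + j)"
  have k1: "k j \<ge> N j" "k j \<ge> j" for j
    unfolding k_def by (auto intro!: trans_le_add1 member_le_sum)
  have "k (Suc j) \<ge> k j" for j unfolding k_def by simp
  hence k: "k j \<ge> N j" "k (Suc j) \<ge> N j" "k j \<ge> j" for j
    using k1 order_trans by blast+
  define h where "h = (\<lambda>j x. f (k (Suc j)) x - f (k j) x)"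
  have h_norm: "L2_norm M (h j) \<le> (1/2) ^ j" for j
    unfolding h_def by (intro less_imp_le N k)
  have hL2: "h j \<in> L2_space M" for j unfolding h_def by (intro L2_space_diff f)
  have [measurable]: "h j \<in> borel_measurable M" for j using hL2 L2_space_measurable by blast
  have "(\<integral>\<^sup>+x. (\<Sum>j. ennreal (2 ^ j * (cmod (h j x))\<^sup>2)) \<partial>M) = (\<Sum>j. \<integral>\<^sup>+x. ennreal (2 ^ j * (cmod (h j x))\<^sup>2) \<partial>M)"
    by (intro nn_integral_suminf) measurable
  also have "\<dots> = (\<Sum>j. ennreal (2 ^ j * (L2_norm M (h j))\<^sup>2))"
    by (simp add: ennreal_mult nn_integral_cmult nn_integral_cmod_square[OF hL2])
  also have "\<dots> \<le> (\<Sum>j. ennreal ((1/2) ^ j))"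
  proof (intro suminf_le ennreal_leI summableI)
    fix j
    have "2 ^ j * (L2_norm M (h j))\<^sup>2 \<le> 2 ^ j * ((1/2) ^ j)\<^sup>2"
      using h_norm[of j] by (intro mult_left_mono power_mono) auto
    also have "\<dots> = (1/2) ^ j"
      by (simp add: power_mult_distrib power2_eq_square power_one_over)
    finally show "2 ^ j * (L2_norm M (h j))\<^sup>2 \<le> (1/2) ^ j" .
  qed
  also have "\<dots> = ennreal (\<Sum>j. (1/2) ^ j)"
    by (intro suminf_ennreal2) auto
  finally have "(\<integral>\<^sup>+x. (\<Sum>j. ennreal (2 ^ j * (cmod (h j x))\<^sup>2)) \<partial>M) \<noteq> \<infinity>"
    by (auto simp: top_unique)
  hence "AE x in M. (\<Sum>j. ennreal (2 ^ j * (cmod (h j x))\<^sup>2)) \<noteq> \<infinity>"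
    by (intro nn_integral_PInf_AE) auto
  hence conv: "AE x in M. convergent (\<lambda>j. f (k j) x)"
  proof eventually_elim
    case (elim x)
    hence s: "summable (\<lambda>j. 2 ^ j * (cmod (h j x))\<^sup>2)"
      by (intro summable_suminf_not_top) auto
    have "summable (\<lambda>j. h j x)"
    proof (rule summable_comparison_test')
      show "summable (\<lambda>j. (1/2) ^ j + 2 ^ j * (cmod (h j x))\<^sup>2)"
        by (intro summable_add s summable_geometric) auto
      fix j
      define a where "a = cmod (h j x)"
      \<comment> \<open>Arithmetic and geometric mean: \<open>a\<close> is at most 2^-j + 2^j a^2,
        and both terms are summable.\<close>
      have "0 \<le> (1 - 2 ^ j * a)\<^sup>2" by simp
      hence "2 * (2 ^ j * a) \<le> 1 + (2 ^ j * a)\<^sup>2" by (simp add: power2_diff)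
      moreover have "2 ^ j * a \<ge> 0" by (simp add: a_def)
      ultimately have "2 ^ j * a \<le> 1 + (2 ^ j * a)\<^sup>2" by linarith
      also have "\<dots> = 2 ^ j * ((1/2) ^ j + 2 ^ j * a\<^sup>2)"
        by (simp add: power_mult_distrib power2_eq_square algebra_simps power_one_over)
      finally show "norm (h j x) \<le> (1/2) ^ j + 2 ^ j * (cmod (h j x))\<^sup>2"
        by (simp add: a_def)
    qed
    hence "convergent (\<lambda>n. \<Sum>j<n. h j x)" by (simp add: summable_iff_convergent)
    moreover have "(\<Sum>j<n. h j x) = f (k n) x - f (k 0) x" for n
      unfolding h_def by (rule sum_lessThan_telescope)
    ultimately have "convergent (\<lambda>n. f (k n) x - f (k 0) x)" by simp
    hence "convergent (\<lambda>n. (f (k n) x - f (k 0) x) + f (k 0) x)"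
      by (intro convergent_add convergent_const)
    thus ?case by simp
  qed
  define F where "F = (\<lambda>x. lim (\<lambda>j. f (k j) x))"
  have [measurable]: "F \<in> borel_measurable M"
    unfolding F_def by (intro borel_measurable_lim_metric) measurable
  have bound: "(\<lambda>x. F x - f n x) \<in> L2_space M \<and> L2_norm M (\<lambda>x. F x - f n x) \<le> (1/2) ^ i"
    if n: "n \<ge> N i" for n i
  proof -
    have "(\<integral>\<^sup>+x. ennreal ((cmod (F x - f n x))\<^sup>2) \<partial>M) =
          (\<integral>\<^sup>+x. liminf (\<lambda>j. ennreal ((cmod (f (k j) x - f n x))\<^sup>2)) \<partial>M)"
    proof (rule nn_integral_cong_AE, use conv in eventually_elim)
      case (elim x)
      hence "(\<lambda>j. f (k j) x) \<longlonglongrightarrow> F x" unfolding F_def by (rule convergent_LIMSEQ_iff[THEN iffD1])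
      hence "(\<lambda>j. ennreal ((cmod (f (k j) x - f n x))\<^sup>2)) \<longlonglongrightarrow> ennreal ((cmod (F x - f n x))\<^sup>2)"
        by (intro tendsto_intros)
      thus ?case by (intro lim_imp_Liminf[symmetric]) auto
    qed
    also have "\<dots> \<le> liminf (\<lambda>j. \<integral>\<^sup>+x. ennreal ((cmod (f (k j) x - f n x))\<^sup>2) \<partial>M)"
      by (intro nn_integral_liminf) measurable
    also have "\<dots> \<le> liminf (\<lambda>j. ennreal (((1/2) ^ i)\<^sup>2))"
    proof (intro Liminf_mono eventually_sequentiallyI[of "N i"])
      fix j assume "j \<ge> N i"
      hence "k j \<ge> N i" using k(3)[of j] by linarith
      hence "L2_norm M (\<lambda>x. f (k j) x - f n x) \<le> (1/2) ^ i" using N n less_imp_le by blast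
      hence "(L2_norm M (\<lambda>x. f (k j) x - f n x))\<^sup>2 \<le> ((1/2) ^ i)\<^sup>2" by (intro power_mono) auto
      thus "(\<integral>\<^sup>+x. ennreal ((cmod (f (k j) x - f n x))\<^sup>2) \<partial>M) \<le> ennreal (((1/2) ^ i)\<^sup>2)"
        by (subst nn_integral_cmod_square[OF L2_space_diff[OF f f]]) (rule ennreal_leI)
    qed
    also have "\<dots> = ennreal (((1/2) ^ i)\<^sup>2)" by (rule lim_imp_Liminf) auto
    finally have *: "(\<integral>\<^sup>+x. ennreal ((cmod (F x - f n x))\<^sup>2) \<partial>M) \<le> ennreal (((1/2) ^ i)\<^sup>2)" .
    show ?thesis using L2_spaceI_nn_integral[OF _ *] by simp
  qed
  have FL2: "F \<in> L2_space M"
    using L2_space_add[OF conjunct1[OF bound[OF order_refl, of 0]] f[of "N 0"]] by simp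
  have "(\<lambda>n. L2_norm M (\<lambda>x. f n x - F x)) \<longlonglongrightarrow> 0"
  proof (rule LIMSEQ_I)
    fix e :: real assume "e > 0"
    then obtain i where "(1/2) ^ i < e" using real_arch_pow_inv[of e "1/2"] by auto
    thus "\<exists>no. \<forall>n\<ge>no. norm (L2_norm M (\<lambda>x. f n x - F x) - 0) < e"
      using bound by (intro exI[of _ "N i"]) (auto simp: L2_norm_diff_commute[of M F] intro: order_le_less_trans)
  qed
  thus thesis using that FL2 by blast
qed

lemma L2_inner_zero_if_minimal:
  assumes f: "f \<in> L2_space M" and g: "g \<in> L2_space M"
    and min: "\<And>c. L2_norm M f \<le> L2_norm M (\<lambda>x. f x - c * g x)"
  shows "L2_inner M f g = 0"
proof (rule ccontr)
  define a B where "a = (cmod (L2_inner M f g))\<^sup>2" and "B = (L2_norm M g)\<^sup>2"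
  \<comment> \<open>The denominator is \<open>B + 1\<close> because the norm of \<open>g\<close> may
    vanish; it still gives \<open>t * B < 2\<close>.\<close>
  define t where "t = 1 / (B + 1)"
  assume "L2_inner M f g \<noteq> 0"
  hence a: "a > 0" by (simp add: a_def)
  have B: "B \<ge> 0" by (simp add: B_def)
  have "(L2_norm M f)\<^sup>2 \<le> (L2_norm M (\<lambda>x. f x - (of_real t * L2_inner M f g) * g x))\<^sup>2"
    by (intro power_mono min) auto
  hence "0 \<le> t\<^sup>2 * a * B - 2 * t * a"
    unfolding L2_norm_diff_inner[OF f g] by (simp add: a_def B_def)
  also have "\<dots> = t * a * (t * B - 2)" by (simp add: power2_eq_square algebra_simps)
  finally have "0 \<le> t * a * (t * B - 2)" .
  moreover have "t * B - 2 < 0" "t > 0" using B by (auto simp: t_def field_simps)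
  ultimately show False using a by (meson mult_pos_neg mult_pos_pos not_le)
qed

text \<open>A minimising sequence in the linear span is Cauchy by the parallelogram law, and its
  limit is the projection. Elements of the closed span enter the orthogonality proof through
  approximants in the span, where the infimum \<open>d\<close> is available.\<close>

theorem L2_projection_exists:
  assumes S: "S \<subseteq> L2_space M" and f: "f \<in> L2_space M"
  obtains p where "p \<in> L2_closed_span M S"
    "\<And>g. g \<in> L2_closed_span M S \<Longrightarrow> L2_inner M (\<lambda>x. f x - p x) g = 0"
proof -
  define D where "D = (\<lambda>g. L2_norm M (\<lambda>x. f x - g x)) ` lin_span S"
  define d where "d = Inf D"
  have D0: "D \<noteq> {}" "bdd_below D" using lin_span_zero[of S] by (auto simp: D_def intro!: bdd_belowI[of _ 0])
  have d_le: "d \<le> L2_norm M (\<lambda>x. f x - g x)" if "g \<in> lin_span S" for g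
    unfolding d_def using that D0 by (intro cInf_lower) (auto simp: D_def)
  have d0: "d \<ge> 0" unfolding d_def using D0 by (intro cInf_greatest) (auto simp: D_def)
  have "\<exists>g\<in>lin_span S. L2_norm M (\<lambda>x. f x - g x) < d + 1 / Suc n" for n
  proof -
    have "d < d + 1 / Suc n" by simp
    then obtain y where "y \<in> D" "y < d + 1 / Suc n" unfolding d_def using cInf_lessD[OF D0(1)] by blast
    thus ?thesis by (auto simp: D_def)
  qed
  then obtain g where gS: "\<And>n. g n \<in> lin_span S" and gd: "\<And>n. L2_norm M (\<lambda>x. f x - g n x) < d + 1 / Suc n"
    by metis
  have gL2: "g n \<in> L2_space M" for n using lin_span_L2[OF S gS] .
  have par: "(L2_norm M (\<lambda>x. g m x - g n x))\<^sup>2 \<le> 4 * ((d + 1 / Suc N)\<^sup>2 - d\<^sup>2)" if "m \<ge> N" "n \<ge> N" for m n N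
  proof -
    define u v where "u = (\<lambda>x. f x - g m x)" and "v = (\<lambda>x. f x - g n x)"
    have uv: "u \<in> L2_space M" "v \<in> L2_space M" by (auto simp: u_def v_def intro: L2_space_diff f gL2)
    have 1: "(L2_norm M (\<lambda>x. u x - v x))\<^sup>2 = (L2_norm M u)\<^sup>2 + (L2_norm M v)\<^sup>2 - 2 * Re (L2_inner M u v)"
      by (rule L2_norm_diff_power2[OF uv])
    have "(L2_norm M (\<lambda>x. u x - (-1) * v x))\<^sup>2 = (L2_norm M u)\<^sup>2 + (L2_norm M (\<lambda>x. (-1) * v x))\<^sup>2
         - 2 * Re (L2_inner M u (\<lambda>x. (-1) * v x))"
      by (rule L2_norm_diff_power2[OF uv(1) L2_space_cmult[OF uv(2)]])
    also have "Re (L2_inner M u (\<lambda>x. (-1) * v x)) = - Re (L2_inner M u v)"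
      by (subst L2_inner_commute) (simp only: L2_inner_cmult_left, subst L2_inner_commute, simp)
    also have "L2_norm M (\<lambda>x. (-1) * v x) = L2_norm M v" by (simp only: L2_norm_cmult) simp
    finally have 2: "(L2_norm M (\<lambda>x. u x + v x))\<^sup>2 = (L2_norm M u)\<^sup>2 + (L2_norm M v)\<^sup>2 + 2 * Re (L2_inner M u v)"
      by simp
    \<comment> \<open>The midpoint of \<open>g m\<close> and \<open>g n\<close> lies in the span, so
      \<open>u + v\<close> has norm at least \<open>2 * d\<close> and the parallelogram law forces
      \<open>u - v\<close> to be small.\<close>
    have "(\<lambda>x. (1/2) * (g m x + g n x)) \<in> lin_span S" by (intro lin_span_cmult lin_span_add gS)
    hence "d \<le> L2_norm M (\<lambda>x. f x - (1/2) * (g m x + g n x))" by (rule d_le)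
    also have "(\<lambda>x. f x - (1/2) * (g m x + g n x)) = (\<lambda>x. (1/2) * (u x + v x))"
      by (auto simp: u_def v_def algebra_simps)
    also have "L2_norm M \<dots> = L2_norm M (\<lambda>x. u x + v x) / 2"
      by (subst L2_norm_cmult) (simp add: norm_divide)
    finally have "(2 * d)\<^sup>2 \<le> (L2_norm M (\<lambda>x. u x + v x))\<^sup>2" using d0 by (intro power_mono) auto
    moreover have "(L2_norm M u)\<^sup>2 \<le> (d + 1 / Suc N)\<^sup>2" "(L2_norm M v)\<^sup>2 \<le> (d + 1 / Suc N)\<^sup>2"
    proof -
      have "1 / real (Suc m) \<le> 1 / real (Suc N)" "1 / real (Suc n) \<le> 1 / real (Suc N)"
        using that by (auto intro!: divide_left_mono)
      thus "(L2_norm M u)\<^sup>2 \<le> (d + 1 / Suc N)\<^sup>2" "(L2_norm M v)\<^sup>2 \<le> (d + 1 / Suc N)\<^sup>2"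
        using gd[of m] gd[of n] by (auto simp: u_def v_def intro!: power_mono)
    qed
    ultimately have "(L2_norm M (\<lambda>x. u x - v x))\<^sup>2 \<le> 4 * ((d + 1 / Suc N)\<^sup>2 - d\<^sup>2)"
      using 1 2 by simp
    also have "L2_norm M (\<lambda>x. u x - v x) = L2_norm M (\<lambda>x. g m x - g n x)"
      by (simp add: u_def v_def L2_norm_diff_commute[of M "g n"])
    finally show ?thesis .
  qed
  have lim0: "(\<lambda>N. 4 * ((d + 1 / Suc N)\<^sup>2 - d\<^sup>2)) \<longlonglongrightarrow> 4 * ((d + 0)\<^sup>2 - d\<^sup>2)"
    by (intro tendsto_intros LIMSEQ_Suc[OF lim_const_over_n[of 1, simplified]])
  obtain p where p: "p \<in> L2_space M" and lim: "(\<lambda>n. L2_norm M (\<lambda>x. g n x - p x)) \<longlonglongrightarrow> 0"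
  proof (rule L2_complete[OF gL2])
    fix e :: real assume e: "e > 0"
    hence "\<forall>\<^sub>F N in sequentially. 4 * ((d + 1 / Suc N)\<^sup>2 - d\<^sup>2) < e\<^sup>2"
      using order_tendstoD(2)[OF lim0, of "e\<^sup>2"] by simp
    then obtain N where N: "4 * ((d + 1 / Suc N)\<^sup>2 - d\<^sup>2) < e\<^sup>2"
      by (auto simp: eventually_sequentially)
    have "L2_norm M (\<lambda>x. g m x - g n x) < e" if "m \<ge> N" "n \<ge> N" for m n
      using par[OF that] N e by (intro power2_less_imp_less[of _ e]) auto
    thus "\<exists>N. \<forall>m\<ge>N. \<forall>n\<ge>N. L2_norm M (\<lambda>x. g m x - g n x) < e" by blast
  qed blast
  have "p \<in> L2_closed_span M S"
    unfolding L2_closed_span_def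
  proof (safe, fact p)
    fix e :: real assume "e > 0"
    hence "\<forall>\<^sub>F n in sequentially. L2_norm M (\<lambda>x. g n x - p x) < e"
      using order_tendstoD(2)[OF lim] by simp
    then obtain n where "L2_norm M (\<lambda>x. g n x - p x) < e" by (auto simp: eventually_sequentially)
    thus "\<exists>g\<in>lin_span S. L2_norm M (\<lambda>x. p x - g x) < e"
      using gS by (intro bexI[of _ "g n"]) (auto simp: L2_norm_diff_commute[of M p])
  qed
  moreover have "L2_inner M (\<lambda>x. f x - p x) u = 0" if u: "u \<in> L2_closed_span M S" for u
  proof (rule L2_inner_zero_if_minimal)
    show fp: "(\<lambda>x. f x - p x) \<in> L2_space M" by (intro L2_space_diff f p)
    show uL: "u \<in> L2_space M" using u by (simp add: L2_closed_span_def)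
    fix c
    have "L2_norm M (\<lambda>x. f x - p x) \<le> d"
    proof (rule LIMSEQ_le_const)
      show "(\<lambda>n. (d + 1 / Suc n) + L2_norm M (\<lambda>x. g n x - p x)) \<longlonglongrightarrow> d"
      proof -
        have "(\<lambda>n. (d + 1 / Suc n) + L2_norm M (\<lambda>x. g n x - p x)) \<longlonglongrightarrow> (d + 0) + 0"
          by (intro tendsto_intros lim LIMSEQ_Suc[OF lim_const_over_n[of 1, simplified]])
        thus ?thesis by simp
      qed
      show "\<exists>N. \<forall>n\<ge>N. L2_norm M (\<lambda>x. f x - p x) \<le> d + 1 / real (Suc n) + L2_norm M (\<lambda>x. g n x - p x)"
        using L2_norm_triangle_diff[OF f gL2 p] gd by (intro exI[of _ 0]) (smt (verit))
    qed
    also have "d \<le> L2_norm M (\<lambda>x. f x - p x - c * u x)"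
    proof (rule field_le_epsilon)
      fix e :: real assume e: "e > 0"
      \<comment> \<open>Approximating \<open>p\<close> costs \<open>e'\<close> and approximating
        \<open>c * u\<close> costs \<open>cmod c * e'\<close>.\<close>
      define e' where "e' = e / (1 + cmod c)"
      have c1: "1 + cmod c > 0" by (simp add: add_pos_nonneg)
      hence "e' * (1 + cmod c) = e" by (simp add: e'_def)
      moreover have "e' > 0" using e c1 by (simp add: e'_def)
      ultimately have e': "e' > 0" "e' + cmod c * e' = e" by (simp_all add: algebra_simps)
      obtain v where v: "v \<in> lin_span S" "L2_norm M (\<lambda>x. u x - v x) < e'"
        using u e' by (auto simp: L2_closed_span_def)
      obtain q where q: "q \<in> lin_span S" "L2_norm M (\<lambda>x. p x - q x) < e'"
        using \<open>p \<in> L2_closed_span M S\<close> e' by (auto simp: L2_closed_span_def)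
      have vL: "v \<in> L2_space M" and qL: "q \<in> L2_space M" using lin_span_L2[OF S] v q by auto
      have "(\<lambda>x. q x + c * v x) \<in> lin_span S" by (intro lin_span_add lin_span_cmult q v)
      hence "d \<le> L2_norm M (\<lambda>x. f x - (q x + c * v x))" by (rule d_le)
      also have "(\<lambda>x. f x - (q x + c * v x)) = (\<lambda>x. (f x - p x - c * u x) + ((p x - q x) + c * (u x - v x)))"
        by (auto simp: algebra_simps)
      also have "L2_norm M \<dots> \<le> L2_norm M (\<lambda>x. f x - p x - c * u x) + L2_norm M (\<lambda>x. (p x - q x) + c * (u x - v x))"
        by (intro L2_norm_triangle L2_space_diff L2_space_add L2_space_cmult f p uL vL qL)
      also have "L2_norm M (\<lambda>x. (p x - q x) + c * (u x - v x)) \<le> L2_norm M (\<lambda>x. p x - q x) + L2_norm M (\<lambda>x. c * (u x - v x))"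
        by (intro L2_norm_triangle L2_space_diff L2_space_add L2_space_cmult f p uL vL qL)
      also have "L2_norm M (\<lambda>x. c * (u x - v x)) = cmod c * L2_norm M (\<lambda>x. u x - v x)"
        by (rule L2_norm_cmult)
      also have "\<dots> \<le> cmod c * e'" using v by (intro mult_left_mono) auto
      finally show "d \<le> L2_norm M (\<lambda>x. f x - p x - c * u x) + e" using q(2) e'(2) by linarith
    qed
    finally show "L2_norm M (\<lambda>x. f x - p x) \<le> L2_norm M (\<lambda>x. f x - p x - c * u x)" .
  qed
  ultimately show thesis using that by blast
qed

section \<open>Poisson-Jensen theory and outer polynomials on the unit disc\<close>

definition circ :: "real \<Rightarrow> complex" where
  "circ x = exp (2 * complex_of_real pi * \<i> * complex_of_real x)"

lemma norm_circ [simp]: "cmod (circ x) = 1"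
  by (simp add: circ_def)

lemma continuous_on_circ [continuous_intros]: "continuous_on A circ"
  unfolding circ_def by (intro continuous_intros)

definition poisson_kernel :: "real \<Rightarrow> complex \<Rightarrow> complex \<Rightarrow> real" where
  "poisson_kernel r w u = (r\<^sup>2 - (cmod w)\<^sup>2) / (cmod (u - w))\<^sup>2"

text \<open>Cauchy's formula at \<open>w\<close> for \<open>L * c / D\<close>. Here
  \<open>D w = c\<close>, and on the circle \<open>D u = u * cnj (u - w)\<close>, so the Cauchy
  kernel turns into the Poisson kernel.\<close>

lemma poisson_formula:
  assumes L: "L holomorphic_on ball 0 R" and r: "0 < r" "r < R" and w: "cmod w < r"
  shows "((\<lambda>x. poisson_kernel r w (of_real r * circ x) * Re (L (of_real r * circ x)))
            has_integral Re (L w)) {0..1}"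
proof -
  define D where "D = (\<lambda>u. of_real (r\<^sup>2) - cnj w * u)"
  define c where "c = complex_of_real (r\<^sup>2 - (cmod w)\<^sup>2)"
  define f where "f = (\<lambda>u. L u * c / D u)"
  have D0: "D u \<noteq> 0" if "cmod u \<le> r" for u
  proof
    assume "D u = 0"
    hence "cmod (of_real (r\<^sup>2)) = cmod (cnj w * u)" by (simp add: D_def)
    hence "r\<^sup>2 = cmod w * cmod u" by (simp add: norm_mult norm_power)
    also have "\<dots> \<le> cmod w * r" using that by (intro mult_left_mono) auto
    also have "\<dots> < r * r" using w r by (intro mult_strict_right_mono) auto
    finally show False by (simp add: power2_eq_square)
  qed
  have c0: "c \<noteq> 0"
  proof -
    have "(cmod w)\<^sup>2 < r\<^sup>2" using w by (intro power_strict_mono) auto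
    thus ?thesis unfolding c_def of_real_eq_0_iff by linarith
  qed
  have Dw: "D w = c"
    by (simp add: D_def c_def complex_norm_square mult.commute del: of_real_power)
  have "f holomorphic_on cball 0 r"
    unfolding f_def D_def
    by (intro holomorphic_intros holomorphic_on_subset[OF L]) (use r D0 in \<open>auto simp: D_def\<close>)
  hence "((\<lambda>u. f u / (u - w)) has_contour_integral 2 * of_real pi * \<i> * f w) (circlepath 0 r)"
    using w by (intro Cauchy_integral_circlepath holomorphic_on_imp_continuous_on)
      (auto intro: holomorphic_on_subset)
  hence 1: "((\<lambda>x. f (of_real r * circ x) / (of_real r * circ x - w) *
          (of_real (2 * pi) * \<i> * of_real r * circ x)) has_integral 2 * of_real pi * \<i> * f w) {0..1}"
    unfolding has_contour_integral vector_derivative_circlepath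
    by (simp add: circ_def circlepath mult_ac)
  have fw: "f w = L w" using c0 Dw by (simp add: f_def)
  have eq: "f u / (u - w) * (of_real (2 * pi) * \<i> * of_real r * circ x) =
      2 * of_real pi * \<i> * (of_real (poisson_kernel r w u) * L u)"
    if u: "u = of_real r * circ x" for u x
  proof -
    have uu: "u * cnj u = of_real (r\<^sup>2)"
      using u r complex_norm_square[of u] by (simp add: norm_mult)
    have Du: "D u = u * cnj (u - w)"
      by (simp add: D_def uu[symmetric] algebra_simps del: of_real_power)
    have u0: "u \<noteq> 0" using u r by (metis norm_circ norm_zero norm_mult mult_eq_0_iff of_real_eq_0_iff zero_neq_one less_irrefl)
    have p: "u - w \<noteq> 0" using w u r by (auto simp: norm_mult)
    have k: "(of_real ((cmod (u - w))\<^sup>2) :: complex) = (u - w) * cnj (u - w)"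
      by (simp add: complex_norm_square del: of_real_power)
    have cc: "of_real (2 * pi) * \<i> * of_real r * circ x = 2 * of_real pi * \<i> * u"
      by (simp add: u)
    have alg: "l * c / (u * q) / p * (2 * of_real pi * \<i> * u) = 2 * of_real pi * \<i> * (c / (p * q) * l)"
      if "p \<noteq> 0" "q \<noteq> 0" for l c p q :: complex
      using that u0 by (simp add: field_simps)
    show ?thesis
      unfolding f_def Du poisson_kernel_def c_def of_real_divide k cc
      by (rule alg) (use p in \<open>simp_all only: complex_cnj_zero_iff not_False_eq_True\<close>)
  qed
  have "((\<lambda>x. 2 * of_real pi * \<i> * (of_real (poisson_kernel r w (of_real r * circ x)) * L (of_real r * circ x)))
          has_integral 2 * of_real pi * \<i> * L w) {0..1}"
    using 1 unfolding fw by (subst eq[OF refl, symmetric]) simp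
  hence "((\<lambda>x. (2 * of_real pi * \<i>) * (of_real (poisson_kernel r w (of_real r * circ x)) * L (of_real r * circ x)) / (2 * of_real pi * \<i>))
          has_integral (2 * of_real pi * \<i> * L w) / (2 * of_real pi * \<i>)) {0..1}"
    by (rule has_integral_divide)
  hence "((\<lambda>x. of_real (poisson_kernel r w (of_real r * circ x)) * L (of_real r * circ x))
          has_integral L w) {0..1}"
    by simp
  from has_integral_Re[OF this] show ?thesis by simp
qed

text \<open>The exponents are read off from \<Phi> and not from the successive quotients; points of
  \<open>F\<close> where \<Phi> does not vanish get exponent 0.\<close>

lemma factor_out_zeros:
  assumes \<Phi>: "\<Phi> holomorphic_on S" and S: "open S" "connected S"
    and nz: "\<exists>z\<in>S. \<Phi> z \<noteq> 0" and F: "finite F" "F \<subseteq> S"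
  shows "\<exists>H. H holomorphic_on S \<and> (\<forall>w\<in>F. H w \<noteq> 0) \<and>
          (\<forall>z\<in>S. \<Phi> z = (\<Prod>w\<in>F. (z - w) ^ nat (zorder \<Phi> w)) * H z)"
  using F
proof (induction F rule: finite_induct)
  case empty
  then show ?case using \<Phi> by auto
next
  case (insert w F)
  then obtain H where H: "H holomorphic_on S" "\<forall>w\<in>F. H w \<noteq> 0"
    "\<And>z. z \<in> S \<Longrightarrow> \<Phi> z = (\<Prod>w\<in>F. (z - w) ^ nat (zorder \<Phi> w)) * H z" by auto
  define n where "n = nat (zorder \<Phi> w)"
  define Q where "Q = (\<lambda>z. \<Prod>w\<in>F. (z - w) ^ nat (zorder \<Phi> w))"
  have wS: "w \<in> S" using insert by auto
  from zorder_exist_zero[OF \<Phi> S wS nz] obtain r p where r: "r > 0" "cball w r \<subseteq> S"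
    and p: "p holomorphic_on cball w r"
    "\<And>z. z \<in> cball w r \<Longrightarrow> \<Phi> z = p z * (z - w) ^ n \<and> p z \<noteq> 0"
    unfolding n_def by blast
  have Qw: "Q w \<noteq> 0" using insert by (auto simp: Q_def)
  have contQ: "continuous_on UNIV Q" unfolding Q_def by (intro continuous_intros)
  have holQ: "Q holomorphic_on A" for A unfolding Q_def by (intro holomorphic_intros)
  have "open {z. Q z \<noteq> 0}"
    using continuous_open_preimage[OF contQ open_UNIV, of "-{0}"] by (auto simp: vimage_def)
  then obtain r2 where r2: "r2 > 0" "ball w r2 \<subseteq> {z. Q z \<noteq> 0}"
    using Qw unfolding open_contains_ball by blast
  define r' where "r' = min r r2"
  have r': "r' > 0" "ball w r' \<subseteq> cball w r" "\<And>z. z \<in> ball w r' \<Longrightarrow> Q z \<noteq> 0"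
    using r r2 by (auto simp: r'_def)
  \<comment> \<open>At \<open>w\<close> the quotient is given its limit. On a small ball round
    \<open>w\<close> it equals \<open>p / Q\<close>, with \<open>p\<close> the nonvanishing local
    factor of \<Phi>, so it is holomorphic on each of two open sets covering
    \<open>S\<close>.\<close>
  define H' where "H' = (\<lambda>z. if z = w then p w / Q w else H z / (z - w) ^ n)"
  have near: "H' z = p z / Q z" if "z \<in> ball w r'" for z
  proof (cases "z = w")
    case False
    have "z \<in> cball w r" using that r' by auto
    hence "p z * (z - w) ^ n = Q z * H z"
      using p(2)[of z] H(3)[of z] r by (auto simp: Q_def)
    thus ?thesis using False r'(3)[OF that] by (simp add: H'_def field_simps)
  qed (simp add: H'_def)
  have "H' holomorphic_on (S - {w}) \<union> ball w r'"
  proof (rule holomorphic_on_Un)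
    have "(\<lambda>z. H z / (z - w) ^ n) holomorphic_on S - {w}"
      by (intro holomorphic_intros holomorphic_on_subset[OF H(1)]) auto
    thus "H' holomorphic_on S - {w}"
      by (rule holomorphic_transform) (auto simp: H'_def)
    have "(\<lambda>z. p z / Q z) holomorphic_on ball w r'"
      by (intro holomorphic_intros holomorphic_on_subset[OF p(1)] holQ) (use r' in auto)
    thus "H' holomorphic_on ball w r'"
      by (rule holomorphic_transform) (auto simp: near)
  qed (use S in auto)
  moreover have "(S - {w}) \<union> ball w r' = S" using r r' wS by auto
  ultimately have "H' holomorphic_on S" by simp
  moreover have "\<forall>v\<in>insert w F. H' v \<noteq> 0"
    using H(2) insert p(2)[of w] Qw r by (auto simp: H'_def)
  moreover have "\<forall>z\<in>S. \<Phi> z = (\<Prod>w\<in>insert w F. (z - w) ^ nat (zorder \<Phi> w)) * H' z"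
  proof
    fix z assume z: "z \<in> S"
    show "\<Phi> z = (\<Prod>w\<in>insert w F. (z - w) ^ nat (zorder \<Phi> w)) * H' z"
    proof (cases "z = w")
      case True
      have "(\<Prod>v\<in>insert w F. (w - v) ^ nat (zorder \<Phi> v)) = (w - w) ^ n * Q w"
        using insert by (simp add: n_def Q_def)
      then show ?thesis using True Qw p(2)[of w] r near[of w] r' by simp
    next
      case False
      then show ?thesis using insert H(3)[OF z] by (simp add: H'_def n_def[symmetric])
    qed
  qed
  ultimately show ?case by blast
qed

text \<open>After multiplication by r the difference of the squares of both sides factors as (r^2 -
  |z|^2)(r^2 - |w|^2).\<close>

lemma blaschke_bounds:
  assumes "cmod z \<le> r" "cmod w < r"
  shows "cmod (z - w) \<le> cmod ((of_real (r\<^sup>2) - cnj w * z) / of_real r)"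
    and "cmod z = r \<Longrightarrow> cmod (z - w) = cmod ((of_real (r\<^sup>2) - cnj w * z) / of_real r)"
proof -
  have r: "r > 0" using assms by (meson norm_ge_zero order_le_less_trans)
  have *: "(cmod (of_real (r\<^sup>2) - cnj w * z))\<^sup>2 - r\<^sup>2 * (cmod (z - w))\<^sup>2 =
        (r\<^sup>2 - (cmod z)\<^sup>2) * (r\<^sup>2 - (cmod w)\<^sup>2)"
    unfolding cmod_power2 by (simp add: algebra_simps power2_eq_square)
  have "(cmod z)\<^sup>2 \<le> r\<^sup>2" "(cmod w)\<^sup>2 \<le> r\<^sup>2" using assms by (auto intro: power_mono)
  hence "(r * cmod (z - w))\<^sup>2 \<le> (cmod (of_real (r\<^sup>2) - cnj w * z))\<^sup>2"
    using * by (simp add: power_mult_distrib) (metis diff_ge_0_iff_ge mult_nonneg_nonneg)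
  hence "r * cmod (z - w) \<le> cmod (of_real (r\<^sup>2) - cnj w * z)"
    by (rule power2_le_imp_le) auto
  thus "cmod (z - w) \<le> cmod ((of_real (r\<^sup>2) - cnj w * z) / of_real r)"
    using r by (simp add: norm_divide field_simps)
  assume "cmod z = r"
  hence "(r * cmod (z - w))\<^sup>2 = (cmod (of_real (r\<^sup>2) - cnj w * z))\<^sup>2"
    using * by (simp add: power_mult_distrib)
  hence "r * cmod (z - w) = cmod (of_real (r\<^sup>2) - cnj w * z)"
    using r by (subst (asm) power2_eq_iff_nonneg) auto
  thus "cmod (z - w) = cmod ((of_real (r\<^sup>2) - cnj w * z) / of_real r)"
    using r by (simp add: norm_divide field_simps)
qed

text \<open>Each factor z - w is traded for \<open>d w z\<close>, which has no zeros in the closed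
  disc of radius r and the same modulus on the circle. \<open>F\<close> is any finite subset of the
  open disc: the lower bound takes all zeros there, the upper bound only selected ones.\<close>

lemma blaschke_division:
  assumes \<Phi>: "\<Phi> holomorphic_on ball 0 1"
    and nz: "\<Phi> 0 \<noteq> 0" and r: "0 < r" "r < 1" and F: "finite F" "F \<subseteq> ball 0 r"
  shows "\<exists>h B. h holomorphic_on ball 0 1 \<and> (\<forall>w\<in>F. h w \<noteq> 0) \<and>
    (\<forall>z\<in>ball 0 1. h z = 0 \<longrightarrow> \<Phi> z = 0 \<or> r < cmod z) \<and>
    (\<forall>z. cmod z \<le> r \<longrightarrow> \<Phi> z = B z * h z \<and> cmod (B z) \<le> 1) \<and>
    (\<forall>z. cmod z = r \<longrightarrow> cmod (B z) = 1) \<and>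
    cmod (B 0) = (\<Prod>w\<in>F. (cmod w / r) ^ nat (zorder \<Phi> w))"
proof -
  define n where "n = (\<lambda>w. nat (zorder \<Phi> w))"
  have "F \<subseteq> ball 0 1" using F r by auto
  from factor_out_zeros[OF \<Phi> _ _ _ F(1) this] nz obtain H where
    H: "H holomorphic_on ball 0 1" "\<forall>w\<in>F. H w \<noteq> 0"
      "\<And>z. z \<in> ball 0 1 \<Longrightarrow> \<Phi> z = (\<Prod>w\<in>F. (z - w) ^ n w) * H z"
    unfolding n_def by force
  define d where "d = (\<lambda>w z. (of_real (r\<^sup>2) - cnj w * z) / of_real r)"
  have d0: "d w z \<noteq> 0" if "w \<in> F" "cmod z \<le> r" for w z
  proof
    assume "d w z = 0"
    hence "of_real (r\<^sup>2) = cnj w * z" using r by (simp add: d_def)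
    hence "cmod (of_real (r\<^sup>2)) = cmod w * cmod z" by (metis norm_mult complex_mod_cnj)
    hence "r * r = cmod w * cmod z" by (simp add: norm_power power2_eq_square norm_mult)
    also have "\<dots> \<le> cmod w * r" using that by (intro mult_left_mono) auto
    also have "\<dots> < r * r" using that F r by (intro mult_strict_right_mono) auto
    finally show False by simp
  qed
  define h where "h = (\<lambda>z. H z * (\<Prod>w\<in>F. d w z ^ n w))"
  define B where "B = (\<lambda>z. \<Prod>w\<in>F. ((z - w) / d w z) ^ n w)"
  have 1: "h holomorphic_on ball 0 1"
    unfolding h_def d_def by (intro holomorphic_intros H(1)) (use r in auto)
  have 2: "h w \<noteq> 0" if "w \<in> F" for w
    using that H(2) F d0[of _ w] by (auto simp: h_def)
  have 3: "\<Phi> z = 0 \<or> r < cmod z" if "z \<in> ball 0 1" "h z = 0" for z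
    using that H(3)[of z] d0[of _ z] F by (force simp: h_def not_less)
  have 4: "\<Phi> z = B z * h z" if "cmod z \<le> r" for z
  proof -
    have "(\<Prod>w\<in>F. d w z ^ n w) \<noteq> 0" using d0 that F by auto
    thus ?thesis using H(3)[of z] that r
      by (simp add: B_def h_def power_divide prod_dividef)
  qed
  have 5: "cmod (B z) \<le> 1" if "cmod z \<le> r" for z
    unfolding B_def prod_norm[symmetric]
  proof (intro prod_le_1 conjI)
    fix w assume w: "w \<in> F"
    have "cmod (z - w) \<le> cmod (d w z)"
      unfolding d_def using F w that by (intro blaschke_bounds) auto
    hence "cmod (z - w) / cmod (d w z) \<le> 1" using d0[OF w that] by (simp add: field_simps)
    thus "cmod (((z - w) / d w z) ^ n w) \<le> 1"
      unfolding norm_power norm_divide by (intro power_le_one) auto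
  qed auto
  have 6: "cmod (B z) = 1" if "cmod z = r" for z
    unfolding B_def prod_norm[symmetric]
  proof (intro prod.neutral ballI)
    fix w assume w: "w \<in> F"
    have "cmod (z - w) = cmod (d w z)"
      unfolding d_def using F w that by (intro blaschke_bounds) auto
    thus "cmod (((z - w) / d w z) ^ n w) = 1"
      using d0[OF w] that by (simp add: norm_power norm_divide)
  qed
  have 7: "cmod (B 0) = (\<Prod>w\<in>F. (cmod w / r) ^ nat (zorder \<Phi> w))"
    unfolding B_def prod_norm[symmetric] using r
    by (simp add: norm_power norm_divide d_def n_def power2_eq_square norm_mult)
  show ?thesis by (intro exI[of _ h] exI[of _ B]) (use 1 2 3 4 5 6 7 in auto)
qed

lemma finite_zeros_compact:
  assumes "f holomorphic_on S" "open S" "connected S" "compact K" "K \<subseteq> S" "z0 \<in> S" "f z0 \<noteq> 0"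
  shows "finite {z\<in>K. f z = 0}"
proof (cases "f constant_on S")
  case True
  then obtain c where c: "\<And>z. z \<in> S \<Longrightarrow> f z = c" by (auto simp: constant_on_def)
  have "f z \<noteq> 0" if "z \<in> K" for z using c[of z] c[of z0] that assms by auto
  hence "{z\<in>K. f z = 0} = {}" by auto
  thus ?thesis by (simp only: finite.emptyI)
qed (use holomorphic_compact_finite_zeros assms in blast)

text \<open>Supplies a disc beyond the circle of integration, on which the zero-free quotient has a
  holomorphic logarithm.\<close>

lemma cball_subset_open_imp_larger_ball:
  fixes S :: "complex set"
  assumes "open S" "cball 0 r \<subseteq> S" "0 < r"
  obtains R where "r < R" "ball 0 R \<subseteq> S"
proof -
  obtain e where e: "e > 0" "(\<Union>x\<in>cball 0 r. ball x e) \<subseteq> S"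
    using compact_subset_open_imp_ball_epsilon_subset[of "cball 0 r" S] assms by auto
  have "z \<in> S" if "cmod z < r + e" for z
  proof (cases "cmod z \<le> r")
    case False
    define x where "x = of_real (r / cmod z) * z"
    have z: "cmod z > 0" using False assms by linarith
    have "z - x = of_real (1 - r / cmod z) * z" by (simp add: x_def algebra_simps)
    hence "dist x z = \<bar>1 - r / cmod z\<bar> * cmod z"
      by (simp only: dist_norm norm_minus_commute[of x] norm_mult norm_of_real)
    also have "\<dots> = \<bar>cmod z - r\<bar>" using z by (simp add: abs_if field_simps)
    finally have "dist x z < e" using that False by simp
    moreover have "cmod x = r" using z assms by (simp add: x_def norm_mult norm_divide)
    ultimately show ?thesis using e(2) by force
  qed (use assms in auto)
  thus thesis using e(1) by (intro that[of "r + e"]) auto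
qed

text \<open>\<open>L\<close> is a logarithm of \<Phi> divided by its Blaschke product for radius r.
  That product has modulus 1 on the circle and at most 1 inside; its value at 0 is the correction
  term of Jensen's formula.\<close>

lemma poisson_jensen:
  assumes \<Phi>: "\<Phi> holomorphic_on ball 0 1" and nz: "\<Phi> 0 \<noteq> 0" and r: "0 < r" "r < 1"
    and sphere: "\<And>z. cmod z = r \<Longrightarrow> \<Phi> z \<noteq> 0"
  shows "\<exists>L R F. r < R \<and> L holomorphic_on ball 0 R \<and>
    (\<forall>z. cmod z = r \<longrightarrow> Re (L z) = ln (cmod (\<Phi> z))) \<and>
    (\<forall>z. cmod z < r \<longrightarrow> \<Phi> z \<noteq> 0 \<longrightarrow> ln (cmod (\<Phi> z)) \<le> Re (L z)) \<and>
    finite F \<and> F \<subseteq> {z\<in>ball 0 r. \<Phi> z = 0} \<and>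
    Re (L 0) = ln (cmod (\<Phi> 0)) - ln (\<Prod>w\<in>F. (cmod w / r) ^ nat (zorder \<Phi> w))"
proof -
  define F where "F = {z\<in>ball 0 r. \<Phi> z = 0}"
  have "finite {z\<in>cball 0 r. \<Phi> z = 0}"
    by (rule finite_zeros_compact[OF \<Phi>, of _ 0]) (use nz r in auto)
  hence F: "finite F" by (rule finite_subset[rotated]) (auto simp: F_def)
  have F2: "F \<subseteq> ball 0 r" by (auto simp: F_def)
  obtain h B where h: "h holomorphic_on ball 0 1" "\<And>w. w \<in> F \<Longrightarrow> h w \<noteq> 0"
    "\<And>z. z \<in> ball 0 1 \<Longrightarrow> h z = 0 \<Longrightarrow> \<Phi> z = 0 \<or> r < cmod z"
    and B: "\<And>z. cmod z \<le> r \<Longrightarrow> \<Phi> z = B z * h z"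
    "\<And>z. cmod z \<le> r \<Longrightarrow> cmod (B z) \<le> 1"
    "\<And>z. cmod z = r \<Longrightarrow> cmod (B z) = 1"
    "cmod (B 0) = (\<Prod>w\<in>F. (cmod w / r) ^ nat (zorder \<Phi> w))"
    using blaschke_division[OF \<Phi> nz r F F2] by blast
  have h0: "h z \<noteq> 0" if "cmod z \<le> r" for z
    using h(2,3)[of z] that r sphere[of z] by (force simp: F_def)
  define S where "S = ball 0 1 \<inter> h -` (- {0})"
  have "open S" unfolding S_def
    by (intro continuous_open_preimage holomorphic_on_imp_continuous_on h) auto
  moreover have "cball 0 r \<subseteq> S" using h0 r by (auto simp: S_def)
  ultimately obtain R where R: "r < R" "ball 0 R \<subseteq> S"
    using cball_subset_open_imp_larger_ball r by metis
  have "h holomorphic_on ball 0 R" "\<And>z. z \<in> ball 0 R \<Longrightarrow> h z \<noteq> 0"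
    using R by (auto simp: S_def intro: holomorphic_on_subset[OF h(1)])
  then obtain L where L: "L holomorphic_on ball 0 R" "\<And>z. z \<in> ball 0 R \<Longrightarrow> exp (L z) = h z"
    using holomorphic_logarithm_exists[of "ball 0 R" h 0] r R by auto
  have ReL: "Re (L z) = ln (cmod (h z))" if "cmod z \<le> r" for z
    using L(2)[of z] R that by (metis dist_0_norm ln_exp mem_ball norm_exp_eq_Re order_le_less_trans)
  have 1: "Re (L z) = ln (cmod (\<Phi> z))" if "cmod z = r" for z
    using ReL[of z] B(1)[of z] B(3)[of z] that by (simp add: norm_mult)
  have 2: "ln (cmod (\<Phi> z)) \<le> Re (L z)" if "cmod z < r" "\<Phi> z \<noteq> 0" for z
  proof -
    have "cmod (\<Phi> z) \<le> cmod (h z)"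
      using B(1)[of z] B(2)[of z] that by (auto simp: norm_mult intro!: mult_left_le_one_le)
    thus ?thesis using ReL[of z] that by (auto intro!: ln_mono)
  qed
  have "cmod (\<Phi> 0) = cmod (B 0) * cmod (h 0)" using B(1)[of 0] r by (simp add: norm_mult)
  moreover have "cmod (B 0) > 0" using B(1)[of 0] nz r by auto
  moreover have "cmod (h 0) > 0" using h0[of 0] r by simp
  ultimately have "ln (cmod (\<Phi> 0)) = ln (cmod (B 0)) + ln (cmod (h 0))"
    by (simp add: ln_mult)
  hence 3: "Re (L 0) = ln (cmod (\<Phi> 0)) - ln (\<Prod>w\<in>F. (cmod w / r) ^ nat (zorder \<Phi> w))"
    using ReL[of 0] r by (simp add: B(4)[symmetric])
  show ?thesis
    by (intro exI[of _ L] exI[of _ R] exI[of _ F]) (use 1 2 3 R L F in \<open>auto simp: F_def\<close>)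
qed

section \<open>Poisson kernel estimates and logarithmic means up to the boundary circle\<close>

lemma poisson_kernel_pos: "cmod w < r \<Longrightarrow> poisson_kernel r w u \<ge> 0"
  unfolding poisson_kernel_def by (intro divide_nonneg_nonneg) (auto intro: power_mono)

text \<open>The kernel is at least 1 / (8 \<eta>) on the arc: its numerator is at least \<eta> / 2
  and the distance in the denominator at most 2 \<eta>. The condition on r keeps the circle at least
  \<eta> / 2 outside the point (1 - \<eta>) e.\<close>

lemma poisson_kernel_lower:
  assumes e: "cmod e = 1" and v: "cmod v = 1" "dist v e < \<eta>" and \<eta>: "0 < \<eta>" "\<eta> < 1/2"
    and r: "1 - \<eta> / 2 < r" "r < 1"
  shows "1 \<le> 8 * \<eta> * poisson_kernel r (of_real (1 - \<eta>) * e) (of_real r * v)"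
proof -
  define w u where "w = of_real (1 - \<eta>) * e" and "u = of_real r * v"
  have w: "cmod w = 1 - \<eta>" using e \<eta> unfolding w_def norm_mult norm_of_real by simp
  have "u - w = of_real r * (v - e) + of_real (r - (1 - \<eta>)) * e"
    by (simp add: u_def w_def algebra_simps)
  hence "cmod (u - w) \<le> cmod (of_real r * (v - e)) + cmod (of_real (r - (1 - \<eta>)) * e)"
    by (metis norm_triangle_ineq)
  also have "\<dots> = r * dist v e + (r - (1 - \<eta>))"
    using r \<eta> e unfolding norm_mult norm_of_real dist_norm by simp
  also have "r * dist v e \<le> 1 * dist v e" using r by (intro mult_right_mono) auto
  finally have "cmod (u - w) \<le> 2 * \<eta>" using v r by simp
  moreover have "0 < cmod (u - w)"
  proof -
    have "cmod u = r" using r v \<eta> by (simp add: u_def norm_mult)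
    thus ?thesis using norm_triangle_ineq2[of u w] w r \<eta> by linarith
  qed
  ultimately have d: "0 < (cmod (u - w))\<^sup>2" "(cmod (u - w))\<^sup>2 \<le> (2 * \<eta>)\<^sup>2"
    by (simp, intro power_mono) simp_all
  have "\<eta> / 2 * 1 \<le> (r - (1 - \<eta>)) * (r + (1 - \<eta>))"
    using r \<eta> by (intro mult_mono) auto
  also have "\<dots> = r\<^sup>2 - (cmod w)\<^sup>2" unfolding w by (simp add: power2_eq_square algebra_simps)
  finally have "8 * \<eta> * (\<eta> / 2) \<le> 8 * \<eta> * (r\<^sup>2 - (cmod w)\<^sup>2)"
    using \<eta> by (intro mult_left_mono) auto
  hence "(cmod (u - w))\<^sup>2 \<le> 8 * \<eta> * (r\<^sup>2 - (cmod w)\<^sup>2)"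
    using d by (simp add: power2_eq_square)
  thus ?thesis using d(1) unfolding poisson_kernel_def u_def[symmetric] w_def[symmetric]
    by (simp add: field_simps)
qed

lemma xlnx_tendsto_0: "((\<lambda>x::real. x * ln x) \<longlongrightarrow> 0) (at_right 0)"
  by real_asymp

text \<open>Near \<open>e\<close> the function is (z - e)^n times a nonvanishing factor, and |z - e|
  = \<eta> on the radius. So the logarithm is n ln \<eta> up to a bounded term, and \<eta> ln \<eta>
  tends to 0.\<close>

lemma radial_log_decay:
  assumes G: "G holomorphic_on U" and U: "open U" "connected U" "z0 \<in> U" "G z0 \<noteq> 0"
    and e: "e \<in> U" "cmod e = 1"
  shows "((\<lambda>\<eta>. \<eta> * ln (cmod (G (of_real (1 - \<eta>) * e)))) \<longlongrightarrow> 0) (at_right 0)"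
    and "\<forall>\<^sub>F \<eta> in at_right 0. G (of_real (1 - \<eta>) * e) \<noteq> 0"
proof -
  obtain n r p where r: "r > 0" and p: "p holomorphic_on cball e r"
    "\<And>z. z \<in> cball e r \<Longrightarrow> G z = p z * (z - e) ^ n \<and> p z \<noteq> 0"
    using zorder_exist_zero[OF G U(1,2) e(1)] U(3,4) by blast
  have isc: "isCont p e"
    using holomorphic_on_imp_continuous_on[OF p(1)] r
    by (simp add: continuous_on_interior)
  have pe: "p e \<noteq> 0" using p(2)[of e] r by auto
  have ev: "\<forall>\<^sub>F \<eta> in at_right 0. 0 < \<eta> \<and> \<eta> < r"
    using r by (auto simp: eventually_at_right_field)
  have in_ball: "of_real (1 - \<eta>) * e \<in> cball e r" if "0 < \<eta>" "\<eta> < r" for \<eta>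
  proof -
    have "e - of_real (1 - \<eta>) * e = of_real \<eta> * e" by (simp add: algebra_simps)
    thus ?thesis using that e by (simp add: dist_norm norm_mult)
  qed
  have diff: "cmod (of_real (1 - \<eta>) * e - e) = \<eta>" if "\<eta> > 0" for \<eta>
  proof -
    have "of_real (1 - \<eta>) * e - e = of_real (-\<eta>) * e" by (simp add: algebra_simps)
    thus ?thesis using that e by (simp only: norm_mult norm_of_real)
  qed
  show "\<forall>\<^sub>F \<eta> in at_right 0. G (of_real (1 - \<eta>) * e) \<noteq> 0"
    using ev
  proof eventually_elim
    case (elim \<eta>)
    with diff[of \<eta>] have "of_real (1 - \<eta>) * e - e \<noteq> 0" by (metis norm_zero less_irrefl)
    thus ?case using p(2)[OF in_ball[of \<eta>]] elim by simp
  qed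
  have "((\<lambda>\<eta>. of_real (1 - \<eta>) * e) \<longlongrightarrow> of_real (1 - 0) * e) (at_right (0::real))"
    by (intro tendsto_intros)
  hence "((\<lambda>\<eta>. p (of_real (1 - \<eta>) * e)) \<longlongrightarrow> p e) (at_right 0)"
    by (intro isCont_tendsto_compose[OF isc]) simp
  hence "((\<lambda>\<eta>. \<eta> * ln (cmod (p (of_real (1 - \<eta>) * e))) + real n * (\<eta> * ln \<eta>)) \<longlongrightarrow>
      0 * ln (cmod (p e)) + real n * 0) (at_right 0)"
    using pe by (intro tendsto_intros xlnx_tendsto_0) auto
  moreover have "\<forall>\<^sub>F \<eta> in at_right 0. \<eta> * ln (cmod (p (of_real (1 - \<eta>) * e))) + real n * (\<eta> * ln \<eta>) =
      \<eta> * ln (cmod (G (of_real (1 - \<eta>) * e)))"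
    using ev
  proof eventually_elim
    case (elim \<eta>)
    have "ln (cmod (G (of_real (1 - \<eta>) * e))) = ln (cmod (p (of_real (1 - \<eta>) * e)) * \<eta> ^ n)"
      using p(2)[OF in_ball[of \<eta>]] diff[of \<eta>] elim by (simp add: norm_mult norm_power)
    also have "\<dots> = ln (cmod (p (of_real (1 - \<eta>) * e))) + real n * ln \<eta>"
      using p(2)[OF in_ball[of \<eta>]] elim by (simp add: ln_mult ln_realpow)
    finally show ?case by (simp add: algebra_simps)
  qed
  ultimately show "((\<lambda>\<eta>. \<eta> * ln (cmod (G (of_real (1 - \<eta>) * e)))) \<longlongrightarrow> 0) (at_right 0)"
    by (simp add: tendsto_cong)
qed

lemma poisson_kernel_0: "cmod u = r \<Longrightarrow> r > 0 \<Longrightarrow> poisson_kernel r 0 u = 1"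
  by (simp add: poisson_kernel_def)

lemma mean_value_Re:
  assumes "L holomorphic_on ball 0 R" "0 < r" "r < R"
  shows "((\<lambda>x. Re (L (of_real r * circ x))) has_integral Re (L 0)) {0..1}"
  using poisson_formula[OF assms, of 0] assms by (simp add: poisson_kernel_0 norm_mult)

text \<open>A smaller closed disc contains finitely many zeros, so their moduli exclude only
  finitely many radii.\<close>

lemma exists_zero_free_radius:
  assumes "G holomorphic_on ball 0 1" "G 0 \<noteq> 0" "r1 < 1"
  obtains r where "r1 < r" "0 < r" "r < 1" "\<And>z. cmod z = r \<Longrightarrow> G z \<noteq> 0"
proof -
  define a where "a = max r1 0"
  define b where "b = (a + 1) / 2"
  have ab: "a < b" "b < 1" "0 \<le> a" "r1 \<le> a" using assms by (auto simp: a_def b_def)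
  have "finite {z\<in>cball 0 b. G z = 0}"
    by (rule finite_zeros_compact[OF assms(1), of _ 0]) (use assms ab in auto)
  hence "finite (cmod ` {z\<in>cball 0 b. G z = 0})" by simp
  moreover have "infinite {a<..<b}" using ab by simp
  ultimately obtain r where "r \<in> {a<..<b}" "r \<notin> cmod ` {z\<in>cball 0 b. G z = 0}"
    by (meson finite_subset subsetI)
  thus thesis using ab by (intro that[of r]) auto
qed

text \<open>The quantity made small is the price of one arc in \<open>truncated_log_mean\<close>:
  \<open>K\<close> is the logarithm of an upper bound of |G|, and the factor 8 \<eta> comes from
  \<open>poisson_kernel_lower\<close>.\<close>

lemma small_arc:
  assumes lim: "((\<lambda>\<eta>. \<eta> * ln (cmod (G (of_real (1 - \<eta>) * e)))) \<longlongrightarrow> 0) (at_right 0)"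
    and ev: "\<forall>\<^sub>F \<eta> in at_right 0. G (of_real (1 - \<eta>) * e) \<noteq> 0" and \<kappa>: "\<kappa> > 0"
  shows "\<exists>\<eta>. 0 < \<eta> \<and> \<eta> < 1/2 \<and> G (of_real (1 - \<eta>) * e) \<noteq> 0 \<and>
           8 * \<eta> * (K - ln (cmod (G (of_real (1 - \<eta>) * e)))) < \<kappa>"
proof -
  have "((\<lambda>\<eta>. 8 * K * \<eta> - 8 * (\<eta> * ln (cmod (G (of_real (1 - \<eta>) * e))))) \<longlongrightarrow> 8 * K * 0 - 8 * 0) (at_right 0)"
    by (intro tendsto_intros lim)
  hence "\<forall>\<^sub>F \<eta> in at_right 0. 8 * K * \<eta> - 8 * (\<eta> * ln (cmod (G (of_real (1 - \<eta>) * e)))) < \<kappa>"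
    using \<kappa> by (intro order_tendstoD(2)) auto
  moreover have "\<forall>\<^sub>F \<eta>::real in at_right 0. 0 < \<eta> \<and> \<eta> < 1/2"
    by (auto simp: eventually_at_right_field intro!: exI[of _ "1/2"])
  ultimately have "\<forall>\<^sub>F \<eta> in at_right 0. 0 < \<eta> \<and> \<eta> < 1/2 \<and> G (of_real (1 - \<eta>) * e) \<noteq> 0 \<and>
           8 * \<eta> * (K - ln (cmod (G (of_real (1 - \<eta>) * e)))) < \<kappa>"
    using ev by eventually_elim (simp add: algebra_simps)
  thus ?thesis using eventually_happens trivial_limit_at_right_real by fast
qed

text \<open>Away from arcs round 1 and round the zeros on the circle the truncation has no effect
  for r near 1. On an arc the truncated value is at most ln M, and ln M - ln |G| is nonnegative,
  hence dominated by 8 \<eta> times itself weighted with the Poisson kernel; the mean of that is at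
  most 8 \<eta> (ln M - ln |G((1 - \<eta>) e)|). All arcs together cost at most \<epsilon> / 2, and
  passing from radius r to 1 costs the other half.\<close>

lemma truncated_log_mean:
  assumes contG: "continuous_on (cball 0 1) G"
    and holG: "G holomorphic_on U" and U: "open U" "connected U" "cball 0 1 - {1} \<subseteq> U"
    and G0: "G 0 = 1"
    and low: "((\<lambda>\<eta>. \<eta> * ln (cmod (G (of_real (1 - \<eta>))))) \<longlongrightarrow> 0) (at_right 0)"
      "\<forall>\<^sub>F \<eta> in at_right 0. G (of_real (1 - \<eta>)) \<noteq> 0"
    and \<beta>: "0 < \<beta>" "\<And>F. finite F \<Longrightarrow> F \<subseteq> {z\<in>ball 0 1. G z = 0} \<Longrightarrow> \<beta> \<le> (\<Prod>w\<in>F. cmod w ^ nat (zorder G w))"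
    and \<epsilon>: "0 < \<epsilon>"
  shows "\<exists>\<delta>>0. integral {0..1} (\<lambda>x. ln (max (cmod (G (circ x))) \<delta>)) \<le> - ln \<beta> + \<epsilon>"
proof -
  have holG1: "G holomorphic_on ball 0 1"
    by (rule holomorphic_on_subset[OF holG]) (use U in auto)
  have U0: "0 \<in> U" "G 0 \<noteq> 0" using U G0 by auto
  have "bounded (G ` cball 0 1)"
    using compact_imp_bounded[OF compact_continuous_image[OF contG compact_cball]] .
  then obtain M0 where "\<forall>y\<in>G ` cball 0 1. cmod y \<le> M0" unfolding bounded_iff by blast
  hence M0: "cmod (G z) \<le> M0" if "z \<in> cball 0 1" for z using that by blast
  define M where "M = max M0 1"
  have M: "cmod (G z) \<le> M" if "cmod z \<le> 1" for z using M0[of z] that by (simp add: M_def)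
  have M1: "M \<ge> 1" by (simp add: M_def)
  define good where "good = (\<lambda>\<kappa> e \<eta>. 0 < \<eta> \<and> \<eta> < 1/2 \<and> G (of_real (1 - \<eta>) * e) \<noteq> 0 \<and>
           8 * \<eta> * (ln M - ln (cmod (G (of_real (1 - \<eta>) * e)))) < (\<kappa>::real))"
  have good1: "\<exists>\<eta>. good \<kappa> e \<eta>" if "cmod e = 1" "\<kappa> > 0" for e \<kappa>
  proof (cases "e = 1")
    case True
    then show ?thesis using small_arc[of G 1 \<kappa> "ln M"] low that by (simp add: good_def)
  next
    case False
    hence "e \<in> U" using U that by auto
    thus ?thesis unfolding good_def
      using radial_log_decay[OF holG U(1,2) U0 _ that(1)] that by (intro small_arc) auto
  qed
  obtain \<eta>1 where \<eta>1: "good (\<epsilon>/4) 1 \<eta>1" using good1[of 1 "\<epsilon>/4"] \<epsilon> by auto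
  \<comment> \<open>Zeros on the circle can accumulate only at 1, the one point of the circle where
    \<open>G\<close> need not be holomorphic; the arc round 1 absorbs all but finitely many.\<close>
  define E where "E = {z\<in>sphere 0 1 - ball 1 \<eta>1. G z = 0}"
  have "finite E" unfolding E_def
  proof (rule finite_zeros_compact[OF holG U(1,2) _ _ U0])
    show "compact (sphere 0 1 - ball (1::complex) \<eta>1)" by (intro compact_diff) auto
    show "sphere 0 1 - ball 1 \<eta>1 \<subseteq> U" using U(3) \<eta>1 by (force simp: good_def)
  qed
  \<comment> \<open>The arc at 1 has the budget \<epsilon> / 4, the arcs at \<open>E\<close> share
    another \<epsilon> / 4; adding 1 covers an empty \<open>E\<close>.\<close>
  define \<kappa> where "\<kappa> = \<epsilon> / (4 * (card E + 1))"
  have \<kappa>: "\<kappa> > 0" using \<epsilon> by (simp add: \<kappa>_def)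
  have "\<forall>e\<in>E. \<exists>\<eta>. good \<kappa> e \<eta>" using good1 \<kappa> by (auto simp: E_def)
  then obtain \<eta>0 where \<eta>0: "\<And>e. e \<in> E \<Longrightarrow> good \<kappa> e (\<eta>0 e)" by metis
  define \<eta> where "\<eta> = \<eta>0(1 := \<eta>1)"
  define E' where "E' = insert 1 E"
  have E1: "1 \<notin> E" using \<eta>1 by (auto simp: E_def good_def)
  have E': "finite E'" "\<And>e. e \<in> E' \<Longrightarrow> cmod e = 1" using \<open>finite E\<close> by (auto simp: E'_def E_def)
  have \<eta>: "0 < \<eta> e" "\<eta> e < 1/2" "G (of_real (1 - \<eta> e) * e) \<noteq> 0" if "e \<in> E'" for e
    using \<eta>1 \<eta>0[of e] that E1 by (auto simp: good_def E'_def \<eta>_def)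
  define err where "err = (\<lambda>e. 8 * \<eta> e * (ln M - ln (cmod (G (of_real (1 - \<eta> e) * e)))))"
  have "(\<Sum>e\<in>E'. err e) = err 1 + (\<Sum>e\<in>E. err e)"
    using E1 \<open>finite E\<close> by (simp add: E'_def)
  also have "err 1 \<le> \<epsilon> / 4" using \<eta>1 by (auto simp: err_def \<eta>_def good_def)
  also have "(\<Sum>e\<in>E. err e) \<le> (\<Sum>e\<in>E. \<kappa>)"
    using \<eta>0 E1 by (intro sum_mono) (auto simp: err_def \<eta>_def good_def less_imp_le)
  also have "\<dots> \<le> \<epsilon> / 4" using \<epsilon> by (simp add: \<kappa>_def field_simps)
  finally have err: "(\<Sum>e\<in>E'. err e) \<le> \<epsilon> / 2" by simp
  define K where "K = sphere 0 1 - (\<Union>e\<in>E'. ball e (\<eta> e))"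
  have K: "compact K" unfolding K_def by (intro compact_diff open_UN) auto
  have Knz: "G v \<noteq> 0" if "v \<in> K" for v
  proof
    assume "G v = 0"
    hence "v \<in> E" using that by (auto simp: K_def E_def E'_def \<eta>_def)
    thus False using that \<eta>[of v] by (auto simp: K_def E'_def)
  qed
  \<comment> \<open>The factor 2 absorbs the variation of \<open>G\<close> between radius r and the
    unit circle, which is kept below \<delta>.\<close>
  have "\<exists>\<delta>>0. \<forall>v\<in>K. 2 * \<delta> \<le> cmod (G v)"
  proof (cases "K = {}")
    case False
    have "continuous_on K (\<lambda>v. cmod (G v))"
      by (intro continuous_intros continuous_on_subset[OF contG]) (auto simp: K_def)
    from continuous_attains_inf[OF K False this] obtain v0 where "v0 \<in> K" "\<And>v. v \<in> K \<Longrightarrow> cmod (G v0) \<le> cmod (G v)"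
      by auto
    thus ?thesis using Knz[of v0] by (intro exI[of _ "cmod (G v0) / 2"]) auto
  qed (auto intro: exI[of _ 1])
  then obtain \<delta>0 where \<delta>0: "\<delta>0 > 0" "\<And>v. v \<in> K \<Longrightarrow> 2 * \<delta>0 \<le> cmod (G v)" by blast
  \<comment> \<open>The cap 1 keeps \<delta> below \<open>M\<close>, so the truncated logarithm
    stays below ln M.\<close>
  define \<delta> where "\<delta> = min \<delta>0 1"
  have \<delta>: "\<delta> > 0" "\<delta> \<le> M" "\<And>v. v \<in> K \<Longrightarrow> 2 * \<delta> \<le> cmod (G v)"
    using \<delta>0 M1 by (force simp: \<delta>_def)+
  define u where "u = (\<lambda>z. ln (max (cmod (G z)) \<delta>))"
  have contu: "continuous_on (cball 0 1) u"
    unfolding u_def using \<delta>(1) by (intro continuous_intros contG) auto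
  obtain d1 where d1: "d1 > 0" "\<And>x y. x \<in> cball 0 1 \<Longrightarrow> y \<in> cball 0 1 \<Longrightarrow> dist y x < d1 \<Longrightarrow> dist (G y) (G x) < \<delta>"
    using compact_uniformly_continuous[OF contG compact_cball] \<delta>(1) unfolding uniformly_continuous_on_def by meson
  obtain d2 where d2: "d2 > 0" "\<And>x y. x \<in> cball 0 1 \<Longrightarrow> y \<in> cball 0 1 \<Longrightarrow> dist y x < d2 \<Longrightarrow> dist (u y) (u x) < \<epsilon>/2"
    using compact_uniformly_continuous[OF contu compact_cball] \<epsilon> unfolding uniformly_continuous_on_def
    by (meson half_gt_zero)
  \<comment> \<open>Lower bounds for r: from the uniform continuity of \<open>G\<close> and of
    \<open>u\<close>, and from the condition of \<open>poisson_kernel_lower\<close> at each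
    arc.\<close>
  define X where "X = insert (1 - d1) (insert (1 - d2) ((\<lambda>e. 1 - \<eta> e / 2) ` E'))"
  define r1 where "r1 = Max X"
  have X: "finite X" "X \<noteq> {}" using E' by (auto simp: X_def)
  have "r1 < 1" unfolding r1_def using X d1 d2 \<eta>(1) by (subst Max_less_iff) (auto simp: X_def)
  moreover have "x \<le> r1" if "x \<in> X" for x unfolding r1_def using X(1) that by (rule Max_ge)
  ultimately have r1: "r1 < 1" "1 - d1 \<le> r1" "1 - d2 \<le> r1" "\<And>e. e \<in> E' \<Longrightarrow> 1 - \<eta> e / 2 \<le> r1"
    by (auto simp: X_def)
  obtain r where r: "r1 < r" "0 < r" "r < 1" and zf: "\<And>z. cmod z = r \<Longrightarrow> G z \<noteq> 0"
    using exists_zero_free_radius[OF holG1 U0(2) r1(1)] by metis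
  obtain L R F where L: "r < R" "L holomorphic_on ball 0 R"
    "\<And>z. cmod z = r \<Longrightarrow> Re (L z) = ln (cmod (G z))"
    "\<And>z. cmod z < r \<Longrightarrow> G z \<noteq> 0 \<Longrightarrow> ln (cmod (G z)) \<le> Re (L z)"
    and F: "finite F" "F \<subseteq> {z\<in>ball 0 r. G z = 0}"
    "Re (L 0) = ln (cmod (G 0)) - ln (\<Prod>w\<in>F. (cmod w / r) ^ nat (zorder G w))"
    using poisson_jensen[OF holG1 U0(2) r(2,3) zf] by blast
  define w where "w = (\<lambda>e. of_real (1 - \<eta> e) * e)"
  have w: "cmod (w e) < r" if "e \<in> E'" for e
  proof -
    have "cmod (w e) = 1 - \<eta> e" using E'(2)[OF that] \<eta>[OF that]
      unfolding w_def norm_mult norm_of_real by simp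
    thus ?thesis using r1(4)[OF that] r(1) \<eta>[OF that] by linarith
  qed
  define z where "z = (\<lambda>x. of_real r * circ x)"
  have z: "cmod (z x) = r" for x using r by (simp add: z_def norm_mult)
  have dz: "dist (z x) (circ x) = 1 - r" for x
  proof -
    have "z x - circ x = of_real (r - 1) * circ x" by (simp add: z_def algebra_simps)
    hence "dist (z x) (circ x) = \<bar>r - 1\<bar> * 1" by (simp only: dist_norm norm_mult norm_of_real norm_circ)
    thus ?thesis using r by simp
  qed
  \<comment> \<open>The mean of the majorant comes from the Poisson formula at 0 and at the points
    \<open>w e\<close>, where Re L dominates ln |G|.\<close>
  have I1: "((\<lambda>x. Re (L (z x)) + (\<Sum>e\<in>E'. 8 * \<eta> e * (poisson_kernel r (w e) (z x) * Re (of_real (ln M) - L (z x)))))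
          has_integral Re (L 0) + (\<Sum>e\<in>E'. 8 * \<eta> e * Re (of_real (ln M) - L (w e)))) {0..1}"
    unfolding z_def
    by (intro has_integral_add has_integral_sum E' has_integral_mult_right mean_value_Re[OF L(2)]
        poisson_formula[where R = R and L = "\<lambda>z. of_real (ln M) - L z"] holomorphic_intros L(2) w)
       (use r L in auto)
  have I2: "((\<lambda>x. u (z x)) has_integral integral {0..1} (\<lambda>x. u (z x))) {0..1}"
    by (intro integrable_integral integrable_continuous_real continuous_on_compose2[OF contu])
       (use z r in \<open>auto simp: z_def norm_mult intro!: continuous_intros\<close>)
  have I3: "u (z x) \<le> Re (L (z x)) + (\<Sum>e\<in>E'. 8 * \<eta> e * (poisson_kernel r (w e) (z x) * Re (of_real (ln M) - L (z x))))"
    if "x \<in> {0..1}" for x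
  proof -
    have Lz: "Re (L (z x)) = ln (cmod (G (z x)))" using L(3)[OF z] .
    have Gz: "cmod (G (z x)) > 0" "cmod (G (z x)) \<le> M" using zf[OF z[of x]] M[of "z x"] z[of x] r by auto
    have nn: "Re (of_real (ln M) - L (z x)) \<ge> 0" using Lz Gz by (auto intro!: ln_mono)
    have terms: "8 * \<eta> e * (poisson_kernel r (w e) (z x) * Re (of_real (ln M) - L (z x))) \<ge> 0" if "e \<in> E'" for e
      using \<eta>(1)[OF that] poisson_kernel_pos[OF w[OF that]] nn by (intro mult_nonneg_nonneg) auto
    show ?thesis
    proof (cases "circ x \<in> K")
      case True
      have "dist (G (z x)) (G (circ x)) < \<delta>"
        using dz[of x] r1 r z[of x] by (intro d1) auto
      hence "cmod (G (z x)) \<ge> \<delta>"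
        using \<delta>(3)[OF True] norm_triangle_ineq2[of "G (circ x)" "G (z x)"] by (simp add: dist_norm norm_minus_commute)
      hence "u (z x) = Re (L (z x))" by (simp add: u_def Lz max_def)
      thus ?thesis using sum_nonneg[OF terms] by simp
    next
      case False
      then obtain e where e: "e \<in> E'" "dist (circ x) e < \<eta> e" by (auto simp: K_def dist_commute)
      have "1 \<le> 8 * \<eta> e * poisson_kernel r (w e) (z x)"
        unfolding w_def z_def
        using E'(2) \<eta>[OF e(1)] r1(4)[OF e(1)] r e by (intro poisson_kernel_lower) auto
      hence "1 * Re (of_real (ln M) - L (z x)) \<le> 8 * \<eta> e * poisson_kernel r (w e) (z x) * Re (of_real (ln M) - L (z x))"
        using nn by (rule mult_right_mono)
      also have "\<dots> = 8 * \<eta> e * (poisson_kernel r (w e) (z x) * Re (of_real (ln M) - L (z x)))" by (simp add: mult.assoc)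
      also have "\<dots> \<le> (\<Sum>e\<in>E'. 8 * \<eta> e * (poisson_kernel r (w e) (z x) * Re (of_real (ln M) - L (z x))))"
        using terms by (intro member_le_sum e E') auto
      finally have "ln M \<le> Re (L (z x)) + (\<Sum>e\<in>E'. 8 * \<eta> e * (poisson_kernel r (w e) (z x) * Re (of_real (ln M) - L (z x))))"
        by simp
      moreover have "u (z x) \<le> ln M" unfolding u_def using Gz \<delta> by (intro ln_mono) auto
      ultimately show ?thesis by linarith
    qed
  qed
  have "integral {0..1} (\<lambda>x. u (z x)) \<le> Re (L 0) + (\<Sum>e\<in>E'. 8 * \<eta> e * Re (of_real (ln M) - L (w e)))"
    by (rule has_integral_le[OF I2 I1 I3])
  also have "(\<Sum>e\<in>E'. 8 * \<eta> e * Re (of_real (ln M) - L (w e))) \<le> (\<Sum>e\<in>E'. err e)"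
  proof (intro sum_mono)
    fix e assume e: "e \<in> E'"
    have "ln (cmod (G (w e))) \<le> Re (L (w e))"
      using \<eta>(3)[OF e] by (intro L(4) w e) (simp add: w_def)
    thus "8 * \<eta> e * Re (of_real (ln M) - L (w e)) \<le> err e"
      unfolding err_def using \<eta>(1)[OF e] by (intro mult_left_mono) (auto simp: w_def)
  qed
  also note err
  also have "Re (L 0) \<le> - ln \<beta>"
  proof -
    have "\<beta> \<le> (\<Prod>w\<in>F. cmod w ^ nat (zorder G w))" using F(2) r by (intro \<beta>(2) F(1)) auto
    \<comment> \<open>Dividing the moduli by r < 1 only enlarges the product.\<close>
    also have "\<dots> \<le> (\<Prod>w\<in>F. (cmod w / r) ^ nat (zorder G w))"
      using r by (intro prod_mono conjI power_mono) (auto simp: field_simps mult_left_le_one_le)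
    finally have "ln \<beta> \<le> ln (\<Prod>w\<in>F. (cmod w / r) ^ nat (zorder G w))"
      using \<beta>(1) by (intro ln_mono) auto
    thus ?thesis using F(3) G0 by simp
  qed
  finally have *: "integral {0..1} (\<lambda>x. u (z x)) \<le> - ln \<beta> + \<epsilon> / 2" by simp
  have "integral {0..1} (\<lambda>x. u (circ x)) \<le> integral {0..1} (\<lambda>x. u (z x) + \<epsilon> / 2)"
  proof (rule integral_le)
    show "(\<lambda>x. u (circ x)) integrable_on {0..1}"
      by (intro integrable_continuous_real continuous_on_compose2[OF contu]) (auto intro!: continuous_intros)
    show "(\<lambda>x. u (z x) + \<epsilon> / 2) integrable_on {0..1}"
      by (intro integrable_continuous_real continuous_intros continuous_on_compose2[OF contu])
         (use z r in \<open>auto simp: z_def norm_mult intro!: continuous_intros\<close>)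
    fix x :: real
    have "dist (u (z x)) (u (circ x)) < \<epsilon> / 2"
      using dz[of x] r1 r z[of x] by (intro d2) auto
    thus "u (circ x) \<le> u (z x) + \<epsilon> / 2" unfolding dist_real_def by linarith
  qed
  also have "\<dots> = integral {0..1} (\<lambda>x. u (z x)) + integral {0..1} (\<lambda>x::real. \<epsilon> / 2)"
    by (intro Henstock_Kurzweil_Integration.integral_add integrable_continuous_real continuous_on_compose2[OF contu])
       (use z r in \<open>auto simp: z_def norm_mult intro!: continuous_intros\<close>)
  also have "\<dots> \<le> - ln \<beta> + \<epsilon>" using * by simp
  finally show ?thesis using \<delta>(1) unfolding u_def by blast
qed

section \<open>Polynomial approximation and the outer polynomial\<close>

text \<open>Since z cnj z = 1 on the circle, a common factor z of both arguments drops out;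
  conjugating a mixed term keeps its real part and makes it polynomial.\<close>

lemma poly_Re_mult_cnj:
  "\<exists>s :: complex poly. \<forall>z. cmod z = 1 \<longrightarrow> Re (poly p z * cnj (poly q z)) = Re (poly s z)"
proof (induction p q rule: poly_induct2)
  case 0
  show ?case by (intro exI[of _ 0]) simp
next
  case (pCons a p b q)
  then obtain s where s: "\<And>z. cmod z = 1 \<Longrightarrow> Re (poly p z * cnj (poly q z)) = Re (poly s z)" by blast
  define s' where "s' = [:a * cnj b:] + smult (cnj a) (pCons 0 q) + smult (cnj b) (pCons 0 p) + s"
  have "Re (poly (pCons a p) z * cnj (poly (pCons b q) z)) = Re (poly s' z)" if z: "cmod z = 1" for z
  proof -
    have zz: "z * cnj z = 1" using z complex_norm_square[of z] by simp
    have Recnj: "Re x = Re (cnj x)" for x by simp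
    have "poly (pCons a p) z * cnj (poly (pCons b q) z) =
        a * cnj b + a * cnj (z * poly q z) + cnj b * (z * poly p z) + (z * cnj z) * (poly p z * cnj (poly q z))"
      by (simp add: algebra_simps)
    also have "Re \<dots> = Re (a * cnj b) + Re (a * cnj (z * poly q z)) + Re (cnj b * (z * poly p z)) + Re (poly p z * cnj (poly q z))"
      by (simp add: zz)
    also have "Re (a * cnj (z * poly q z)) = Re (cnj (a * cnj (z * poly q z)))" by (rule Recnj)
    also have "cnj (a * cnj (z * poly q z)) = cnj a * (z * poly q z)" by simp
    finally show ?thesis by (simp only: s[OF z] s'_def poly_add poly_smult poly_pCons) simp
  qed
  thus ?case by blast
qed

text \<open>By 2 Re a Re b = Re (a b) + Re (a cnj b). This makes the real parts of polynomials an
  algebra on the circle, as Stone-Weierstrass requires.\<close>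

lemma poly_Re_mult:
  "\<exists>s :: complex poly. \<forall>z. cmod z = 1 \<longrightarrow> Re (poly p z) * Re (poly q z) = Re (poly s z)"
proof -
  obtain s where s: "\<And>z. cmod z = 1 \<Longrightarrow> Re (poly p z * cnj (poly q z)) = Re (poly s z)"
    using poly_Re_mult_cnj[of p q] by blast
  have "Re (poly p z) * Re (poly q z) = Re (poly (smult (1/2) (p * q + s)) z)" if "cmod z = 1" for z
  proof -
    have "Re (poly (smult (1/2) (p * q + s)) z) = (Re (poly p z * poly q z) + Re (poly s z)) / 2" by simp
    also have "\<dots> = (Re (poly p z * poly q z) + Re (poly p z * cnj (poly q z))) / 2" using s[OF that] by simp
    finally show ?thesis by simp
  qed
  thus ?thesis by blast
qed

lemma poly_Re_approx:
  fixes u :: "complex \<Rightarrow> real"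
  assumes u: "continuous_on (sphere 0 1) u" and e: "e > 0"
  obtains Q :: "complex poly" where "\<And>z. cmod z = 1 \<Longrightarrow> \<bar>Re (poly Q z) - u z\<bar> < e"
proof -
  define R where "R = {f :: complex \<Rightarrow> real. \<exists>p. \<forall>z. cmod z = 1 \<longrightarrow> f z = Re (poly p z)}"
  have "function_ring_on R (sphere 0 1)"
  proof (standard, goal_cases)
    case (2 f)
    then obtain p where "\<And>z. cmod z = 1 \<Longrightarrow> f z = Re (poly p z)" by (auto simp: R_def)
    moreover have "continuous_on (sphere 0 1) (\<lambda>z. Re (poly p z))" by (intro continuous_intros)
    ultimately show ?case by (subst continuous_on_cong[OF refl]) auto
  next
    case (3 f g)
    then obtain p q where "\<And>z. cmod z = 1 \<Longrightarrow> f z = Re (poly p z)" "\<And>z. cmod z = 1 \<Longrightarrow> g z = Re (poly q z)"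
      by (auto simp: R_def)
    thus ?case unfolding R_def by (intro CollectI exI[of _ "p + q"]) simp
  next
    case (4 f g)
    then obtain p q where "\<And>z. cmod z = 1 \<Longrightarrow> f z = Re (poly p z)" "\<And>z. cmod z = 1 \<Longrightarrow> g z = Re (poly q z)"
      by (auto simp: R_def)
    moreover obtain s where "\<And>z. cmod z = 1 \<Longrightarrow> Re (poly p z) * Re (poly q z) = Re (poly s z)"
      using poly_Re_mult[of p q] by blast
    ultimately show ?case unfolding R_def by (intro CollectI exI[of _ s]) simp
  next
    case (5 c)
    show ?case unfolding R_def by (intro CollectI exI[of _ "[:of_real c:]"]) simp
  next
    case (6 x y)
    have 1: "Re \<in> R" unfolding R_def by (intro CollectI exI[of _ "[:0, 1:]"]) simp
    have 2: "Im \<in> R" unfolding R_def by (intro CollectI exI[of _ "[:0, -\<i>:]"]) simp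
    show ?case using 1 2 6 complex_eqI by blast
  qed auto
  from function_ring_on.Stone_Weierstrass[OF this u] obtain F where
    F: "\<And>n. F n \<in> R" "uniform_limit (sphere 0 1) F u sequentially" by auto
  from eventually_happens'[OF sequentially_bot uniform_limitD[OF F(2) e]]
  obtain n where n: "\<And>z. z \<in> sphere 0 1 \<Longrightarrow> dist (F n z) (u z) < e"
    by blast
  from F(1)[of n] obtain Q where "\<And>z. cmod z = 1 \<Longrightarrow> F n z = Re (poly Q z)" by (auto simp: R_def)
  thus thesis using n by (intro that[of Q]) (auto simp: dist_real_def)
qed

text \<open>Averages of dilates realise polynomials in z, so the exponential has to become one: a
  Taylor sum in \<open>poly Q z\<close>, uniform on the disc because \<open>poly Q\<close> is
  bounded there.\<close>

lemma poly_exp_approx: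
  fixes Q :: "complex poly"
  assumes e: "e > 0"
  obtains q :: "complex poly" where "\<And>z. cmod z \<le> 1 \<Longrightarrow> cmod (exp (poly Q z) - poly q z) < e"
proof -
  have "bounded (poly Q ` cball 0 1)"
    by (intro compact_imp_bounded compact_continuous_image continuous_intros compact_cball)
  then obtain K where "\<forall>y\<in>poly Q ` cball 0 1. cmod y \<le> K" unfolding bounded_iff by blast
  hence K: "cmod (poly Q z) \<le> K" if "cmod z \<le> 1" for z using that by auto
  have K0: "K \<ge> 0" using order_trans[OF norm_ge_zero K[of 0]] by simp
  have "(\<lambda>n. K ^ n / fact n) \<longlonglongrightarrow> 0"
    using summable_LIMSEQ_zero[OF summable_exp[of K]] by (simp add: divide_inverse mult.commute)
  hence "(\<lambda>n. exp K * (K * (K ^ n / fact n))) \<longlonglongrightarrow> exp K * (K * 0)"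
    by (intro tendsto_intros)
  from order_tendstoD(2)[OF this, of e] e obtain n where n: "exp K * (K * (K ^ n / fact n)) < e"
    by (auto simp: eventually_sequentially)
  define q where "q = (\<Sum>k\<le>n. smult (1 / fact k) (Q ^ k))"
  show thesis
  proof (rule that[of q])
    fix z :: complex assume z: "cmod z \<le> 1"
    have "poly q z = (\<Sum>k\<le>n. poly Q z ^ k / fact k)"
      by (simp add: q_def poly_sum)
    hence "cmod (exp (poly Q z) - poly q z) \<le> exp \<bar>Re (poly Q z)\<bar> * cmod (poly Q z) ^ Suc n / fact n"
      using Taylor_exp[of "poly Q z" n] by simp
    also have "\<dots> \<le> exp K * K ^ Suc n / fact n"
      using K[OF z] abs_Re_le_cmod[of "poly Q z"] K0
      by (intro divide_right_mono mult_mono power_mono) auto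
    also have "\<dots> = exp K * (K * (K ^ n / fact n))" by simp
    finally show "cmod (exp (poly Q z) - poly q z) < e" using n by simp
  qed
qed

text \<open>\<open>q\<close> stands in for the reciprocal of the outer part of \<open>G\<close>.
  Continuity of \<open>G\<close> up to the circle lets the maximum principle carry the bound on the
  circle into the disc.\<close>

theorem outer_polynomial:
  assumes contG: "continuous_on (cball 0 1) G"
    and holG: "G holomorphic_on U" and U: "open U" "connected U" "cball 0 1 - {1} \<subseteq> U"
    and G0: "G 0 = 1"
    and low: "((\<lambda>\<eta>. \<eta> * ln (cmod (G (of_real (1 - \<eta>))))) \<longlongrightarrow> 0) (at_right 0)"
      "\<forall>\<^sub>F \<eta> in at_right 0. G (of_real (1 - \<eta>)) \<noteq> 0"
    and \<beta>: "0 < \<beta>" "\<And>F. finite F \<Longrightarrow> F \<subseteq> {z\<in>ball 0 1. G z = 0} \<Longrightarrow> \<beta> \<le> (\<Prod>w\<in>F. cmod w ^ nat (zorder G w))"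
    and \<epsilon>: "0 < \<epsilon>"
  obtains q :: "complex poly" where "\<And>z. cmod z \<le> 1 \<Longrightarrow> cmod (poly q z * G z) \<le> 1"
    "\<beta> - \<epsilon> \<le> cmod (poly q 0)"
proof -
  \<comment> \<open>Three losses of \<epsilon>' occur in the exponent: the truncated mean, the
    approximation by \<open>Q\<close>, and the shift that makes |exp (- Q - \<epsilon>') G| at most
    1 on the circle. Still, \<beta> exp (-3 \<epsilon>') is at least \<beta> - \<epsilon> /
    2.\<close>
  define \<epsilon>' where "\<epsilon>' = \<epsilon> / (6 * \<beta>)"
  have \<epsilon>': "\<epsilon>' > 0" using \<epsilon> \<beta> by (simp add: \<epsilon>'_def)
  obtain \<delta> where \<delta>: "\<delta> > 0" "integral {0..1} (\<lambda>x. ln (max (cmod (G (circ x))) \<delta>)) \<le> - ln \<beta> + \<epsilon>'"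
    using truncated_log_mean[OF contG holG U G0 low \<beta> \<epsilon>'] by blast
  define u where "u = (\<lambda>z. ln (max (cmod (G z)) \<delta>))"
  have contu: "continuous_on (cball 0 1) u"
    unfolding u_def using \<delta>(1) by (intro continuous_intros contG) auto
  obtain Q where Q: "\<And>z. cmod z = 1 \<Longrightarrow> \<bar>Re (poly Q z) - u z\<bar> < \<epsilon>'"
    using poly_Re_approx[OF continuous_on_subset[OF contu] \<epsilon>'] by (metis sphere_cball)
  have "((\<lambda>x. Re (poly Q (of_real 1 * circ x))) has_integral Re (poly Q 0)) {0..1}"
    by (rule mean_value_Re[where R = 2]) (auto intro!: holomorphic_intros)
  moreover have "((\<lambda>x. u (circ x)) has_integral integral {0..1} (\<lambda>x. u (circ x))) {0..1}"
    by (intro integrable_integral integrable_continuous_real continuous_on_compose2[OF contu])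
       (auto intro!: continuous_intros)
  hence "((\<lambda>x. u (circ x) + \<epsilon>') has_integral integral {0..1} (\<lambda>x. u (circ x)) + \<epsilon>') {0..1}"
    using has_integral_add[OF _ has_integral_const_real[of \<epsilon>' 0 1]] by fastforce
  ultimately have "Re (poly Q 0) \<le> integral {0..1} (\<lambda>x. u (circ x)) + \<epsilon>'"
  proof (rule has_integral_le)
    fix x :: real
    show "Re (poly Q (of_real 1 * circ x)) \<le> u (circ x) + \<epsilon>'"
      using Q[OF norm_circ[of x]] by simp
  qed
  also have "\<dots> \<le> - ln \<beta> + 2 * \<epsilon>'" using \<delta>(2) by (simp add: u_def)
  finally have Q0: "Re (poly Q 0) \<le> - ln \<beta> + 2 * \<epsilon>'" .
  have "bounded (G ` cball 0 1)"
    using compact_imp_bounded[OF compact_continuous_image[OF contG compact_cball]] .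
  then obtain M where "\<forall>y\<in>G ` cball 0 1. cmod y \<le> M" unfolding bounded_iff by blast
  hence M: "cmod (G z) \<le> M" if "cmod z \<le> 1" for z using that by simp
  have M0: "M \<ge> 0" using M[of 0] G0 by simp
  define b where "b = \<beta> * exp (- 3 * \<epsilon>')"
  have b0: "b > 0" using \<beta> by (simp add: b_def)
  \<comment> \<open>Chosen for the final step: after division by c = 1 + \<kappa> M the value b -
    \<kappa> is still at least b - \<kappa> (1 + b M), a loss of \<epsilon> / 2.\<close>
  define \<kappa> where "\<kappa> = \<epsilon> / (2 * (1 + b * M))"
  have bM: "1 + b * M > 0" using b0 M0 by (simp add: add_pos_nonneg)
  have half: "\<epsilon> / (2 * x) * x = \<epsilon> / 2" if "x > 0" for x using that by simp
  have \<kappa>: "\<kappa> > 0" "\<kappa> * (1 + b * M) = \<epsilon> / 2"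
    using \<epsilon> bM half[OF bM] by (simp_all only: \<kappa>_def divide_pos_pos mult_pos_pos zero_less_numeral)
  obtain q where q: "\<And>z. cmod z \<le> 1 \<Longrightarrow> cmod (exp (poly (- Q - [:of_real \<epsilon>':]) z) - poly q z) < \<kappa>"
    using poly_exp_approx[OF \<kappa>(1), where Q = "- Q - [:of_real \<epsilon>':]"] by blast
  define c where "c = 1 + \<kappa> * M"
  have c: "c > 0" using \<kappa> M0 by (simp add: c_def add_pos_nonneg)
  have on_sphere: "cmod (poly q z * G z) \<le> c" if z: "cmod z = 1" for z
  proof -
    define E where "E = exp (poly (- Q - [:of_real \<epsilon>':]) z)"
    have "cmod E = exp (- Re (poly Q z) - \<epsilon>')" by (simp add: E_def norm_exp_eq_Re)
    also have "\<dots> \<le> exp (- u z)" using Q[OF z] by (simp add: abs_less_iff)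
    finally have "cmod E * cmod (G z) \<le> exp (- u z) * exp (u z)"
      using \<delta>(1) by (intro mult_mono) (auto simp: u_def)
    hence 1: "cmod (E * G z) \<le> 1" by (simp add: norm_mult exp_minus)
    have "cmod (poly q z - E) * cmod (G z) \<le> \<kappa> * M"
      using q[of z] M[of z] z \<kappa> by (intro mult_mono) (auto simp: E_def norm_minus_commute less_imp_le)
    hence 2: "cmod ((poly q z - E) * G z) \<le> \<kappa> * M" by (simp add: norm_mult)
    have "poly q z * G z = E * G z + (poly q z - E) * G z" by (simp add: algebra_simps)
    hence "cmod (poly q z * G z) \<le> cmod (E * G z) + cmod ((poly q z - E) * G z)"
      by (metis norm_triangle_ineq)
    thus ?thesis using 1 2 by (simp add: c_def)
  qed
  have qG: "cmod (poly q z * G z) \<le> c" if "cmod z \<le> 1" for z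
  proof (rule maximum_modulus_frontier[where S = "cball 0 1" and f = "\<lambda>z. poly q z * G z"])
    show "(\<lambda>z. poly q z * G z) holomorphic_on interior (cball 0 1)"
      by (intro holomorphic_intros holomorphic_on_subset[OF holG]) (use U in auto)
    show "continuous_on (closure (cball 0 1)) (\<lambda>z. poly q z * G z)"
      by (simp, intro continuous_intros contG)
  qed (use that on_sphere in auto)
  have "b = exp (ln \<beta> - 3 * \<epsilon>')" using \<beta> by (simp add: b_def exp_diff exp_minus divide_inverse)
  also have "\<dots> \<le> exp (- Re (poly Q 0) - \<epsilon>')" using Q0 by simp
  also have "\<dots> = cmod (exp (poly (- Q - [:of_real \<epsilon>':]) 0))" by (simp add: norm_exp_eq_Re)
  finally have "b \<le> cmod (exp (poly (- Q - [:of_real \<epsilon>':]) 0))" .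
  moreover have "cmod (exp (poly (- Q - [:of_real \<epsilon>':]) 0) - poly q 0) < \<kappa>" by (rule q) simp
  ultimately have q0: "b - \<kappa> \<le> cmod (poly q 0)"
    using norm_triangle_ineq2[of "exp (poly (- Q - [:of_real \<epsilon>':]) 0)" "poly q 0"] by linarith
  show thesis
  proof (rule that[of "smult (of_real (1 / c)) q"])
    show "cmod (poly (smult (of_real (1 / c)) q) z * G z) \<le> 1" if "cmod z \<le> 1" for z
      using qG[OF that] c by (simp add: norm_mult norm_divide field_simps)
    have "\<beta> * (1 - 3 * \<epsilon>') \<le> b"
      using exp_ge_add_one_self[of "- 3 * \<epsilon>'"] \<beta> unfolding b_def by (intro mult_left_mono) auto
    moreover have "\<beta> * (1 - 3 * \<epsilon>') = \<beta> - \<epsilon> / 2" using \<beta> by (simp add: \<epsilon>'_def field_simps)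
    ultimately have "\<beta> - \<epsilon> \<le> b - \<kappa> * (1 + b * M)" using \<kappa>(2) by simp
    also have "\<dots> \<le> (b - \<kappa>) / c"
    proof -
      have "(b - \<kappa> * (1 + b * M)) * c = b - \<kappa> - \<kappa>\<^sup>2 * M - b * \<kappa>\<^sup>2 * M\<^sup>2"
        by (simp add: c_def algebra_simps power2_eq_square)
      moreover have "\<kappa>\<^sup>2 * M \<ge> 0" "b * \<kappa>\<^sup>2 * M\<^sup>2 \<ge> 0" using b0 M0 by auto
      ultimately have "(b - \<kappa> * (1 + b * M)) * c \<le> b - \<kappa>" by linarith
      thus ?thesis using c by (simp add: field_simps)
    qed
    also have "\<dots> \<le> cmod (poly q 0) / c" using q0 c by (intro divide_right_mono) auto
    also have "\<dots> = cmod (poly (smult (of_real (1 / c)) q) 0)" using c by (simp add: norm_mult norm_divide)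
    finally show "\<beta> - \<epsilon> \<le> cmod (poly (smult (of_real (1 / c)) q) 0)" .
  qed
qed

section \<open>The zeta function\<close>

text \<open>The falling factorial; divided by \<open>fact k\<close> it is the k-th binomial
  coefficient of a complex exponent.\<close>

definition ffact :: "nat \<Rightarrow> complex \<Rightarrow> complex" where
  "ffact k a = (\<Prod>i<k. a - of_nat i)"

lemma ffact_0 [simp]: "ffact 0 a = 1" and ffact_Suc: "ffact (Suc k) a = ffact k a * (a - of_nat k)"
  by (simp_all add: ffact_def)

lemma holomorphic_ffact [holomorphic_intros]: "f holomorphic_on A \<Longrightarrow> (\<lambda>s. ffact k (f s)) holomorphic_on A"
  unfolding ffact_def by (intro holomorphic_intros)

lemma ffact_bound:
  assumes "cmod a \<le> K" shows "cmod (ffact k a) \<le> (\<Prod>i<k. K + real i)"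
proof -
  have "cmod (a - of_nat i) \<le> K + real i" for i
    using norm_triangle_ineq4[of a "of_nat i"] assms by simp
  thus ?thesis unfolding ffact_def prod_norm[symmetric] by (intro prod_mono) auto
qed

definition binom_rem :: "nat \<Rightarrow> complex \<Rightarrow> complex \<Rightarrow> complex" where
  "binom_rem M a w = (1 + w) powr a - (\<Sum>k\<le>M. ffact k a * w ^ k / fact k)"

text \<open>Taylor's formula is applied on the real segment [0, 1] only. There |1 + u| >= 1, and the
  exponent in the derivative of order M + 1 has real part at most 0.\<close>

lemma binom_rem_bound:
  assumes t: "0 \<le> t" "t \<le> 1" and a: "Re a \<le> real (Suc M)"
  shows "cmod (binom_rem M a (of_real t)) \<le> cmod (ffact (Suc M) a) * t ^ Suc M"
proof -
  define S where "S = (of_real ` {0..1} :: complex set)"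
  define f where "f = (\<lambda>i w. ffact i a * (1 + w) powr (a - of_nat i))"
  have S: "\<exists>u. w = of_real u \<and> 0 \<le> u \<and> u \<le> 1" if "w \<in> S" for w using that by (auto simp: S_def)
  have "cmod (f 0 (of_real t) - (\<Sum>i\<le>M. f i 0 * (of_real t - 0) ^ i / fact i))
      \<le> cmod (ffact (Suc M) a) * cmod (of_real t - 0) ^ Suc M / fact M"
  proof (rule complex_Taylor)
    show "convex S" unfolding S_def
      by (intro convex_linear_image convex_closed_interval linearI) (auto simp: scaleR_conv_of_real)
    show "(f i has_field_derivative f (Suc i) w) (at w within S)" if wS: "w \<in> S" for i w
    proof -
      obtain u where u: "w = of_real u" "0 \<le> u" using S[OF wS] by blast
      have "1 + w \<notin> \<real>\<^sub>\<le>\<^sub>0" using u by (auto simp: complex_nonpos_Reals_iff)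
      hence "(f i has_field_derivative ffact i a * ((a - of_nat i) * (1 + w) powr (a - of_nat i - 1))) (at w within S)"
        unfolding f_def by (auto intro!: derivative_eq_intros)
      moreover have "a - of_nat i - 1 = a - of_nat (Suc i)" by simp
      ultimately show ?thesis unfolding f_def by (simp only: ffact_Suc mult.assoc)
    qed
    show "cmod (f (Suc M) w) \<le> cmod (ffact (Suc M) a)" if wS: "w \<in> S" for w
    proof -
      obtain u where u: "w = of_real u" "0 \<le> u" using S[OF wS] by blast
      have "cmod ((1 + w) powr (a - of_nat (Suc M))) = (1 + u) powr (Re a - real (Suc M))"
        using u norm_powr_real_powr[of "1 + w" "a - of_nat (Suc M)"] by simp
      also have "\<dots> \<le> (1 + u) powr 0" using u a by (intro powr_mono) auto
      also have "\<dots> = 1" using u by simp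
      finally show ?thesis unfolding f_def norm_mult by (intro mult_left_le) auto
    qed
    show "0 \<in> S" "of_real t \<in> S" unfolding S_def using t by (auto simp: image_iff intro: bexI[of _ 0])
  qed
  also have "f 0 (of_real t) - (\<Sum>i\<le>M. f i 0 * (of_real t - 0) ^ i / fact i) = binom_rem M a (of_real t)"
    by (simp add: f_def binom_rem_def)
  also have "cmod (ffact (Suc M) a) * cmod (of_real t - 0) ^ Suc M / fact M \<le> cmod (ffact (Suc M) a) * t ^ Suc M"
  proof -
    have "x / fact M \<le> x" if "x \<ge> 0" for x :: real
      using divide_left_mono[of 1 "fact M" x] fact_ge_1[of M, where 'a = real] that by simp
    moreover have "cmod (of_real t - 0) = t" using t by simp
    ultimately show ?thesis using t by (simp only:) simp
  qed
  finally show ?thesis .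
qed

text \<open>With N = n + 1 this is (N + 1)^(1-s) minus the first M + 1 terms of its expansion in
  descending powers of N; it is of order N^(-s-M).\<close>

definition zeta_rem :: "nat \<Rightarrow> complex \<Rightarrow> nat \<Rightarrow> complex" where
  "zeta_rem M s n = of_nat (Suc n) powr (1 - s) * binom_rem M (1 - s) (1 / of_nat (Suc n))"

lemma zeta_rem_bound:
  assumes s: "Re s \<ge> - real M"
  shows "cmod (zeta_rem M s n) \<le> cmod (ffact (Suc M) (1 - s)) * real (Suc n) powr (- Re s - real M)"
proof -
  define N where "N = real (Suc n)"
  have N: "N > 0" "N \<ge> 1" by (auto simp: N_def)
  have "cmod (binom_rem M (1 - s) (of_real (1 / N))) \<le> cmod (ffact (Suc M) (1 - s)) * (1 / N) ^ Suc M"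
    using N s by (intro binom_rem_bound) auto
  moreover have "cmod (of_nat (Suc n) powr (1 - s)) = N powr (1 - Re s)"
    using norm_powr_real_powr[of "of_nat (Suc n)" "1 - s"] by (simp add: N_def)
  ultimately have "cmod (zeta_rem M s n) \<le> N powr (1 - Re s) * (cmod (ffact (Suc M) (1 - s)) * (1 / N) ^ Suc M)"
    unfolding zeta_rem_def norm_mult by (intro mult_mono) (auto simp: N_def)
  also have "(1 / N) ^ Suc M = N powr (- real (Suc M))"
    using N(1) by (simp only: powr_minus powr_realpow power_one_over inverse_eq_divide)
  also have "N powr (1 - Re s) * (cmod (ffact (Suc M) (1 - s)) * N powr (- real (Suc M))) =
      cmod (ffact (Suc M) (1 - s)) * N powr (1 - Re s + (- real (Suc M)))"
    unfolding powr_add by simp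
  also have "1 - Re s + (- real (Suc M)) = - Re s - real M" by simp
  finally show ?thesis by (simp add: N_def)
qed

lemma summable_powr_Suc: "x > 1 \<Longrightarrow> summable (\<lambda>n. real (Suc n) powr (- x))"
proof -
  assume "x > 1"
  hence "summable (\<lambda>n. real n powr (- x))" by (subst summable_real_powr_iff) auto
  thus ?thesis by (subst summable_Suc_iff)
qed

lemma holomorphic_zeta_rem: "(\<lambda>s. zeta_rem M s n) holomorphic_on A"
  unfolding zeta_rem_def binom_rem_def
  by (intro holomorphic_intros) (auto simp: complex_nonpos_Reals_iff add_nonneg_pos simp flip: of_nat_Suc)

lemma zeta_rem_summable:
  assumes "Re s > 1 - real M"
  shows "summable (zeta_rem M s)"
proof (rule summable_comparison_test')
  show "summable (\<lambda>n. cmod (ffact (Suc M) (1 - s)) * real (Suc n) powr (- (Re s + real M)))"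
    using assms by (intro summable_mult summable_powr_Suc) auto
  show "norm (zeta_rem M s n) \<le> cmod (ffact (Suc M) (1 - s)) * real (Suc n) powr (- (Re s + real M))" for n
    using zeta_rem_bound[of M s n] assms by simp
qed

lemma holomorphic_zeta_rem_sum:
  "(\<lambda>s. \<Sum>n. zeta_rem M s n) holomorphic_on {s. Re s > 1 - real M}"
proof (rule holomorphic_uniform_sequence)
  show "open {s. Re s > 1 - real M}" by (rule open_halfspace_Re_gt)
  show "(\<lambda>s. \<Sum>i<n. zeta_rem M s i) holomorphic_on {s. Re s > 1 - real M}" for n
    by (intro holomorphic_intros holomorphic_zeta_rem)
  fix s assume "s \<in> {s. Re s > 1 - real M}"
  hence s: "Re s > 1 - real M" by simp
  define d where "d = (Re s - (1 - real M)) / 2"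
  have d: "d > 0" using s by (simp add: d_def)
  have ball: "Re z \<ge> 1 - real M + d" "cmod (1 - z) \<le> 1 + cmod s + d" if "z \<in> cball s d" for z
  proof -
    have "\<bar>Re (s - z)\<bar> \<le> d" using that abs_Re_le_cmod[of "s - z"] by (simp add: dist_norm)
    moreover have "Re s = 1 - real M + 2 * d" by (simp add: d_def field_simps)
    ultimately show "Re z \<ge> 1 - real M + d" unfolding minus_complex.simps by linarith
    have "1 - z = 1 - s + (s - z)" by simp
    hence "cmod (1 - z) \<le> cmod (1 - s) + cmod (s - z)" by (metis norm_triangle_ineq)
    also have "cmod (1 - s) \<le> 1 + cmod s" using norm_triangle_ineq4[of 1 s] by simp
    finally show "cmod (1 - z) \<le> 1 + cmod s + d" using that by (simp add: dist_norm)
  qed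
  define C where "C = (\<Prod>i<Suc M. 1 + cmod s + d + real i)"
  have "uniform_limit (cball s d) (\<lambda>n s. \<Sum>i<n. zeta_rem M s i) (\<lambda>s. \<Sum>n. zeta_rem M s n) sequentially"
  proof (rule Weierstrass_m_test)
    show "summable (\<lambda>n. C * real (Suc n) powr (- (1 + d)))"
      using d by (intro summable_mult summable_powr_Suc) auto
    fix n z assume z: "z \<in> cball s d"
    have "cmod (zeta_rem M z n) \<le> cmod (ffact (Suc M) (1 - z)) * real (Suc n) powr (- Re z - real M)"
      using ball[OF z] d by (intro zeta_rem_bound) auto
    also have "\<dots> \<le> C * real (Suc n) powr (- (1 + d))"
      unfolding C_def using ball[OF z]
      by (intro mult_mono ffact_bound powr_mono prod_nonneg) (auto intro!: add_nonneg_nonneg simp: less_imp_le[OF d])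
    finally show "norm (zeta_rem M z n) \<le> C * real (Suc n) powr (- (1 + d))" by simp
  qed
  moreover have "cball s d \<subseteq> {s. Re s > 1 - real M}" using ball d by fastforce
  ultimately show "\<exists>d>0. cball s d \<subseteq> {s. Re s > 1 - real M} \<and>
      uniform_limit (cball s d) (\<lambda>n s. \<Sum>i<n. zeta_rem M s i) (\<lambda>s. \<Sum>n. zeta_rem M s n) sequentially"
    using d by blast
qed

section \<open>Analytic continuation of the Dirichlet series\<close>

definition zeta_series :: "complex \<Rightarrow> complex" where
  "zeta_series s = (\<Sum>n. 1 / of_nat (Suc n) powr s)"

lemma zeta_series_summable:
  assumes "Re s > 1" shows "summable (\<lambda>n. 1 / of_nat (Suc n) powr s :: complex)"
proof (rule summable_comparison_test')
  show "summable (\<lambda>n. real (Suc n) powr (- Re s))" using assms by (rule summable_powr_Suc)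
  show "norm (1 / of_nat (Suc n) powr s :: complex) \<le> real (Suc n) powr (- Re s)" for n
    using norm_powr_real_powr[of "of_nat (Suc n)" s] by (simp add: norm_divide norm_inverse powr_minus divide_inverse)
qed

lemma zeta_series_sums: "Re s > 1 \<Longrightarrow> (\<lambda>n. 1 / of_nat (Suc n) powr s) sums zeta_series s"
  unfolding zeta_series_def by (rule summable_sums[OF zeta_series_summable])

text \<open>Expanding the summands of the telescoping series of \<open>(n + 1)\<^sup>1\<^sup>-\<^sup>s - n\<^sup>1\<^sup>-\<^sup>s\<close> binomially
  expresses \<open>(s - 1) \<zeta>(s)\<close> by the values \<open>\<zeta>(s + 1), \<zeta>(s + 2), \<dots>\<close>, which extends it strip by strip.\<close>

lemma zeta_series_recurrence:
  assumes s: "Re s > 1" and M: "M \<ge> 1"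
  shows "(s - 1) * zeta_series s = 1 + (\<Sum>n. zeta_rem M s n)
     + (\<Sum>k\<in>{2..M}. ffact k (1 - s) / fact k * zeta_series (s + of_nat (k - 1)))"
proof -
  define b where "b = (\<lambda>n. complex_of_nat (Suc n) powr (1 - s))"
  have b_lim: "b \<longlonglongrightarrow> 0"
  proof (rule tendsto_norm_zero_cancel)
    have "(\<lambda>n. real (Suc n) powr (1 - Re s)) \<longlonglongrightarrow> 0"
      using s by (intro LIMSEQ_Suc tendsto_neg_powr filterlim_real_sequentially) auto
    moreover have "cmod (b n) = real (Suc n) powr (1 - Re s)" for n
      unfolding b_def using norm_powr_real_powr[of "of_nat (Suc n)" "1 - s"] by simp
    ultimately show "(\<lambda>n. cmod (b n)) \<longlonglongrightarrow> 0" by simp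
  qed
  have tele: "(\<lambda>n. b (Suc n) - b n) sums (0 - b 0)" by (rule telescope_sums[OF b_lim])
  \<comment> \<open>The term k = 0 reproduces \<open>b n\<close>; the term k contributes N^(1-s-k),
    a summand of the series at s + k - 1.\<close>
  have expand: "b (Suc n) - b n = zeta_rem M s n
     + (\<Sum>k\<in>{1..M}. ffact k (1 - s) / fact k * (1 / of_nat (Suc n) powr (s + of_nat (k - 1))))" for n
  proof -
    define N where "N = complex_of_nat (Suc n)"
    have N0: "N \<noteq> 0" by (simp add: N_def del: of_nat_Suc)
    have "N * (1 + 1 / N) = N + 1" using N0 by (simp add: algebra_simps)
    also have "\<dots> = of_nat (Suc (Suc n))" by (simp add: N_def)
    finally have "b (Suc n) = (N * (1 + 1 / N)) powr (1 - s)" by (simp only: b_def)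
    also have "\<dots> = N powr (1 - s) * (1 + 1 / N) powr (1 - s)"
    proof -
      have "N = of_real (real (Suc n))" "1 + 1 / N = of_real (1 + 1 / real (Suc n))"
        by (simp_all add: N_def)
      thus ?thesis using powr_times_real[of N "1 + 1 / N" "1 - s"]
        by (metis Re_complex_of_real Reals_of_real add_nonneg_nonneg of_nat_0_le_iff zero_le_divide_1_iff zero_le_one)
    qed
    also have "(1 + 1 / N) powr (1 - s) = binom_rem M (1 - s) (1 / N) + (\<Sum>k\<le>M. ffact k (1 - s) * (1 / N) ^ k / fact k)"
      by (simp add: binom_rem_def)
    also have "{..M} = insert 0 {1..M}" by auto
    also have "(\<Sum>k\<in>insert 0 {1..M}. ffact k (1 - s) * (1 / N) ^ k / fact k) =
        1 + (\<Sum>k\<in>{1..M}. ffact k (1 - s) * (1 / N) ^ k / fact k)" by simp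
    also have "N powr (1 - s) * (binom_rem M (1 - s) (1 / N) + (1 + (\<Sum>k\<in>{1..M}. ffact k (1 - s) * (1 / N) ^ k / fact k))) =
        zeta_rem M s n + b n + (\<Sum>k\<in>{1..M}. ffact k (1 - s) / fact k * (N powr (1 - s) * (1 / N) ^ k))"
      by (simp add: zeta_rem_def b_def N_def[symmetric] algebra_simps sum_distrib_left del: of_nat_Suc)
    also have "(\<Sum>k\<in>{1..M}. ffact k (1 - s) / fact k * (N powr (1 - s) * (1 / N) ^ k)) =
        (\<Sum>k\<in>{1..M}. ffact k (1 - s) / fact k * (1 / N powr (s + of_nat (k - 1))))"
    proof (intro sum.cong refl arg_cong2[where f = times])
      fix k assume "k \<in> {1..M}"
      hence k: "k \<ge> 1" by simp
      have "s + of_nat (k - 1) = of_nat k - (1 - s)" using k by (simp add: of_nat_diff)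
      hence "N powr (s + of_nat (k - 1)) = N ^ k / N powr (1 - s)"
        using N0 by (simp only: powr_diff powr_nat if_False)
      thus "N powr (1 - s) * (1 / N) ^ k = 1 / N powr (s + of_nat (k - 1))"
        by (simp add: power_one_over divide_inverse power_inverse)
    qed
    finally show ?thesis by (simp add: N_def del: of_nat_Suc)
  qed
  have "(\<lambda>n. zeta_rem M s n + (\<Sum>k\<in>{1..M}. ffact k (1 - s) / fact k * (1 / of_nat (Suc n) powr (s + of_nat (k - 1)))))
     sums ((\<Sum>n. zeta_rem M s n) + (\<Sum>k\<in>{1..M}. ffact k (1 - s) / fact k * zeta_series (s + of_nat (k - 1))))"
    using s M by (intro sums_add sums_sum sums_mult zeta_series_sums summable_sums zeta_rem_summable) auto
  hence "0 - b 0 = (\<Sum>n. zeta_rem M s n) + (\<Sum>k\<in>{1..M}. ffact k (1 - s) / fact k * zeta_series (s + of_nat (k - 1)))"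
    using tele expand sums_unique2 by (metis (no_types, lifting) sums_cong)
  moreover have "b 0 = 1" by (simp add: b_def)
  \<comment> \<open>The term k = 1 is (1 - s) times the series at s; brought to the other side it
    becomes the left-hand side of the recurrence.\<close>
  moreover have "{1..M} = insert 1 {2..M}" using M by auto
  ultimately have "- 1 = (\<Sum>n. zeta_rem M s n) + ((1 - s) * zeta_series s +
      (\<Sum>k\<in>{2..M}. ffact k (1 - s) / fact k * zeta_series (s + of_nat (k - 1))))"
    by (simp add: ffact_def)
  thus ?thesis by (simp add: algebra_simps)
qed

lemma zeta_strip_extension:
  "\<exists>g. g holomorphic_on {s. Re s > - real N} \<and> (\<forall>s. Re s > 1 \<longrightarrow> g s = (s - 1) * zeta_series s)"
proof (induction N)
  case 0
  have "(\<lambda>s. 1 + (\<Sum>n. zeta_rem 1 s n)) holomorphic_on {s. Re s > 1 - real 1}"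
    by (intro holomorphic_intros holomorphic_zeta_rem_sum)
  thus ?case using zeta_series_recurrence[of _ 1]
    by (intro exI[of _ "\<lambda>s. 1 + (\<Sum>n. zeta_rem 1 s n)"]) auto
next
  case (Suc N)
  then obtain g where g: "g holomorphic_on {s. Re s > - real N}" "\<And>s. Re s > 1 \<Longrightarrow> g s = (s - 1) * zeta_series s"
    by blast
  \<comment> \<open>The remainder series converges for Re s > 1 - M, which for M = N + 2 is the new
    half-plane.\<close>
  define M where "M = N + 2"
  \<comment> \<open>The last factor of \<open>ffact k (1 - s)\<close> is -(s + k - 2), exactly what
    turns the series at s + k - 1 into \<open>g\<close>. Absorbing it there keeps the sum free of
    poles.\<close>
  define g' where "g' = (\<lambda>s. 1 + (\<Sum>n. zeta_rem M s n) +
      (\<Sum>k\<in>{2..M}. - ffact (k - 1) (1 - s) / fact k * g (s + of_nat (k - 1))))"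
  have "(\<lambda>s. g (s + of_nat (k - 1))) holomorphic_on {s. Re s > - real (Suc N)}" if "k \<in> {2..M}" for k
  proof -
    have "(g \<circ> (\<lambda>s. s + of_nat (k - 1))) holomorphic_on {s. Re s > - real (Suc N)}"
    proof (rule holomorphic_on_compose_gen[OF _ g(1)])
      show "(\<lambda>s. s + of_nat (k - 1)) holomorphic_on {s. Re s > - real (Suc N)}" by (intro holomorphic_intros)
      have "real (k - 1) \<ge> 1" using that by auto
      thus "(\<lambda>s. s + of_nat (k - 1)) ` {s. Re s > - real (Suc N)} \<subseteq> {s. Re s > - real N}" by auto
    qed
    thus ?thesis by (simp add: o_def)
  qed
  moreover have "(\<lambda>s. \<Sum>n. zeta_rem M s n) holomorphic_on {s. Re s > - real (Suc N)}"
    by (rule holomorphic_on_subset[OF holomorphic_zeta_rem_sum]) (auto simp: M_def)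
  ultimately have "g' holomorphic_on {s. Re s > - real (Suc N)}"
    unfolding g'_def by (intro holomorphic_intros) auto
  moreover have "g' s = (s - 1) * zeta_series s" if s: "Re s > 1" for s
  proof -
    have "(\<Sum>k\<in>{2..M}. - ffact (k - 1) (1 - s) / fact k * g (s + of_nat (k - 1))) =
        (\<Sum>k\<in>{2..M}. ffact k (1 - s) / fact k * zeta_series (s + of_nat (k - 1)))"
    proof (intro sum.cong refl)
      fix k assume k: "k \<in> {2..M}"
      then obtain j where j: "k = Suc j" by (cases k) auto
      have gj: "g (s + of_nat j) = (s + of_nat j - 1) * zeta_series (s + of_nat j)" using s by (intro g) auto
      have e: "1 - s - of_nat j = - (s + of_nat j - 1)" by simp
      show "- ffact (k - 1) (1 - s) / fact k * g (s + of_nat (k - 1)) =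
         ffact k (1 - s) / fact k * zeta_series (s + of_nat (k - 1))"
        unfolding j diff_Suc_1 ffact_Suc gj e by (simp only: minus_mult_left[symmetric] minus_mult_right[symmetric] minus_divide_left[symmetric] times_divide_eq_left mult.assoc)
    qed
    thus ?thesis using zeta_series_recurrence[OF s, of M] by (simp add: g'_def M_def)
  qed
  ultimately show ?case by blast
qed

lemma zeta_series_extension_unique:
  assumes "f holomorphic_on S" "g holomorphic_on S" "open S" "connected S" "{s. Re s > 1} \<subseteq> S"
    "\<And>s. Re s > 1 \<Longrightarrow> f s = g s" "s \<in> S"
  shows "f s = g s"
proof (rule analytic_continuation_open[of "{s. Re s > 1}" S f g])
  have "2 \<in> {s. Re s > 1}" by simp
  thus "{s. Re s > 1} \<noteq> {}" by blast
qed (use assms open_halfspace_Re_gt[of 1] in auto)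

lemma connected_halfspace_Re_gt: "connected {s. Re s > a}"
  by (intro convex_connected convex_halfspace_Re_gt)

lemma zeta_entire_extension:
  "\<exists>g. g holomorphic_on UNIV \<and> (\<forall>s. Re s > 1 \<longrightarrow> g s = (s - 1) * zeta_series s)"
proof -
  obtain G where G: "\<And>N. G N holomorphic_on {s. Re s > - real N}"
    "\<And>N s. Re s > 1 \<Longrightarrow> G N s = (s - 1) * zeta_series s"
    using zeta_strip_extension by metis
  have agree: "G N s = G N' s" if "Re s > - real N" "N \<le> N'" for N N' s
    by (rule zeta_series_extension_unique[where S = "{s. Re s > - real N}"])
       (use that G in \<open>auto intro: holomorphic_on_subset[OF G(1)] connected_halfspace_Re_gt open_halfspace_Re_gt\<close>)
  \<comment> \<open>The index only has to exceed -Re s; \<open>agree\<close> makes the value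
    independent of it.\<close>
  define g where "g = (\<lambda>s. G (nat \<lceil>\<bar>Re s\<bar>\<rceil> + 1) s)"
  have geq: "g s = G N s" if "Re s > - real N" for s N
  proof -
    have "Re s > - real (nat \<lceil>\<bar>Re s\<bar>\<rceil> + 1)" by linarith
    thus ?thesis unfolding g_def using that agree[of N s "nat \<lceil>\<bar>Re s\<bar>\<rceil> + 1"] agree[of "nat \<lceil>\<bar>Re s\<bar>\<rceil> + 1" s N]
      by (metis linorder_linear)
  qed
  have "g holomorphic_on (\<Union>N. {s. Re s > - real N})"
  proof (rule holomorphic_on_UN_open)
    show "g holomorphic_on {s. Re s > - real N}" for N
      by (rule holomorphic_transform[OF G(1)]) (use geq in auto)
  qed (rule open_halfspace_Re_gt)
  moreover have "(\<Union>N. {s. Re s > - real N}) = UNIV"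
  proof -
    have "Re s > - real (nat \<lceil>\<bar>Re s\<bar>\<rceil> + 1)" for s by linarith
    thus ?thesis by blast
  qed
  moreover have "g s = (s - 1) * zeta_series s" if "Re s > 1" for s
    using geq[of 0 s] that G(2) by simp
  ultimately show ?thesis by auto
qed

lemma connected_minus_1: "connected (- {1 :: complex})"
  by (rule connected_punctured_universe) simp

text \<open>Justifies the definite description: existence from the entire extension of (s - 1) times
  the series, uniqueness from the identity theorem on the connected punctured plane and the fixed
  value at 1.\<close>

lemma riemann_zeta_properties:
  "riemann_zeta holomorphic_on - {1} \<and>
     (\<forall>s. Re s > 1 \<longrightarrow> (\<lambda>n. 1 / of_nat (Suc n) powr s) sums riemann_zeta s) \<and> riemann_zeta 1 = 0"
proof -
  obtain g where g: "g holomorphic_on UNIV" "\<And>s. Re s > 1 \<Longrightarrow> g s = (s - 1) * zeta_series s"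
    using zeta_entire_extension by blast
  define f where "f = (\<lambda>s. if s = 1 then 0 else g s / (s - 1))"
  have "(\<lambda>s. g s / (s - 1)) holomorphic_on - {1}"
    by (intro holomorphic_intros holomorphic_on_subset[OF g(1)]) auto
  hence "f holomorphic_on - {1}" by (rule holomorphic_transform) (auto simp: f_def)
  moreover have "f s = zeta_series s" if "Re s > 1" for s
    using that g(2)[OF that] by (auto simp: f_def)
  ultimately have f: "f holomorphic_on - {1} \<and>
     (\<forall>s. Re s > 1 \<longrightarrow> (\<lambda>n. 1 / of_nat (Suc n) powr s) sums f s) \<and> f 1 = 0"
    using zeta_series_sums by (auto simp: f_def)
  have ex1: "\<exists>!f. f holomorphic_on - {1} \<and>
     (\<forall>s. Re s > 1 \<longrightarrow> (\<lambda>n. 1 / of_nat (Suc n) powr s) sums f s) \<and> f 1 = 0"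
  proof (rule ex1I[where a = f])
    show "f holomorphic_on - {1} \<and>
     (\<forall>s. Re s > 1 \<longrightarrow> (\<lambda>n. 1 / of_nat (Suc n) powr s) sums f s) \<and> f 1 = 0" by (rule f)
    fix h assume h: "h holomorphic_on - {1} \<and>
     (\<forall>s. Re s > 1 \<longrightarrow> (\<lambda>n. 1 / of_nat (Suc n) powr s) sums h s) \<and> h 1 = 0"
    show "h = f"
    proof
      fix s show "h s = f s"
      proof (cases "s = 1")
        case False
        show ?thesis
          by (rule zeta_series_extension_unique[where S = "- {1}"])
             (use False h f connected_minus_1 in \<open>auto intro: sums_unique2\<close>)
      qed (use h f in auto)
    qed
  qed
  from theI'[OF ex1] show ?thesis unfolding riemann_zeta_def .
qed

lemma riemann_zeta_holomorphic: "riemann_zeta holomorphic_on - {1}"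
  using riemann_zeta_properties by blast

lemma riemann_zeta_eq_series: "Re s > 1 \<Longrightarrow> riemann_zeta s = zeta_series s"
  using riemann_zeta_properties zeta_series_sums sums_unique2 by blast

section \<open>The entire function (s - 1) zeta(s)\<close>

text \<open>The value at 1 is the residue of zeta, which removes the singularity.\<close>

definition zeta_reg :: "complex \<Rightarrow> complex" where
  "zeta_reg s = (if s = 1 then 1 else (s - 1) * riemann_zeta s)"

lemma zeta_reg_eq_rem:
  assumes "Re s > 0" shows "zeta_reg s = 1 + (\<Sum>n. zeta_rem 1 s n)"
proof (cases "s = 1")
  case True
  have "1 + 1 / of_nat (Suc n) \<noteq> (0 :: complex)" for n
  proof -
    have "(1 + 1 / of_nat (Suc n) :: complex) = of_real (1 + 1 / real (Suc n))" by simp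
    moreover have "1 + 1 / real (Suc n) > 0" by (intro add_pos_nonneg) auto
    ultimately show ?thesis by (metis of_real_eq_0_iff less_irrefl)
  qed
  \<comment> \<open>For the exponent 1 - s = 0 the binomial expansion is exact, provided the base is
    nonzero: \<open>0 powr 0\<close> is 0.\<close>
  hence "zeta_rem 1 1 n = 0" for n
    by (simp add: zeta_rem_def binom_rem_def ffact_def del: of_nat_Suc)
  thus ?thesis using True by (simp add: zeta_reg_def)
next
  case False
  define S where "S = {s. Re s > 0} - {1}"
  have S1: "open S" unfolding S_def by (intro open_Diff open_halfspace_Re_gt) auto
  have S2: "connected S" unfolding S_def
    by (intro connected_open_delete open_halfspace_Re_gt connected_halfspace_Re_gt) simp
  have S3: "(\<lambda>s. (s - 1) * riemann_zeta s) holomorphic_on S"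
    by (intro holomorphic_intros holomorphic_on_subset[OF riemann_zeta_holomorphic]) (auto simp: S_def)
  have S4: "(\<lambda>s. 1 + (\<Sum>n. zeta_rem 1 s n)) holomorphic_on S"
    by (intro holomorphic_intros holomorphic_on_subset[OF holomorphic_zeta_rem_sum]) (auto simp: S_def)
  have "(s - 1) * riemann_zeta s = 1 + (\<Sum>n. zeta_rem 1 s n)"
    by (rule zeta_series_extension_unique[OF S3 S4 S1 S2])
       (use assms False zeta_series_recurrence[of _ 1] in \<open>auto simp: S_def riemann_zeta_eq_series\<close>)
  thus ?thesis using False by (simp add: zeta_reg_def)
qed

lemma zeta_reg_holomorphic: "zeta_reg holomorphic_on UNIV"
proof -
  have "zeta_reg holomorphic_on {s. Re s > 0} \<union> - {1}"
  proof (rule holomorphic_on_Un)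
    have "(\<lambda>s. 1 + (\<Sum>n. zeta_rem 1 s n)) holomorphic_on {s. Re s > 0}"
      by (intro holomorphic_intros holomorphic_on_subset[OF holomorphic_zeta_rem_sum]) auto
    thus "zeta_reg holomorphic_on {s. Re s > 0}"
      by (rule holomorphic_transform) (simp add: zeta_reg_eq_rem)
    have "(\<lambda>s. (s - 1) * riemann_zeta s) holomorphic_on - {1}"
      by (intro holomorphic_intros riemann_zeta_holomorphic)
    thus "zeta_reg holomorphic_on - {1}"
      by (rule holomorphic_transform) (auto simp: zeta_reg_def)
  qed (auto intro: open_halfspace_Re_gt)
  moreover have "{s. Re s > 0} \<union> - {1 :: complex} = UNIV" by auto
  ultimately show ?thesis by simp
qed

text \<open>The remainder with M = 1 carries the factor (1 - s)(-s) and a power of n + 1 with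
  exponent at most -3/2 on this half-plane. The quadratic growth decides the exponent in
  \<open>zeta_disc 3\<close>.\<close>

lemma zeta_reg_growth:
  obtains C where "C \<ge> 0" "\<And>s. Re s \<ge> 1/2 \<Longrightarrow> cmod (zeta_reg s) \<le> 1 + C * (cmod (1 - s) * cmod s)"
proof
  define C where "C = (\<Sum>n. real (Suc n) powr (- (3/2)))"
  have sm: "summable (\<lambda>n. real (Suc n) powr (- (3/2)))" by (rule summable_powr_Suc) simp
  show "C \<ge> 0" unfolding C_def by (intro suminf_nonneg sm) simp
  fix s assume s: "Re s \<ge> 1/2"
  define A where "A = cmod (1 - s) * cmod s"
  have b: "norm (zeta_rem 1 s n) \<le> A * real (Suc n) powr (- (3/2))" for n
  proof -
    have "cmod (zeta_rem 1 s n) \<le> cmod (ffact (Suc 1) (1 - s)) * real (Suc n) powr (- Re s - real 1)"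
      using s by (intro zeta_rem_bound) auto
    also have "ffact (Suc 1) (1 - s) = (1 - s) * (- s)" by (simp add: ffact_def numeral_2_eq_2)
    also have "cmod ((1 - s) * (- s)) = A" by (simp add: A_def norm_mult)
    also have "real (Suc n) powr (- Re s - real 1) \<le> real (Suc n) powr (- (3/2))"
      using s by (intro powr_mono) auto
    finally show ?thesis by (simp add: A_def mult_left_mono)
  qed
  have "cmod (\<Sum>n. zeta_rem 1 s n) \<le> (\<Sum>n. A * real (Suc n) powr (- (3/2)))"
    by (intro norm_suminf_le b summable_mult sm)
  also have "\<dots> = A * C" unfolding C_def by (intro suminf_mult sm)
  finally show "cmod (zeta_reg s) \<le> 1 + C * (cmod (1 - s) * cmod s)"
    using norm_triangle_ineq[of 1 "\<Sum>n. zeta_rem 1 s n"] s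
    by (simp add: zeta_reg_eq_rem A_def mult.commute)
qed

text \<open>The first term of the Dirichlet series is 1 and the others are positive. This excludes
  exponential decay of the transform towards z = 1.\<close>

lemma zeta_reg_real_lower:
  assumes x: "x > 1" shows "cmod (zeta_reg (of_real x)) \<ge> x - 1"
proof -
  have "(\<lambda>n. Re (1 / of_nat (Suc n) powr (of_real x))) sums Re (zeta_series (of_real x))"
    using x by (intro sums_Re zeta_series_sums) simp
  moreover have "Re (1 / of_nat (Suc n) powr (of_real x :: complex)) = real (Suc n) powr (- x)" for n
  proof -
    have "(of_nat (Suc n) powr (of_real x) :: complex) = of_real (real (Suc n) powr x)"
      using powr_of_real[of "real (Suc n)" x] by simp
    hence "(1 / of_nat (Suc n) powr (of_real x) :: complex) = of_real (real (Suc n) powr (- x))"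
      by (simp add: powr_minus divide_inverse)
    thus ?thesis by simp
  qed
  ultimately have s: "(\<lambda>n. real (Suc n) powr (- x)) sums Re (zeta_series (of_real x))" by simp
  have "(\<Sum>n<1. real (Suc n) powr (- x)) \<le> Re (zeta_series (of_real x))"
    using sums_unique[OF s] sum_le_suminf[OF sums_summable[OF s], of "{..<1}"] by auto
  hence "1 \<le> cmod (zeta_series (of_real x))"
    using complex_Re_le_cmod[of "zeta_series (of_real x)"] by simp
  moreover have "cmod (zeta_reg (of_real x)) = (x - 1) * cmod (zeta_series (of_real x))"
  proof -
    have "cmod (of_real x - 1) = x - 1" using x by (metis norm_of_real of_real_1 of_real_diff abs_of_pos diff_gt_0_iff_gt)
    thus ?thesis using x by (auto simp: zeta_reg_def riemann_zeta_eq_series norm_mult)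
  qed
  ultimately show ?thesis using x by simp
qed

lemma zeta_reg_zeros: "Re s > 1/2 \<Longrightarrow> zeta_reg s = 0 \<longleftrightarrow> s \<in> zeta_zeros_right"
  by (auto simp: zeta_reg_def zeta_zeros_right_def)

lemma zorder_zeta_reg:
  assumes "\<rho> \<in> zeta_zeros_right" shows "zorder zeta_reg \<rho> = zorder riemann_zeta \<rho>"
proof -
  have \<rho>: "\<rho> \<noteq> 1" using assms by (auto simp: zeta_zeros_right_def)
  have "zeta_reg 1 \<noteq> 0" by (simp add: zeta_reg_def)
  hence ex: "\<exists>w\<in>UNIV. zeta_reg w \<noteq> 0" by blast
  from zorder_exist_zero[OF zeta_reg_holomorphic open_UNIV connected_UNIV UNIV_I ex, of \<rho>] obtain r p where
    r: "r > 0" and p: "p holomorphic_on cball \<rho> r"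
    "\<And>w. w \<in> cball \<rho> r \<Longrightarrow> zeta_reg w = p w * (w - \<rho>) ^ nat (zorder zeta_reg \<rho>) \<and> p w \<noteq> 0"
    by blast
  have zo: "zorder zeta_reg \<rho> \<ge> 0"
    using zorder_exist_zero[OF zeta_reg_holomorphic open_UNIV connected_UNIV UNIV_I ex, of \<rho>] by (auto split: if_splits)
  define S where "S = ball \<rho> r - {1}"
  have "zorder riemann_zeta \<rho> = zorder zeta_reg \<rho>"
  proof (rule zorder_eqI[of S])
    show "open S" "\<rho> \<in> S" using r \<rho> by (auto simp: S_def)
    show "(\<lambda>w. p w / (w - 1)) holomorphic_on S"
      by (intro holomorphic_intros holomorphic_on_subset[OF p(1)]) (auto simp: S_def)
    show "p \<rho> / (\<rho> - 1) \<noteq> 0" using p(2)[of \<rho>] r \<rho> by auto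
    fix w assume w: "w \<in> S" "w \<noteq> \<rho>"
    hence e: "(w - 1) * riemann_zeta w = p w * (w - \<rho>) ^ nat (zorder zeta_reg \<rho>)"
      using p(2)[of w] by (auto simp: S_def zeta_reg_def)
    show "riemann_zeta w = p w / (w - 1) * (w - \<rho>) powi zorder zeta_reg \<rho>"
    proof -
      have "w - 1 \<noteq> 0" using w by (simp add: S_def)
      hence "riemann_zeta w = (p w * (w - \<rho>) ^ nat (zorder zeta_reg \<rho>)) / (w - 1)"
        by (metis e nonzero_mult_div_cancel_left)
      moreover have "(w - \<rho>) powi zorder zeta_reg \<rho> = (w - \<rho>) ^ nat (zorder zeta_reg \<rho>)"
        using zo by (simp add: power_int_def)
      ultimately show ?thesis by simp
    qed
  qed
  thus ?thesis by simp
qed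

section \<open>Laguerre functions and the isometry onto the Hardy space of the disc\<close>

text \<open>Orthogonality of the powers by the mean value property: on the circle z^n cnj (z^n) is
  constant, so the cross terms with the top power form a polynomial without constant term.\<close>

lemma circle_mean_square_poly:
  fixes c :: "nat \<Rightarrow> complex"
  assumes r: "0 < r"
  shows "((\<lambda>x. (cmod (\<Sum>n<N. c n * (of_real r * circ x) ^ n))\<^sup>2) has_integral
           (\<Sum>n<N. (cmod (c n))\<^sup>2 * r ^ (2 * n))) {0..1}"
proof (induction N)
  case (Suc N)
  define z where "z = (\<lambda>x. of_real r * circ x)"
  have z: "cmod (z x) = r" for x using r by (simp add: z_def norm_mult)
  define S where "S = (\<lambda>z. \<Sum>n<N. c n * z ^ n)"
  define L where "L = (\<lambda>z. \<Sum>n<N. c N * cnj (c n) * of_real (r ^ (2 * n)) * z ^ (N - n))"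
  have "((\<lambda>x. Re (L (z x))) has_integral Re (L 0)) {0..1}"
    unfolding z_def by (rule mean_value_Re[where R = "r + 1"]) (use r in \<open>auto simp: L_def intro!: holomorphic_intros\<close>)
  moreover have "L 0 = 0" by (auto simp: L_def intro!: sum.neutral)
  ultimately have L: "((\<lambda>x. Re (L (z x))) has_integral 0) {0..1}" by simp
  have cross: "c N * z x ^ N * cnj (S (z x)) = L (z x)" for x
    unfolding L_def S_def cnj_sum sum_distrib_left
  proof (intro sum.cong refl)
    fix n assume "n \<in> {..<N}"
    hence "z x ^ N = z x ^ (N - n) * z x ^ n" by (simp add: power_add[symmetric])
    moreover have "z x ^ n * cnj (z x ^ n) = of_real (r ^ (2 * n))"
    proof -
      have "z x ^ n * cnj (z x ^ n) = of_real ((cmod (z x ^ n))\<^sup>2)"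
        by (rule complex_norm_square[symmetric, unfolded of_real_power[symmetric]])
      thus ?thesis by (simp add: z norm_power power_mult[symmetric] mult.commute)
    qed
    moreover have "p * (A * B) * (cnj q * cnj B) = p * cnj q * (B * cnj B) * A" for p q A B :: complex
      by (simp add: mult_ac)
    ultimately show "c N * z x ^ N * cnj (c n * z x ^ n) = c N * cnj (c n) * of_real (r ^ (2 * n)) * z x ^ (N - n)"
      by (simp only: complex_cnj_mult)
  qed
  have "(cmod (S (z x) + c N * z x ^ N))\<^sup>2 = (cmod (S (z x)))\<^sup>2 + 2 * Re (L (z x)) + (cmod (c N))\<^sup>2 * r ^ (2 * N)" for x
  proof -
    have "(cmod (a + b))\<^sup>2 = (cmod a)\<^sup>2 + 2 * Re (b * cnj a) + (cmod b)\<^sup>2" for a b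
      unfolding cmod_power2 by (simp add: algebra_simps power2_eq_square)
    from this[of "S (z x)" "c N * z x ^ N"] show ?thesis
      unfolding cross by (simp add: norm_mult norm_power z power_mult_distrib power_mult[symmetric] mult.commute)
  qed
  moreover have "((\<lambda>x. (cmod (S (z x)))\<^sup>2 + 2 * Re (L (z x)) + (cmod (c N))\<^sup>2 * r ^ (2 * N)) has_integral
      ((\<Sum>n<N. (cmod (c n))\<^sup>2 * r ^ (2 * n)) + 2 * 0 + (cmod (c N))\<^sup>2 * r ^ (2 * N))) {0..1}"
  proof (intro has_integral_add has_integral_mult_right L)
    show "((\<lambda>x. (cmod (S (z x)))\<^sup>2) has_integral (\<Sum>n<N. (cmod (c n))\<^sup>2 * r ^ (2 * n))) {0..1}"
      using Suc.IH by (simp add: S_def z_def)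
    show "((\<lambda>x::real. K) has_integral K) {0..1}" for K :: real
      using has_integral_const_real[of K 0 1] by simp
  qed
  ultimately show ?case by (simp add: S_def z_def)
qed simp

lemma circle_mean_square:
  fixes c :: "nat \<Rightarrow> complex"
  assumes F: "\<And>z. cmod z < 1 \<Longrightarrow> (\<lambda>n. c n * z ^ n) sums F z" and r: "0 < r" "r < 1"
  shows "(\<lambda>n. (cmod (c n))\<^sup>2 * r ^ (2 * n)) sums integral {0..1} (\<lambda>x. (cmod (F (of_real r * circ x)))\<^sup>2)"
    and "continuous_on {0..1} (\<lambda>x. F (of_real r * circ x))"
proof -
  define z where "z = (\<lambda>x. of_real r * circ x)"
  have z: "cmod (z x) = r" for x using r by (simp add: z_def norm_mult)
  define S where "S = (\<lambda>N x. \<Sum>n<N. c n * z x ^ n)"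
  \<comment> \<open>Convergence at a larger radius gives absolute convergence at r, hence uniform
    convergence on the circle.\<close>
  obtain \<rho> where \<rho>: "r < \<rho>" "\<rho> < 1" using r dense by blast
  have "(\<lambda>n. c n * of_real \<rho> ^ n) sums F (of_real \<rho>)" using \<rho> r by (intro F) auto
  hence "summable (\<lambda>n. c n * of_real \<rho> ^ n)" by (rule sums_summable)
  hence sm: "summable (\<lambda>n. norm (c n * of_real r ^ n))"
    using powser_insidea[of c "of_real \<rho>" "of_real r"] \<rho> r by simp
  have "uniform_limit {0..1} S (\<lambda>x. \<Sum>n. c n * z x ^ n) sequentially"
    unfolding S_def by (rule Weierstrass_m_test[OF _ sm]) (use r in \<open>simp add: norm_mult norm_power z\<close>)
  moreover have "(\<Sum>n. c n * z x ^ n) = F (z x)" for x using F[of "z x"] z r sums_unique by fastforce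
  ultimately have U: "uniform_limit {0..1} S (\<lambda>x. F (z x)) sequentially" by simp
  have contS: "continuous_on {0..1} (\<lambda>x. S N x)" for N
    unfolding z_def S_def by (intro continuous_intros)
  have contF: "continuous_on {0..1} (\<lambda>x. F (z x))"
    by (rule uniform_limit_theorem[OF _ U]) (use contS in auto)
  thus "continuous_on {0..1} (\<lambda>x. F (of_real r * circ x))" by (simp add: z_def)
  have bd: "bounded ((\<lambda>x. norm (F (z x))) ` {0..1})"
    by (intro compact_imp_bounded compact_continuous_image continuous_intros contF) simp
  have U1: "uniform_limit {0..1} (\<lambda>N x. norm (S N x)) (\<lambda>x. norm (F (z x))) sequentially"
    by (intro uniform_limit_intros U)
  have U2: "uniform_limit {0..1} (\<lambda>N x. (norm (S N x))\<^sup>2) (\<lambda>x. (norm (F (z x)))\<^sup>2) sequentially"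
    unfolding power2_eq_square
    by (intro uniform_lim_mult U1 bd)
  have "(\<lambda>N. integral {0..1} (\<lambda>x. (norm (S N x))\<^sup>2)) \<longlonglongrightarrow> integral {0..1} (\<lambda>x. (norm (F (z x)))\<^sup>2)"
  proof (rule LIMSEQ_I)
    fix e :: real assume e: "e > 0"
    from uniform_limitD[OF U2, of "e / 2"] e obtain N0 where
      N0: "\<And>N x. N \<ge> N0 \<Longrightarrow> x \<in> {0..1} \<Longrightarrow> dist ((norm (S N x))\<^sup>2) ((norm (F (z x)))\<^sup>2) < e / 2"
      unfolding eventually_sequentially by (meson half_gt_zero)
    show "\<exists>N0. \<forall>N\<ge>N0. norm (integral {0..1} (\<lambda>x. (norm (S N x))\<^sup>2) - integral {0..1} (\<lambda>x. (norm (F (z x)))\<^sup>2)) < e"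
    proof (intro exI[of _ N0] allI impI)
      fix N assume N: "N \<ge> N0"
      have "integral {0..1} (\<lambda>x. (norm (S N x))\<^sup>2) - integral {0..1} (\<lambda>x. (norm (F (z x)))\<^sup>2) =
          integral {0..1} (\<lambda>x. (norm (S N x))\<^sup>2 - (norm (F (z x)))\<^sup>2)"
        by (intro Henstock_Kurzweil_Integration.integral_diff[symmetric] integrable_continuous_real continuous_intros contF contS)
      also have "norm \<dots> \<le> (e / 2) * (1 - 0)"
        by (rule integral_bound) (use N0[OF N] contS contF in \<open>auto intro!: continuous_intros less_imp_le simp: dist_real_def\<close>)
      finally show "norm (integral {0..1} (\<lambda>x. (norm (S N x))\<^sup>2) - integral {0..1} (\<lambda>x. (norm (F (z x)))\<^sup>2)) < e"
        using e by simp
    qed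
  qed
  moreover have "integral {0..1} (\<lambda>x. (norm (S N x))\<^sup>2) = (\<Sum>n<N. (cmod (c n))\<^sup>2 * r ^ (2 * n))" for N
    unfolding z_def S_def by (rule integral_unique[OF circle_mean_square_poly[OF r(1)]])
  ultimately show "(\<lambda>n. (cmod (c n))\<^sup>2 * r ^ (2 * n)) sums integral {0..1} (\<lambda>x. (cmod (F (of_real r * circ x)))\<^sup>2)"
    by (simp add: sums_def z_def)
qed

lemma orthonormal_residual:
  fixes u :: "nat \<Rightarrow> 'a \<Rightarrow> complex"
  assumes f: "f \<in> L2_space M" and u: "\<And>n. u n \<in> L2_space M"
    and on: "\<And>m n. L2_inner M (u m) (u n) = (if m = n then 1 else 0)"
  shows "m < N \<Longrightarrow> L2_inner M (\<lambda>x. f x - (\<Sum>n<N. L2_inner M f (u n) * u n x)) (u m) = 0"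
    and "(L2_norm M (\<lambda>x. f x - (\<Sum>n<N. L2_inner M f (u n) * u n x)))\<^sup>2 =
      (L2_norm M f)\<^sup>2 - (\<Sum>n<N. (cmod (L2_inner M f (u n)))\<^sup>2)"
proof -
  define a where "a = (\<lambda>n. L2_inner M f (u n))"
  define P where "P = (\<lambda>x. \<Sum>n<N. a n * u n x)"
  have PL: "P \<in> L2_space M" unfolding P_def by (intro L2_space_sum L2_space_cmult u)
  have Pu: "L2_inner M P h = (\<Sum>n<N. a n * L2_inner M (u n) h)" if "h \<in> L2_space M" for h
    unfolding P_def using that by (subst L2_inner_sum_left) (auto intro: L2_space_cmult u simp: L2_inner_cmult_left)
  have Pm: "L2_inner M P (u m) = (if m < N then a m else 0)" for m
  proof -
    have "L2_inner M P (u m) = (\<Sum>n<N. a n * (if n = m then 1 else 0))"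
      by (subst Pu[OF u]) (simp only: on)
    also have "\<dots> = (\<Sum>n<N. if n = m then a n else 0)" by (intro sum.cong) auto
    also have "\<dots> = (if m < N then a m else 0)" by (subst sum.delta) auto
    finally show ?thesis .
  qed
  show "m < N \<Longrightarrow> L2_inner M (\<lambda>x. f x - (\<Sum>n<N. L2_inner M f (u n) * u n x)) (u m) = 0" for m
    using L2_inner_diff_left[OF f PL u, of m] Pm[of m] by (simp add: a_def P_def)
  have PP: "L2_inner M P P = of_real (\<Sum>n<N. (cmod (a n))\<^sup>2)"
  proof -
    have "L2_inner M (u n) P = cnj (L2_inner M P (u n))" for n by (rule L2_inner_commute)
    hence "L2_inner M P P = (\<Sum>n<N. a n * cnj (a n))"
      by (subst Pu[OF PL]) (simp add: Pm)
    moreover have "a n * cnj (a n) = of_real ((cmod (a n))\<^sup>2)" for n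
      by (rule complex_norm_square[symmetric])
    ultimately show ?thesis by (simp only: of_real_sum)
  qed
  have Pf: "L2_inner M f P = of_real (\<Sum>n<N. (cmod (a n))\<^sup>2)"
  proof -
    have "L2_inner M P f = (\<Sum>n<N. a n * cnj (a n))"
      by (subst Pu[OF f], subst L2_inner_commute) (simp add: a_def)
    hence "L2_inner M f P = cnj (\<Sum>n<N. a n * cnj (a n))" by (metis L2_inner_commute)
    moreover have "a n * cnj (a n) = of_real ((cmod (a n))\<^sup>2)" for n
      by (rule complex_norm_square[symmetric])
    ultimately show ?thesis by (simp only: of_real_sum cnj_sum complex_cnj_complex_of_real)
  qed
  have "(L2_norm M P)\<^sup>2 = (\<Sum>n<N. (cmod (a n))\<^sup>2)"
    using PP unfolding L2_inner_self of_real_eq_iff .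
  hence "(L2_norm M (\<lambda>x. f x - P x))\<^sup>2 = (L2_norm M f)\<^sup>2 - (\<Sum>n<N. (cmod (a n))\<^sup>2)"
    unfolding L2_norm_diff_power2[OF f PL] Pf by simp
  thus "(L2_norm M (\<lambda>x. f x - (\<Sum>n<N. L2_inner M f (u n) * u n x)))\<^sup>2 =
      (L2_norm M f)\<^sup>2 - (\<Sum>n<N. (cmod (L2_inner M f (u n)))\<^sup>2)"
    by (simp add: P_def a_def)
qed

section \<open>Integration over the unit interval and Mellin transforms of logarithms\<close>

lemma space_unit_lborel [simp]: "space unit_lborel = {0<..<1}"
  by (simp add: unit_lborel_def space_restrict_space)

lemma sets_unit_lborel: "sets unit_lborel = sets (restrict_space borel {0<..<1})"
  by (simp add: unit_lborel_def sets_restrict_space)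

lemma measurable_unit_lborel: "f \<in> borel_measurable borel \<Longrightarrow> f \<in> borel_measurable unit_lborel"
  unfolding unit_lborel_def by (intro measurable_restrict_space1) simp

lemma measurable_id_unit_lborel: "(\<lambda>x. x) \<in> borel_measurable unit_lborel"
  by (rule measurable_unit_lborel) simp

lemma integrable_unit_lborel: "integrable unit_lborel f \<longleftrightarrow> set_integrable lborel {0<..<1} f"
  for f :: "real \<Rightarrow> 'a :: {banach, second_countable_topology}"
  unfolding unit_lborel_def set_integrable_def by (rule integrable_restrict_space) simp

lemma integral_unit_lborel: "integral\<^sup>L unit_lborel f = (LINT x:{0<..<1}|lborel. f x)"
  for f :: "real \<Rightarrow> 'a :: {banach, second_countable_topology}"
  unfolding unit_lborel_def set_lebesgue_integral_def by (rule integral_restrict_space) simp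

lemma emeasure_unit_lborel: "emeasure unit_lborel (space unit_lborel) = 1"
  unfolding unit_lborel_def by (simp add: emeasure_restrict_space space_restrict_space)

interpretation unit_lborel: finite_measure unit_lborel
  by (rule finite_measureI) (simp only: emeasure_unit_lborel, simp)

lemma AE_unit_lborelI: "(\<And>x. 0 < x \<Longrightarrow> x < 1 \<Longrightarrow> P x) \<Longrightarrow> AE x in unit_lborel. P x"
  by (rule AE_I2) simp

lemma einterval_01: "einterval 0 1 = {0<..<1}"
  using einterval_eq(1)[of 0 1] by (simp add: zero_ereal_def one_ereal_def)

lemma powr_tendsto_0: "b > 0 \<Longrightarrow> ((\<lambda>t::real. t powr b) \<longlongrightarrow> 0) (at_right 0)"
proof -
  assume b: "b > 0"
  have "((\<lambda>t::real. t powr b) \<longlongrightarrow> 0 powr b) (at_right 0)"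
    by (rule tendsto_powr') (use b in \<open>auto intro: eventually_at_right_less[THEN eventually_mono]\<close>)
  thus ?thesis using b by simp
qed

lemma at_right_ereal_0: "((f \<circ> real_of_ereal) \<longlongrightarrow> A) (at_right (0::ereal)) \<longleftrightarrow> (f \<longlongrightarrow> A) (at_right (0::real))"
  using ereal_tendsto_simps1(2)[of f A 0] by (simp add: zero_ereal_def)

lemma at_left_ereal_1: "((f \<circ> real_of_ereal) \<longlongrightarrow> A) (at_left (1::ereal)) \<longleftrightarrow> (f \<longlongrightarrow> A) (at_left (1::real))"
  using ereal_tendsto_simps1(1)[of f A 1] by (simp add: one_ereal_def)

lemma powr_integral_unit_lborel:
  assumes a: "a > -1"
  shows "integrable unit_lborel (\<lambda>t. t powr a)" "(LINT t|unit_lborel. t powr a) = 1 / (a + 1)"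
proof -
  have d: "DERIV (\<lambda>t. t powr (a + 1) / (a + 1)) x :> x powr a" if "ereal 0 < ereal x" for x
  proof -
    have "DERIV (\<lambda>t. t powr (a + 1)) x :> (a + 1) * x powr (a + 1 - 1)"
      using that by (intro has_real_derivative_powr) simp
    from DERIV_cdivide[OF this, of "a + 1"] show ?thesis using a by simp
  qed
  have l1: "((\<lambda>t. t powr (a + 1) / (a + 1)) \<longlongrightarrow> 0 / (a + 1)) (at_right 0)"
    using a by (intro tendsto_intros powr_tendsto_0) auto
  have "((\<lambda>t. t powr (a + 1) / (a + 1)) \<longlongrightarrow> 1 powr (a + 1) / (a + 1)) (at_left 1)"
    using a by (intro tendsto_intros) auto
  hence l2: "((\<lambda>t. t powr (a + 1) / (a + 1)) \<longlongrightarrow> 1 / (a + 1)) (at_left 1)" by simp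
  have *: "isCont (\<lambda>t. t powr a) x" if "0 < x" for x :: real
    using that by (intro continuous_intros) auto
  note F = interval_integral_FTC_nonneg[of 0 1 "\<lambda>t. t powr (a + 1) / (a + 1)" "\<lambda>t. t powr a" 0 "1 / (a + 1)"]
  have "set_integrable lborel (einterval 0 1) (\<lambda>t. t powr a)"
    by (rule F(1)) (use d * l1 l2 in \<open>auto simp: at_right_ereal_0 at_left_ereal_1\<close>)
  thus "integrable unit_lborel (\<lambda>t. t powr a)" by (simp add: integrable_unit_lborel einterval_01)
  have "(LBINT t=0..1. t powr a) = 1 / (a + 1) - 0"
    by (rule F(2)) (use d * l1 l2 in \<open>auto simp: at_right_ereal_0 at_left_ereal_1\<close>)
  thus "(LINT t|unit_lborel. t powr a) = 1 / (a + 1)"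
    by (simp add: integral_unit_lborel einterval_01 interval_lebesgue_integral_le_eq)
qed

lemma ln_power_bound:
  fixes e :: real
  assumes e: "e > 0"
  shows "\<exists>C\<ge>0. \<forall>t. 0 < t \<longrightarrow> t \<le> 1 \<longrightarrow> \<bar>ln t\<bar> ^ k \<le> C * t powr (- e)"
proof (cases "k = 0")
  case True
  have "1 \<le> t powr (- e)" if "0 < t" "t \<le> 1" for t
    using powr_mono'[of "- e" 0 t] that e by simp
  thus ?thesis using True by (intro exI[of _ 1]) auto
next
  case False
  \<comment> \<open>ln (1/t) is at most (1/t)^d / d; its k-th power has the exponent d k =
    e.\<close>
  define d where "d = e / real k"
  have d: "d > 0" "d * real k = e" using False e by (auto simp: d_def)
  have "\<bar>ln t\<bar> ^ k \<le> (1 / d) ^ k * t powr (- e)" if t: "0 < t" "t \<le> 1" for t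
  proof -
    have "\<bar>ln t\<bar> = ln (1 / t)" using t by (simp add: ln_div)
    also have "\<dots> \<le> (1 / t) powr d / d" using t d by (intro ln_powr_bound) auto
    also have "(1 / t) powr d = t powr (- d)" using t by (simp add: powr_minus_divide powr_divide)
    finally have "\<bar>ln t\<bar> ^ k \<le> (t powr (- d) / d) ^ k" by (intro power_mono) auto
    also have "\<dots> = (1 / d) ^ k * (t powr (- d)) ^ k" by (simp add: power_divide)
    also have "(t powr (- d)) ^ k = t powr (- e)"
      using t d by (simp add: powr_realpow[symmetric] powr_powr)
    finally show ?thesis .
  qed
  thus ?thesis using d by (intro exI[of _ "(1 / d) ^ k"]) auto
qed

text \<open>Any exponent strictly between 0 and 1/2 would serve: below 1/2 for square integrability
  at 0, above 0 to dominate logarithms and to make dilation averages over da/a converge.\<close>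

definition quarter_bounded :: "(real \<Rightarrow> complex) set" where
  "quarter_bounded = {f \<in> borel_measurable borel. \<exists>C. \<forall>t. 0 < t \<longrightarrow> t < 1 \<longrightarrow> cmod (f t) \<le> C * t powr (- (1/4))}"

lemma quarter_bounded_L2: assumes "f \<in> quarter_bounded" shows "f \<in> L2_space unit_lborel"
proof -
  from assms obtain C where [measurable]: "f \<in> borel_measurable borel"
    and C: "\<And>t. 0 < t \<Longrightarrow> t < 1 \<Longrightarrow> cmod (f t) \<le> C * t powr (- (1/4))"
    by (auto simp: quarter_bounded_def)
  have [measurable]: "f \<in> borel_measurable unit_lborel" by (rule measurable_unit_lborel) measurable
  have "integrable unit_lborel (\<lambda>x. (cmod (f x))\<^sup>2)"
  proof (rule Bochner_Integration.integrable_bound)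
    show "integrable unit_lborel (\<lambda>t. C\<^sup>2 * t powr (- (1/2)))"
      by (intro integrable_mult_right powr_integral_unit_lborel) simp
    show "AE t in unit_lborel. norm ((cmod (f t))\<^sup>2) \<le> norm (C\<^sup>2 * t powr (- (1/2)))"
    proof (rule AE_unit_lborelI)
      fix t :: real assume t: "0 < t" "t < 1"
      have "(cmod (f t))\<^sup>2 \<le> (C * t powr (- (1/4)))\<^sup>2" using C[OF t] by (intro power_mono) auto
      also have "\<dots> = C\<^sup>2 * t powr (- (1/2))"
        by (simp add: power2_eq_square powr_add[symmetric] mult_ac)
      finally show "norm ((cmod (f t))\<^sup>2) \<le> norm (C\<^sup>2 * t powr (- (1/2)))" by simp
    qed
  qed measurable
  thus ?thesis by (simp add: L2_space_def)
qed

text \<open>Measurability over the whole line includes negative arguments, where the principal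
  logarithm gains pi i.\<close>

lemma powr_kernel_measurable [measurable]: "(\<lambda>t::real. complex_of_real t powr s) \<in> borel_measurable borel"
proof -
  have "(\<lambda>t::real. if t = 0 then 0 else exp (s * (if t > 0 then of_real (ln t) else of_real (ln (- t)) + pi * \<i>)))
      \<in> borel_measurable borel" by measurable
  moreover have "complex_of_real t powr s = (if t = 0 then 0 else exp (s * (if t > 0 then of_real (ln t) else of_real (ln (- t)) + pi * \<i>)))" for t
    by (auto simp: powr_def Ln_of_real not_less Ln_of_real')
  ultimately show ?thesis by simp
qed

lemma cmod_powr_kernel: "0 < t \<Longrightarrow> cmod (complex_of_real t powr s) = t powr Re s"
  using norm_powr_real_powr[of "of_real t" s] by simp

lemma powr_kernel_L2:
  assumes "Re s > 1/2" shows "(\<lambda>t. complex_of_real t powr (s - 1)) \<in> L2_space unit_lborel"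
    and "(L2_norm unit_lborel (\<lambda>t. complex_of_real t powr (s - 1)))\<^sup>2 = 1 / (2 * Re s - 1)"
proof -
  have sq: "(cmod (complex_of_real t powr (s - 1)))\<^sup>2 = t powr (2 * Re s - 2)" if "0 < t" for t
    using cmod_powr_kernel[OF that, of "s - 1"] by (simp add: power2_eq_square powr_add[symmetric])
  have "integrable unit_lborel (\<lambda>t. t powr (2 * Re s - 2))"
    using assms by (intro powr_integral_unit_lborel) auto
  also have "?this \<longleftrightarrow> integrable unit_lborel (\<lambda>t. (cmod (complex_of_real t powr (s - 1)))\<^sup>2)"
    by (intro Bochner_Integration.integrable_cong refl) (use sq in auto)
  finally show "(\<lambda>t. complex_of_real t powr (s - 1)) \<in> L2_space unit_lborel"
    by (simp add: L2_space_def measurable_unit_lborel)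
  have "(LINT t|unit_lborel. (cmod (complex_of_real t powr (s - 1)))\<^sup>2) = (LINT t|unit_lborel. t powr (2 * Re s - 2))"
    by (intro Bochner_Integration.integral_cong refl) (use sq in auto)
  also have "\<dots> = 1 / (2 * Re s - 1)" using assms by (subst powr_integral_unit_lborel) auto
  finally show "(L2_norm unit_lborel (\<lambda>t. complex_of_real t powr (s - 1)))\<^sup>2 = 1 / (2 * Re s - 1)"
    by (simp add: L2_norm_power2)
qed

lemma L2_space_cnj: "f \<in> L2_space M \<Longrightarrow> (\<lambda>x. cnj (f x)) \<in> L2_space M"
proof -
  have [measurable]: "cnj \<in> borel_measurable borel"
    by (intro borel_measurable_continuous_onI continuous_intros)
  assume "f \<in> L2_space M"
  thus ?thesis by (auto simp: L2_space_def)
qed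

lemma L2_norm_cnj: "L2_norm M (\<lambda>x. cnj (f x)) = L2_norm M f"
  by (simp add: L2_norm_def)

lemma L2_mult_integrable: "f \<in> L2_space M \<Longrightarrow> g \<in> L2_space M \<Longrightarrow> integrable M (\<lambda>x. f x * g x)"
  using L2_prod_integrable[OF _ L2_space_cnj, of f M g] by simp

lemma ln_power_quarter_bounded: "(\<lambda>t. complex_of_real (ln t) ^ k) \<in> quarter_bounded"
  unfolding quarter_bounded_def
proof (intro CollectI conjI)
  obtain C where "\<forall>t::real. 0 < t \<longrightarrow> t \<le> 1 \<longrightarrow> \<bar>ln t\<bar> ^ k \<le> C * t powr (- (1/4))"
    using ln_power_bound[of "1/4" k] zero_less_divide_1_iff[of "4::real"] zero_less_numeral by blast
  thus "\<exists>C. \<forall>t. 0 < t \<longrightarrow> t < 1 \<longrightarrow> cmod (complex_of_real (ln t) ^ k) \<le> C * t powr (- (1/4))"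
    by (intro exI[of _ C]) (auto simp: norm_power)
qed measurable

definition mellin :: "(real \<Rightarrow> complex) \<Rightarrow> complex \<Rightarrow> complex" where
  "mellin f s = (LINT t|unit_lborel. f t * of_real t powr (s - 1))"

lemma mellin_integrable:
  "f \<in> L2_space unit_lborel \<Longrightarrow> Re s > 1/2 \<Longrightarrow> integrable unit_lborel (\<lambda>t. f t * of_real t powr (s - 1))"
  by (intro L2_mult_integrable powr_kernel_L2)

lemma ln_powr_tendsto_0:
  assumes "Re s > 0"
  shows "((\<lambda>t. complex_of_real (ln t) ^ k * of_real t powr s) \<longlongrightarrow> 0) (at_right 0)"
proof -
  obtain C where C: "\<And>t. 0 < t \<Longrightarrow> t \<le> 1 \<Longrightarrow> \<bar>ln t\<bar> ^ k \<le> C * t powr (- (Re s / 2))"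
    using ln_power_bound[of "Re s / 2" k] assms by auto
  have "((\<lambda>t. C * t powr (Re s / 2)) \<longlongrightarrow> C * 0) (at_right 0)"
    using assms by (intro tendsto_intros powr_tendsto_0) auto
  hence tends: "((\<lambda>t. C * t powr (Re s / 2)) \<longlongrightarrow> 0) (at_right 0)" by simp
  have "\<forall>\<^sub>F t in at_right 0. norm (complex_of_real (ln t) ^ k * of_real t powr s) \<le> C * t powr (Re s / 2)"
  proof -
    have "\<forall>\<^sub>F t::real in at_right 0. 0 < t \<and> t < 1"
      by (auto simp: eventually_at_right_field intro!: exI[of _ 1])
    thus ?thesis
    proof eventually_elim
      case (elim t)
      have "norm (complex_of_real (ln t) ^ k * of_real t powr s) = \<bar>ln t\<bar> ^ k * t powr Re s"
        using elim by (simp add: norm_mult norm_power cmod_powr_kernel)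
      also have "\<dots> \<le> C * t powr (- (Re s / 2)) * t powr Re s"
        using C elim by (intro mult_right_mono) auto
      also have "\<dots> = C * t powr (Re s / 2)" by (simp add: mult.assoc powr_add[symmetric])
      finally show ?case .
    qed
  qed
  thus ?thesis using tends by (rule Lim_null_comparison)
qed

text \<open>Integration by parts: the derivative of (ln t)^k t^s / s links consecutive powers of the
  logarithm.\<close>

lemma mellin_ln_power:
  assumes s: "Re s > 1/2"
  shows "mellin (\<lambda>t. of_real (ln t) ^ k) s = (-1) ^ k * fact k / s ^ Suc k"
proof (induction k)
  have s0: "s \<noteq> 0" using s by auto
  define g where "g = (\<lambda>k t. complex_of_real (ln t) ^ k * of_real t powr (s - 1))"
  have gint: "integrable unit_lborel (g k)" for k
    unfolding g_def using mellin_integrable[OF quarter_bounded_L2[OF ln_power_quarter_bounded] s] .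
  have gL: "LINT t|unit_lborel. g k t = mellin (\<lambda>t. of_real (ln t) ^ k) s" for k
    by (simp add: g_def mellin_def)
  \<comment> \<open>\<open>0 ^ k\<close> comes from the boundary value (ln 1)^k, which is 1 only for
    k = 0; in that case the truncated index \<open>k - 1\<close> is multiplied by 0.\<close>
  have step: "(LINT t|unit_lborel. g k t + (of_nat k / s) * g (k - 1) t) = 0 ^ k / s" for k
  proof -
    define F where "F = (\<lambda>t::real. of_real (ln t) ^ k * of_real t powr s / s)"
    have isc: "isCont (g k) x" if "0 < x" for x k
      unfolding g_def using that by (intro continuous_intros) (auto simp: complex_nonpos_Reals_iff)
    have "(LBINT t=0..1. g k t + (of_nat k / s) * g (k - 1) t) = 0 ^ k / s - 0 / s"
    proof (rule interval_integral_FTC_integrable[where F = F])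
      fix x :: real assume "0 < ereal x" "ereal x < 1"
      hence x: "0 < x" "x < 1" by (auto simp: zero_ereal_def one_ereal_def)
      show "isCont (\<lambda>t. g k t + of_nat k / s * g (k - 1) t) x"
        using isc[OF x(1)] by (intro continuous_intros)
      have "((\<lambda>z. Ln z ^ k * z powr s / s) has_field_derivative
          (of_nat k * Ln (of_real x) ^ (k - 1) * (1 / of_real x) * of_real x powr s + Ln (of_real x) ^ k * (s * of_real x powr (s - 1))) / s) (at (of_real x))"
        using x s0 by (auto intro!: derivative_eq_intros simp: complex_nonpos_Reals_iff divide_inverse mult_ac)
      hence "((\<lambda>t. Ln (of_real t) ^ k * of_real t powr s / s) has_vector_derivative
          (of_nat k * Ln (of_real x) ^ (k - 1) * (1 / of_real x) * of_real x powr s + Ln (of_real x) ^ k * (s * of_real x powr (s - 1))) / s) (at x)"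
        by (rule has_vector_derivative_real_field)
      moreover have "of_real x powr s = of_real x * (of_real x powr (s - 1) :: complex)"
        using x by (simp add: powr_diff)
      ultimately have "((\<lambda>t. Ln (of_real t) ^ k * of_real t powr s / s) has_vector_derivative
          (g k x + (of_nat k / s) * g (k - 1) x)) (at x)"
        using x s0 by (simp add: g_def Ln_of_real field_simps)
      thus "(F has_vector_derivative (g k x + (of_nat k / s) * g (k - 1) x)) (at x)"
        by (rule has_vector_derivative_transform_within_open[where S = "{0<..}"])
           (use x in \<open>auto simp: F_def Ln_of_real\<close>)
    next
      show "set_integrable lborel (einterval 0 1) (\<lambda>t. g k t + of_nat k / s * g (k - 1) t)"
        unfolding einterval_01 integrable_unit_lborel[symmetric]
        by (intro Bochner_Integration.integrable_add integrable_mult_right gint)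
      show "((F \<circ> real_of_ereal) \<longlongrightarrow> 0 / s) (at_right 0)"
        unfolding at_right_ereal_0 F_def using s s0 by (intro tendsto_divide tendsto_const ln_powr_tendsto_0) auto
      have "((\<lambda>t. complex_of_real (ln t) ^ k * of_real t powr s / s) \<longlongrightarrow> complex_of_real (ln 1) ^ k * of_real 1 powr s / s) (at_left 1)"
        using s0 by (intro tendsto_intros) (auto simp: complex_nonpos_Reals_iff)
      thus "((F \<circ> real_of_ereal) \<longlongrightarrow> 0 ^ k / s) (at_left 1)"
        unfolding at_left_ereal_1 F_def by simp
    qed auto
    thus ?thesis by (simp add: integral_unit_lborel einterval_01 interval_lebesgue_integral_le_eq)
  qed
  hence rec: "mellin (\<lambda>t. of_real (ln t) ^ k) s + (of_nat k / s) * mellin (\<lambda>t. of_real (ln t) ^ (k - 1)) s = 0 ^ k / s" for k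
    unfolding gL[symmetric] using gint by (subst (asm) Bochner_Integration.integral_add) auto
  {
    case 0
    show ?case using rec[of 0] by simp
  next
    case (Suc k)
    have "mellin (\<lambda>t. of_real (ln t) ^ Suc k) s = - ((of_nat (Suc k) / s) * mellin (\<lambda>t. of_real (ln t) ^ k) s)"
      using rec[of "Suc k"] by (simp add: eq_neg_iff_add_eq_0)
    thus ?case unfolding Suc using s0 by (simp add: divide_simps)
  }
qed

section \<open>Orthonormality of the Laguerre functions\<close>

text \<open>Up to the sign (-1)^n this is the n-th forward difference of (x choose m) at x = j, and
  each difference lowers m by 1. The induction splits off one difference by Pascal's rule.\<close>

lemma alternating_binomial_sum:
  "(\<Sum>k\<le>n. (-1) ^ k * int (n choose k) * int ((j + k) choose m)) =
     (if n \<le> m then (-1) ^ n * int (j choose (m - n)) else 0)"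
proof (induction n arbitrary: j m)
  case (Suc n)
  define f where "f = (\<lambda>k. int ((j + k) choose m))"
  have "(\<Sum>k\<le>Suc n. (-1) ^ k * int (Suc n choose k) * f k) =
      f 0 + (\<Sum>k\<le>n. (-1) ^ Suc k * int (Suc n choose Suc k) * f (Suc k))"
    by (subst sum.atMost_Suc_shift) simp
  also have "(\<Sum>k\<le>n. (-1) ^ Suc k * int (Suc n choose Suc k) * f (Suc k)) =
      (\<Sum>k\<le>n. (-1) ^ Suc k * int (n choose Suc k) * f (Suc k)) - (\<Sum>k\<le>n. (-1) ^ k * int (n choose k) * f (Suc k))"
    by (auto simp: sum_subtractf[symmetric] algebra_simps intro!: sum.cong)
  also have "f 0 + ((\<Sum>k\<le>n. (-1) ^ Suc k * int (n choose Suc k) * f (Suc k)) - (\<Sum>k\<le>n. (-1) ^ k * int (n choose k) * f (Suc k)))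
      = (\<Sum>k\<le>Suc n. (-1) ^ k * int (n choose k) * f k) - (\<Sum>k\<le>n. (-1) ^ k * int (n choose k) * f (Suc k))"
    by (subst sum.atMost_Suc_shift) simp
  also have "\<dots> = (\<Sum>k\<le>n. (-1) ^ k * int (n choose k) * f k) - (\<Sum>k\<le>n. (-1) ^ k * int (n choose k) * f (Suc k))"
    by (simp add: binomial_eq_0)
  also have "\<dots> = (\<Sum>k\<le>n. (-1) ^ k * int (n choose k) * (f k - f (Suc k)))"
    by (simp only: sum_subtractf[symmetric] right_diff_distrib)
  also have "\<dots> = (if Suc n \<le> m then (-1) ^ Suc n * int (j choose (m - Suc n)) else 0)"
  proof (cases m)
    case 0
    thus ?thesis by (simp add: f_def)
  next
    case (Suc m')
    have "f k - f (Suc k) = - int ((j + k) choose m')" for k by (simp add: f_def Suc)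
    hence "(\<Sum>k\<le>n. (-1) ^ k * int (n choose k) * (f k - f (Suc k))) =
        - (\<Sum>k\<le>n. (-1) ^ k * int (n choose k) * int ((j + k) choose m'))"
      by (simp add: sum_negf)
    thus ?thesis by (simp add: Suc.IH Suc)
  qed
  finally show ?case by (simp add: f_def)
qed simp

text \<open>The alternating signs of the classical polynomial in x are absorbed by ln t =
  -x.\<close>

definition laguerre :: "nat \<Rightarrow> real \<Rightarrow> complex" where
  "laguerre n t = (\<Sum>k\<le>n. of_nat (n choose k) / fact k * of_real (ln t) ^ k)"

lemma ln_power_L2: "(\<lambda>t. complex_of_real (ln t) ^ k) \<in> L2_space unit_lborel"
  by (rule quarter_bounded_L2[OF ln_power_quarter_bounded])

lemma laguerre_L2: "laguerre n \<in> L2_space unit_lborel"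
  unfolding laguerre_def[abs_def] by (intro L2_space_sum L2_space_cmult ln_power_L2)

lemma cnj_laguerre [simp]: "cnj (laguerre n t) = laguerre n t"
  by (simp add: laguerre_def)

lemma mellin_sum:
  assumes "\<And>i. i \<in> I \<Longrightarrow> f i \<in> L2_space unit_lborel" "Re s > 1/2"
  shows "mellin (\<lambda>t. \<Sum>i\<in>I. c i * f i t) s = (\<Sum>i\<in>I. c i * mellin (f i) s)"
  unfolding mellin_def sum_distrib_right using assms
  by (subst Bochner_Integration.integral_sum) (auto intro!: sum.cong mellin_integrable simp: mult.assoc)

text \<open>The binomial theorem. This formula motivates the substitution s = 1 / (1 - z): then 1 -
  1/s = z, and multiplication by s leaves z^n.\<close>

lemma mellin_laguerre:
  assumes s: "Re s > 1/2" shows "mellin (laguerre n) s = (1 - 1 / s) ^ n / s"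
proof -
  have "mellin (laguerre n) s = (\<Sum>k\<le>n. of_nat (n choose k) / fact k * mellin (\<lambda>t. of_real (ln t) ^ k) s)"
    unfolding laguerre_def[abs_def] by (rule mellin_sum[OF ln_power_L2 s])
  also have "\<dots> = (\<Sum>k\<le>n. of_nat (n choose k) * (- 1 / s) ^ k * 1 ^ (n - k)) / s"
    unfolding sum_divide_distrib
    by (intro sum.cong refl) (simp only: mellin_ln_power[OF s] power_divide, simp)
  also have "(\<Sum>k\<le>n. of_nat (n choose k) * (- 1 / s) ^ k * 1 ^ (n - k)) = (- 1 / s + 1) ^ n"
    by (rule binomial_ring[symmetric])
  finally show ?thesis by simp
qed

text \<open>The quotients (m + k)! / k! are m! times (m + k choose m), so the alternating sum
  applies. The last branch repeats the left-hand side: for m > n nothing is asserted.\<close>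

lemma laguerre_inner_ln_power:
  "L2_inner unit_lborel (\<lambda>t. of_real (ln t) ^ m) (laguerre n) = (if m < n then 0 else if m = n then fact n else
     L2_inner unit_lborel (\<lambda>t. of_real (ln t) ^ m) (laguerre n))"
proof -
  have "L2_inner unit_lborel (\<lambda>t. of_real (ln t) ^ m) (laguerre n) =
      mellin (\<lambda>t. \<Sum>k\<le>n. of_nat (n choose k) / fact k * of_real (ln t) ^ (m + k)) 1"
    unfolding L2_inner_def mellin_def
    by (intro Bochner_Integration.integral_cong refl) (simp add: laguerre_def sum_distrib_left power_add mult_ac)
  also have "\<dots> = (\<Sum>k\<le>n. of_nat (n choose k) / fact k * mellin (\<lambda>t. of_real (ln t) ^ (m + k)) 1)"
    by (rule mellin_sum[OF ln_power_L2]) simp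
  also have "\<dots> = (\<Sum>k\<le>n. (-1) ^ m * fact m * of_int ((-1) ^ k * int (n choose k) * int ((m + k) choose m)))"
  proof (intro sum.cong refl)
    fix k
    have e: "mellin (\<lambda>t. of_real (ln t) ^ (m + k)) 1 = (-1) ^ (m + k) * fact (m + k)"
      using mellin_ln_power[of 1 "m + k"] by simp
    have f: "(fact (m + k) :: complex) = fact m * fact k * of_nat ((m + k) choose m)"
    proof -
      have "fact m * fact k * ((m + k) choose m) = (fact (m + k) :: nat)"
        using binomial_fact_lemma[of m "m + k"] by simp
      thus ?thesis by (metis of_nat_fact of_nat_mult)
    qed
    show "of_nat (n choose k) / fact k * mellin (\<lambda>t. of_real (ln t) ^ (m + k)) 1 =
        (-1) ^ m * fact m * of_int ((-1) ^ k * int (n choose k) * int ((m + k) choose m))"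
      unfolding e f by (simp add: power_add)
  qed
  also have "\<dots> = (-1) ^ m * fact m * of_int (if n \<le> m then (-1) ^ n * int (m choose (m - n)) else 0)"
    unfolding alternating_binomial_sum[symmetric] by (simp add: sum_distrib_left)
  finally have "L2_inner unit_lborel (\<lambda>t. of_real (ln t) ^ m) (laguerre n) =
      (-1) ^ m * fact m * of_int (if n \<le> m then (-1) ^ n * int (m choose (m - n)) else 0)" .
  thus ?thesis by (auto simp flip: power_add)
qed

lemma laguerre_orthonormal_le:
  assumes "m \<le> n" shows "L2_inner unit_lborel (laguerre m) (laguerre n) = (if m = n then 1 else 0)"
proof -
  have "L2_inner unit_lborel (laguerre m) (laguerre n) =
      (\<Sum>k\<le>m. of_nat (m choose k) / fact k * L2_inner unit_lborel (\<lambda>t. of_real (ln t) ^ k) (laguerre n))"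
  proof -
    have "L2_inner unit_lborel (laguerre m) (laguerre n) =
        (\<Sum>k\<le>m. L2_inner unit_lborel (\<lambda>t. of_nat (m choose k) / fact k * of_real (ln t) ^ k) (laguerre n))"
      unfolding laguerre_def[of m, abs_def] by (intro L2_inner_sum_left L2_space_cmult ln_power_L2 laguerre_L2)
    thus ?thesis by (simp only: L2_inner_cmult_left)
  qed
  also have "\<dots> = (\<Sum>k\<le>m. if k = n then 1 else 0)"
  proof (intro sum.cong refl)
    fix k assume "k \<in> {..m}"
    thus "of_nat (m choose k) / fact k * L2_inner unit_lborel (\<lambda>t. of_real (ln t) ^ k) (laguerre n) = (if k = n then 1 else 0)"
      using assms by (subst laguerre_inner_ln_power) auto
  qed
  finally show ?thesis using assms by simp
qed

lemma laguerre_orthonormal: "L2_inner unit_lborel (laguerre m) (laguerre n) = (if m = n then 1 else 0)"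
  using laguerre_orthonormal_le[of m n] laguerre_orthonormal_le[of n m] L2_inner_commute[of unit_lborel "laguerre m" "laguerre n"]
  by (cases "m \<le> n") auto

section \<open>The transform to the disc and its power series\<close>

definition disc_transform :: "(real \<Rightarrow> complex) \<Rightarrow> complex \<Rightarrow> complex" where
  "disc_transform f z = mellin f (1 / (1 - z)) / (1 - z)"

text \<open>Besides showing that the disc is sent into Re s > 1/2, this expresses in z the quantity
  2 Re s - 1, the reciprocal of the squared norm of t^(s-1).\<close>

lemma two_Re_inverse:
  assumes "z \<noteq> 1" shows "2 * Re (1 / (1 - z)) - 1 = (1 - (cmod z)\<^sup>2) / (cmod (1 - z))\<^sup>2"
proof -
  have n: "(cmod (1 - z))\<^sup>2 \<noteq> 0" using assms by simp
  have "Re (1 / (1 - z)) = (1 - Re z) / (cmod (1 - z))\<^sup>2"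
    by (simp add: Re_divide cmod_power2)
  moreover have "2 * (1 - Re z) - (cmod (1 - z))\<^sup>2 = 1 - (cmod z)\<^sup>2"
    unfolding cmod_power2 by (simp add: power2_eq_square algebra_simps)
  ultimately show ?thesis using n by (simp add: field_simps)
qed

lemma Re_inverse_gt_half: "cmod z < 1 \<Longrightarrow> Re (1 / (1 - z)) > 1/2"
proof -
  assume z: "cmod z < 1"
  hence "z \<noteq> 1" by auto
  moreover have "(cmod z)\<^sup>2 < 1" using z by (simp add: abs_square_less_1)
  ultimately have "2 * Re (1 / (1 - z)) - 1 > 0" unfolding two_Re_inverse[OF \<open>z \<noteq> 1\<close>] by simp
  thus ?thesis by linarith
qed

text \<open>The kernel s t^(s-1) has the Laguerre coefficients z^n, and its squared norm 1 / (1 -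
  |z|^2) is the sum of their squared moduli. So its expansion converges in norm before completeness
  is known; pairing with \<open>f\<close> gives the power series.\<close>

lemma disc_transform_sums:
  assumes f: "f \<in> L2_space unit_lborel" and z: "cmod z < 1"
  shows "(\<lambda>n. L2_inner unit_lborel f (laguerre n) * z ^ n) sums disc_transform f z"
proof -
  define s where "s = 1 / (1 - z)"
  have z1: "z \<noteq> 1" using z by auto
  have s: "Re s > 1/2" unfolding s_def by (rule Re_inverse_gt_half[OF z])
  have s0: "s \<noteq> 0" "1 - 1 / s = z" using z1 by (auto simp: s_def)
  define K where "K = (\<lambda>t. s * of_real t powr (s - 1))"
  have K: "K \<in> L2_space unit_lborel" unfolding K_def by (intro L2_space_cmult powr_kernel_L2 s)
  have Kn: "(L2_norm unit_lborel K)\<^sup>2 = 1 / (1 - (cmod z)\<^sup>2)"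
  proof -
    have "(L2_norm unit_lborel K)\<^sup>2 = (cmod s)\<^sup>2 * (1 / (2 * Re s - 1))"
      unfolding K_def L2_norm_cmult power_mult_distrib powr_kernel_L2(2)[OF s] ..
    also have "2 * Re s - 1 = (1 - (cmod z)\<^sup>2) / (cmod (1 - z))\<^sup>2"
      unfolding s_def by (rule two_Re_inverse[OF z1])
    also have "(cmod s)\<^sup>2 = 1 / (cmod (1 - z))\<^sup>2" by (simp add: s_def norm_divide power_divide)
    finally show ?thesis using z1 by simp
  qed
  have Kl: "L2_inner unit_lborel K (laguerre n) = z ^ n" for n
  proof -
    have "L2_inner unit_lborel K (laguerre n) = s * mellin (laguerre n) s"
      unfolding L2_inner_def mellin_def K_def by (simp add: mult_ac)
    thus ?thesis using mellin_laguerre[OF s] s0 by simp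
  qed
  define R where "R = (\<lambda>N t. K t - (\<Sum>n<N. z ^ n * laguerre n t))"
  have RL: "R N \<in> L2_space unit_lborel" for N unfolding R_def
    by (intro L2_space_diff K L2_space_sum L2_space_cmult laguerre_L2)
  have Rn: "(L2_norm unit_lborel (R N))\<^sup>2 = 1 / (1 - (cmod z)\<^sup>2) - (\<Sum>n<N. ((cmod z)\<^sup>2) ^ n)" for N
    using orthonormal_residual(2)[OF K laguerre_L2 laguerre_orthonormal, of N]
    unfolding Kl Kn R_def by (simp add: norm_power power_mult[symmetric] mult.commute)
  have "(\<lambda>n. ((cmod z)\<^sup>2) ^ n) sums (1 / (1 - (cmod z)\<^sup>2))"
    by (rule geometric_sums) (use z in \<open>simp add: abs_square_less_1\<close>)
  hence "(\<lambda>N. sqrt (1 / (1 - (cmod z)\<^sup>2) - (\<Sum>n<N. ((cmod z)\<^sup>2) ^ n))) \<longlonglongrightarrow>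
      sqrt (1 / (1 - (cmod z)\<^sup>2) - 1 / (1 - (cmod z)\<^sup>2))"
    unfolding sums_def by (intro tendsto_intros)
  hence R0: "(\<lambda>N. L2_norm unit_lborel (R N)) \<longlonglongrightarrow> 0"
    unfolding Rn[symmetric] by simp
  \<comment> \<open>The transform pairs \<open>f\<close> with \<open>K\<close> itself, whereas the
    inner product conjugates, hence the \<open>cnj\<close> on the remainder.\<close>
  have diff: "disc_transform f z - (\<Sum>n<N. L2_inner unit_lborel f (laguerre n) * z ^ n) =
      L2_inner unit_lborel f (\<lambda>t. cnj (R N t))" for N
  proof -
    have 1: "integrable unit_lborel (\<lambda>t. f t * K t)" by (rule L2_mult_integrable[OF f K])
    have 2: "integrable unit_lborel (\<lambda>t. f t * laguerre n t)" for n by (rule L2_mult_integrable[OF f laguerre_L2])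
    have "L2_inner unit_lborel f (\<lambda>t. cnj (R N t)) =
        (LINT t|unit_lborel. f t * K t - (\<Sum>n<N. z ^ n * (f t * laguerre n t)))"
      unfolding L2_inner_def R_def
      by (intro Bochner_Integration.integral_cong refl) (simp add: right_diff_distrib sum_distrib_left mult_ac)
    also have "\<dots> = (LINT t|unit_lborel. f t * K t) - (\<Sum>n<N. z ^ n * (LINT t|unit_lborel. f t * laguerre n t))"
      using 1 2 by (simp add: Bochner_Integration.integral_diff Bochner_Integration.integral_sum)
    also have "(LINT t|unit_lborel. f t * K t) = disc_transform f z"
    proof -
      have "(LINT t|unit_lborel. f t * K t) = (LINT t|unit_lborel. s * (f t * of_real t powr (s - 1)))"
        by (intro Bochner_Integration.integral_cong refl) (simp add: K_def)
      also have "\<dots> = s * mellin f s" by (simp add: mellin_def)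
      finally show ?thesis by (simp add: disc_transform_def s_def)
    qed
    finally show ?thesis by (simp add: L2_inner_def mult.commute)
  qed
  have "(\<lambda>N. disc_transform f z - (\<Sum>n<N. L2_inner unit_lborel f (laguerre n) * z ^ n)) \<longlonglongrightarrow> 0"
  proof (rule Lim_null_comparison)
    show "\<forall>\<^sub>F N in sequentially. norm (disc_transform f z - (\<Sum>n<N. L2_inner unit_lborel f (laguerre n) * z ^ n))
        \<le> L2_norm unit_lborel f * L2_norm unit_lborel (R N)"
      unfolding diff using L2_Cauchy_Schwarz[OF f L2_space_cnj[OF RL]]
      by (intro always_eventually allI) (simp add: L2_norm_cnj)
    show "(\<lambda>N. L2_norm unit_lborel f * L2_norm unit_lborel (R N)) \<longlonglongrightarrow> 0"
      using tendsto_mult[OF tendsto_const R0] by simp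
  qed
  hence "(\<lambda>N. disc_transform f z - (disc_transform f z - (\<Sum>n<N. L2_inner unit_lborel f (laguerre n) * z ^ n))) \<longlonglongrightarrow>
      disc_transform f z - 0" by (intro tendsto_diff tendsto_const)
  thus ?thesis by (simp add: sums_def)
qed

lemma disc_transform_holomorphic:
  assumes "f \<in> L2_space unit_lborel" shows "disc_transform f holomorphic_on ball 0 1"
  by (rule power_series_holomorphic[where a = "\<lambda>n. L2_inner unit_lborel f (laguerre n)"])
     (use disc_transform_sums[OF assms] in simp)

lemma laguerre_Bessel:
  assumes "f \<in> L2_space unit_lborel"
  shows "(\<Sum>n<N. (cmod (L2_inner unit_lborel f (laguerre n)))\<^sup>2) \<le> (L2_norm unit_lborel f)\<^sup>2"
proof -
  have "0 \<le> (L2_norm unit_lborel f)\<^sup>2 - (\<Sum>n<N. (cmod (L2_inner unit_lborel f (laguerre n)))\<^sup>2)"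
    unfolding orthonormal_residual(2)[OF assms laguerre_L2 laguerre_orthonormal, symmetric] by simp
  thus ?thesis by simp
qed

lemma disc_transform_circle_mean:
  assumes f: "f \<in> L2_space unit_lborel" and r: "0 < r" "r < 1"
  shows "integral {0..1} (\<lambda>x. (cmod (disc_transform f (of_real r * circ x)))\<^sup>2) \<le> (L2_norm unit_lborel f)\<^sup>2"
proof -
  define c where "c = (\<lambda>n. L2_inner unit_lborel f (laguerre n))"
  have "(\<lambda>n. (cmod (c n))\<^sup>2 * r ^ (2 * n)) sums
      integral {0..1} (\<lambda>x. (cmod (disc_transform f (of_real r * circ x)))\<^sup>2)"
    by (rule circle_mean_square(1)[OF _ r]) (use disc_transform_sums[OF f] in \<open>simp add: c_def\<close>)
  hence lim: "(\<lambda>N. \<Sum>n<N. (cmod (c n))\<^sup>2 * r ^ (2 * n)) \<longlonglongrightarrow>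
      integral {0..1} (\<lambda>x. (cmod (disc_transform f (of_real r * circ x)))\<^sup>2)"
    by (simp add: sums_def)
  have "(\<Sum>n<N. (cmod (c n))\<^sup>2 * r ^ (2 * n)) \<le> (L2_norm unit_lborel f)\<^sup>2" for N
  proof -
    have "(\<Sum>n<N. (cmod (c n))\<^sup>2 * r ^ (2 * n)) \<le> (\<Sum>n<N. (cmod (c n))\<^sup>2)"
      using r by (intro sum_mono) (simp add: mult_left_le power_le_one)
    thus ?thesis using laguerre_Bessel[OF f, of N] by (simp add: c_def)
  qed
  thus ?thesis by (intro LIMSEQ_le_const2[OF lim]) auto
qed

lemma L2_const: "(\<lambda>_. c) \<in> L2_space unit_lborel"
  by (simp add: L2_space_def)

lemma L2_integrable: "f \<in> L2_space unit_lborel \<Longrightarrow> integrable unit_lborel f"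
  using L2_mult_integrable[OF _ L2_const[of 1], of f] by simp

section \<open>Completeness of the Laguerre functions\<close>

text \<open>Weierstrass approximation on [0, 1]; a uniform error of \<open>e\<close> costs at most
  \<open>e\<close> times the integral of |r|.\<close>

lemma moments_zero_imp_continuous:
  fixes \<phi> :: "real \<Rightarrow> real"
  assumes r: "integrable unit_lborel r"
    and mom: "\<And>m. (LINT t|unit_lborel. r t * of_real t ^ m) = (0 :: complex)"
    and \<phi>: "continuous_on UNIV \<phi>"
  shows "(LINT t|unit_lborel. r t * of_real (\<phi> t)) = 0"
proof -
  have [measurable]: "r \<in> borel_measurable unit_lborel" using r by (rule borel_measurable_integrable)
  have [measurable]: "\<phi> \<in> borel_measurable borel" by (rule borel_measurable_continuous_onI[OF \<phi>])
  define I where "I = (LINT t|unit_lborel. cmod (r t))"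
  have bounded_mult: "integrable unit_lborel (\<lambda>t. r t * of_real (g t)) \<and>
      cmod (LINT t|unit_lborel. r t * of_real (g t)) \<le> e * I"
    if [measurable]: "g \<in> borel_measurable borel" and g: "\<And>t. 0 < t \<Longrightarrow> t < 1 \<Longrightarrow> \<bar>g t\<bar> \<le> e" for g :: "real \<Rightarrow> real" and e
  proof
    have [measurable]: "g \<in> borel_measurable unit_lborel" by (rule measurable_unit_lborel) measurable
    have b: "AE t in unit_lborel. norm (r t * of_real (g t)) \<le> e * cmod (r t)"
    proof (rule AE_unit_lborelI)
      fix t :: real assume "0 < t" "t < 1"
      hence "\<bar>g t\<bar> * cmod (r t) \<le> e * cmod (r t)" using g by (intro mult_right_mono) auto
      thus "norm (r t * of_real (g t)) \<le> e * cmod (r t)" by (simp only: norm_mult norm_of_real mult.commute)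
    qed
    have "AE t in unit_lborel. norm (r t * of_real (g t)) \<le> norm (e * cmod (r t))"
      using b by eventually_elim simp
    thus i: "integrable unit_lborel (\<lambda>t. r t * of_real (g t))"
      by (intro Bochner_Integration.integrable_bound[OF integrable_mult_right[OF integrable_norm[OF r], of e]]) auto
    have "cmod (LINT t|unit_lborel. r t * of_real (g t)) \<le> (LINT t|unit_lborel. norm (r t * of_real (g t)))"
      by (rule integral_norm_bound)
    also have "\<dots> \<le> (LINT t|unit_lborel. e * cmod (r t))"
      by (intro integral_mono_AE integrable_norm i integrable_mult_right r b)
    finally show "cmod (LINT t|unit_lborel. r t * of_real (g t)) \<le> e * I" by (simp add: I_def)
  qed
  have "cmod (LINT t|unit_lborel. r t * of_real (\<phi> t)) \<le> e * I" if e: "e > 0" for e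
  proof -
    obtain g where g: "real_polynomial_function g" "\<And>x. x \<in> {0..1} \<Longrightarrow> \<bar>\<phi> x - g x\<bar> < e"
      using Stone_Weierstrass_real_polynomial_function[of "{0..1}" \<phi> e] continuous_on_subset[OF \<phi>] e by auto
    then obtain a n where ga: "g = (\<lambda>x. \<Sum>i\<le>n. a i * x ^ i)"
      using real_polynomial_function_iff_sum by blast
    have [measurable]: "g \<in> borel_measurable borel" unfolding ga by measurable
    have pow: "integrable unit_lborel (\<lambda>t. r t * of_real (t ^ i))" for i
      using bounded_mult[of "\<lambda>t. t ^ i" 1] by (auto simp: power_le_one)
    have g0: "(LINT t|unit_lborel. r t * of_real (g t)) = 0" "integrable unit_lborel (\<lambda>t. r t * of_real (g t))"
    proof -
      have eq: "r t * of_real (g t) = (\<Sum>i\<le>n. of_real (a i) * (r t * of_real (t ^ i)))" for t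
        by (simp add: ga sum_distrib_left mult_ac)
      show "integrable unit_lborel (\<lambda>t. r t * of_real (g t))"
        unfolding eq by (intro Bochner_Integration.integrable_sum integrable_mult_right pow)
      show "(LINT t|unit_lborel. r t * of_real (g t)) = 0"
        unfolding eq using mom
        by (subst Bochner_Integration.integral_sum) (auto intro!: integrable_mult_right pow[unfolded of_real_power])
    qed
    have d: "integrable unit_lborel (\<lambda>t. r t * of_real (\<phi> t - g t))"
        "cmod (LINT t|unit_lborel. r t * of_real (\<phi> t - g t)) \<le> e * I"
      using bounded_mult[of "\<lambda>t. \<phi> t - g t" e] g(2) by (auto simp: less_imp_le)
    have "(LINT t|unit_lborel. r t * of_real (\<phi> t)) = (LINT t|unit_lborel. r t * of_real (\<phi> t - g t) + r t * of_real (g t))"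
      by (intro Bochner_Integration.integral_cong refl) (simp add: algebra_simps)
    also have "\<dots> = (LINT t|unit_lborel. r t * of_real (\<phi> t - g t))"
      using d g0 by (subst Bochner_Integration.integral_add) auto
    finally show ?thesis using d by simp
  qed
  moreover have "I \<ge> 0" unfolding I_def by (rule integral_nonneg_AE) simp
  ultimately have *: "cmod (LINT t|unit_lborel. r t * of_real (\<phi> t)) \<le> e" if "e > 0" for e
  proof -
    have "cmod (LINT t|unit_lborel. r t * of_real (\<phi> t)) \<le> e / (I + 1) * I"
      using \<open>I \<ge> 0\<close> that by (intro \<open>\<And>e. e > 0 \<Longrightarrow> cmod (LINT t|unit_lborel. r t * of_real (\<phi> t)) \<le> e * I\<close>) auto
    also have "\<dots> \<le> e" using \<open>I \<ge> 0\<close> that by (simp add: field_simps)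
    finally show ?thesis .
  qed
  have "cmod (LINT t|unit_lborel. r t * of_real (\<phi> t)) \<le> 0" by (rule field_le_epsilon) (use * in simp)
  thus ?thesis by simp
qed

lemma moments_zero_imp_interval:
  assumes r: "integrable unit_lborel r"
    and mom: "\<And>m. (LINT t|unit_lborel. r t * of_real t ^ m) = (0 :: complex)"
  shows "(LINT t|unit_lborel. indicator {..x} t *\<^sub>R r t) = 0"
proof -
  note [measurable] = measurable_id_unit_lborel
  have [measurable]: "r \<in> borel_measurable unit_lborel" using r by (rule borel_measurable_integrable)
  \<comment> \<open>For n > 0 a ramp that is 1 up to \<open>x\<close> and falls to 0 over a length
    1/n.\<close>
  define \<phi> where "\<phi> = (\<lambda>n t. max 0 (min 1 (1 - real n * (t - x))))"
  have cont: "continuous_on UNIV (\<phi> n)" for n unfolding \<phi>_def by (intro continuous_intros)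
  have [measurable]: "\<phi> n \<in> borel_measurable unit_lborel" for n
    by (intro measurable_unit_lborel borel_measurable_continuous_onI cont)
  have "(\<lambda>n. LINT t|unit_lborel. r t * of_real (\<phi> n t)) \<longlonglongrightarrow> (LINT t|unit_lborel. indicator {..x} t *\<^sub>R r t)"
  proof (rule integral_dominated_convergence)
    show "integrable unit_lborel (\<lambda>t. cmod (r t))" by (rule integrable_norm[OF r])
    show "AE t in unit_lborel. norm (r t * of_real (\<phi> n t)) \<le> cmod (r t)" for n
      by (intro AE_unit_lborelI) (auto simp: norm_mult \<phi>_def intro!: mult_left_le)
    have "(\<lambda>n. \<phi> n t) \<longlonglongrightarrow> indicator {..x} t" for t
    proof (cases "t \<le> x")
      case True
      hence "\<phi> n t = 1" for n by (simp add: \<phi>_def mult_nonneg_nonpos)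
      thus ?thesis using True by simp
    next
      case False
      obtain N where N: "real N > 1 / (t - x)" using reals_Archimedean2 by blast
      have "\<phi> n t = 0" if "n \<ge> N" for n
      proof -
        have "real n > 1 / (t - x)" using N that by (meson less_le_trans of_nat_le_iff)
        hence "real n * (t - x) > 1" using False by (simp add: field_simps)
        thus ?thesis by (simp add: \<phi>_def)
      qed
      hence "\<forall>\<^sub>F n in sequentially. \<phi> n t = 0" by (auto simp: eventually_sequentially)
      thus ?thesis using False by (simp add: tendsto_eventually)
    qed
    hence "(\<lambda>n. r t * of_real (\<phi> n t)) \<longlonglongrightarrow> r t * of_real (indicator {..x} t)" for t
      by (intro tendsto_intros)
    thus "AE t in unit_lborel. (\<lambda>n. r t * of_real (\<phi> n t)) \<longlonglongrightarrow> indicator {..x} t *\<^sub>R r t"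
      by (simp add: scaleR_conv_of_real mult.commute)
  qed measurable
  moreover have "(LINT t|unit_lborel. r t * of_real (\<phi> n t)) = 0" for n
    by (rule moments_zero_imp_continuous[OF r mom cont])
  ultimately show ?thesis by (simp add: LIMSEQ_const_iff)
qed

text \<open>Half-lines generate the Borel sets and are stable under intersection; the complement
  step uses the moment of order 0.\<close>

lemma moments_zero_imp_borel:
  assumes r: "integrable unit_lborel r"
    and mom: "\<And>m. (LINT t|unit_lborel. r t * of_real t ^ m) = (0 :: complex)"
    and B: "B \<in> sets borel"
  shows "(LINT t|unit_lborel. indicator B t *\<^sub>R r t) = 0"
proof -
  have ss: "B \<in> sigma_sets UNIV (range (\<lambda>a::real. {..a}))"
    using B unfolding borel_eq_atMost by simp
  have ist: "Int_stable (range (\<lambda>a::real. {..a}))"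
    by (auto simp: Int_stable_def)
  have ind: "integrable unit_lborel (\<lambda>t. indicator A t *\<^sub>R r t)" if "A \<in> sets borel" for A
  proof (rule Bochner_Integration.integrable_bound[OF r])
    have [measurable]: "r \<in> borel_measurable unit_lborel" using r by (rule borel_measurable_integrable)
    have [measurable]: "(indicator A :: real \<Rightarrow> real) \<in> borel_measurable unit_lborel"
      using that by (intro measurable_unit_lborel borel_measurable_indicator)
    show "(\<lambda>t. indicator A t *\<^sub>R r t) \<in> borel_measurable unit_lborel" by measurable
  qed (auto intro!: AE_I2 simp: indicator_def)
  from ist subset_Pow_Union[THEN subset_trans, OF Pow_mono[OF subset_UNIV]] ss show ?thesis
  proof (induction rule: sigma_sets_induct_disjoint)
    case (basic A)
    thus ?case using moments_zero_imp_interval[OF r mom] by auto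
  next
    case (compl A)
    hence A: "A \<in> sets borel" by (simp add: borel_eq_atMost)
    have "(LINT t|unit_lborel. indicator (UNIV - A) t *\<^sub>R r t) = (LINT t|unit_lborel. r t - indicator A t *\<^sub>R r t)"
      by (intro Bochner_Integration.integral_cong refl) (auto simp: indicator_def)
    also have "\<dots> = 0"
      using ind[OF A] r compl mom[of 0] by (subst Bochner_Integration.integral_diff) auto
    finally show ?case .
  next
    case (union A)
    hence A: "A i \<in> sets borel" for i by (auto simp: borel_eq_atMost)
    have meas: "space unit_lborel \<inter> A i \<in> sets unit_lborel" for i
      using A[of i] by (auto simp: sets_unit_lborel sets_restrict_space)
    define A' where "A' = (\<lambda>i. space unit_lborel \<inter> A i)"
    have sums: "(LINT t:(\<Union>i. A' i)|unit_lborel. r t) = (\<Sum>i. (LINT t:A' i|unit_lborel. r t))"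
    proof (rule lebesgue_integral_countable_add)
      show "A' i \<in> sets unit_lborel" for i using meas by (simp add: A'_def)
      show "i \<noteq> j \<Longrightarrow> A' i \<inter> A' j = {}" for i j
        using union by (auto simp: A'_def disjoint_family_on_def)
      have "integrable unit_lborel (\<lambda>t. indicator (\<Union>i. A i) t *\<^sub>R r t)" using A by (intro ind) auto
      also have "?this \<longleftrightarrow> set_integrable unit_lborel (\<Union>i. A' i) r" unfolding set_integrable_def
        by (intro Bochner_Integration.integrable_cong refl) (auto simp: A'_def indicator_def)
      finally show "set_integrable unit_lborel (\<Union>i. A' i) r" .
    qed
    have e1: "(LINT t:A' i|unit_lborel. r t) = (LINT t|unit_lborel. indicator (A i) t *\<^sub>R r t)" for i
      unfolding set_lebesgue_integral_def
      by (intro Bochner_Integration.integral_cong refl) (auto simp: A'_def indicator_def)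
    have e2: "(LINT t:(\<Union>i. A' i)|unit_lborel. r t) = (LINT t|unit_lborel. indicator (\<Union>i. A i) t *\<^sub>R r t)"
      unfolding set_lebesgue_integral_def
      by (intro Bochner_Integration.integral_cong refl) (auto simp: A'_def indicator_def)
    show ?case using sums union(3) by (simp add: e1 e2)
  qed auto
qed

lemma moments_zero_imp_zero:
  assumes f: "r \<in> L2_space unit_lborel"
    and mom: "\<And>m. (LINT t|unit_lborel. r t * of_real t ^ m) = (0 :: complex)"
  shows "L2_norm unit_lborel r = 0"
proof -
  have r: "integrable unit_lborel r" by (rule L2_integrable[OF f])
  have set0: "(LINT t:A|unit_lborel. r t) = 0" if A: "A \<in> sets unit_lborel" for A
  proof -
    obtain B where B: "B \<in> sets borel" "A = {0<..<1} \<inter> B"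
      using A unfolding sets_unit_lborel sets_restrict_space by blast
    have "(LINT t:A|unit_lborel. r t) = (LINT t|unit_lborel. indicator B t *\<^sub>R r t)"
      unfolding set_lebesgue_integral_def
      by (intro Bochner_Integration.integral_cong refl) (auto simp: B indicator_def)
    thus ?thesis using moments_zero_imp_borel[OF r mom B(1)] by simp
  qed
  have si: "integrable unit_lborel (\<lambda>t. indicator A t *\<^sub>R r t)" if "A \<in> sets unit_lborel" for A
    using integrable_mult_indicator[OF that r] .
  have 1: "AE t in unit_lborel. Re (r t) = 0"
  proof (rule density_unique_real)
    fix A assume A: "A \<in> sets unit_lborel"
    have "(LINT t:A|unit_lborel. Re (r t)) = Re (LINT t:A|unit_lborel. r t)"
      unfolding set_lebesgue_integral_def using si[OF A] by (subst integral_Re[symmetric]) auto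
    thus "(LINT t:A|unit_lborel. Re (r t)) = (LINT t:A|unit_lborel. 0)"
      using set0[OF A] by (simp add: set_lebesgue_integral_def)
  qed (use r in auto)
  have 2: "AE t in unit_lborel. Im (r t) = 0"
  proof (rule density_unique_real)
    fix A assume A: "A \<in> sets unit_lborel"
    have "(LINT t:A|unit_lborel. Im (r t)) = Im (LINT t:A|unit_lborel. r t)"
      unfolding set_lebesgue_integral_def using si[OF A] by (subst integral_Im[symmetric]) auto
    thus "(LINT t:A|unit_lborel. Im (r t)) = (LINT t:A|unit_lborel. 0)"
      using set0[OF A] by (simp add: set_lebesgue_integral_def)
  qed (use r in auto)
  have "AE t in unit_lborel. (cmod (r t))\<^sup>2 = 0"
    using 1 2 by eventually_elim (simp add: cmod_power2)
  hence "(LINT t|unit_lborel. (cmod (r t))\<^sup>2) = 0"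
    by (rule integral_eq_zero_AE)
  thus ?thesis by (simp add: L2_norm_def)
qed

lemma laguerre_complete:
  assumes r: "r \<in> L2_space unit_lborel" and orth: "\<And>n. L2_inner unit_lborel r (laguerre n) = 0"
  shows "L2_norm unit_lborel r = 0"
proof (rule moments_zero_imp_zero[OF r])
  fix m
  \<comment> \<open>The point z = m / (m + 1) corresponds to s = m + 1, where the Mellin transform
    is the m-th moment.\<close>
  define z where "z = complex_of_real (real m / real (Suc m))"
  have z: "cmod z < 1" unfolding z_def norm_of_real by simp
  have "1 - real m / real (Suc m) = 1 / real (Suc m)" by (simp add: field_simps)
  hence "1 - z = of_real (1 / real (Suc m))" unfolding z_def by (metis of_real_1 of_real_diff)
  hence s: "1 / (1 - z) = of_nat (Suc m)" "1 - z \<noteq> 0" by (simp_all del: of_nat_Suc)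
  have "(\<lambda>n. 0) sums disc_transform r z" using disc_transform_sums[OF r z] by (simp add: orth)
  hence "disc_transform r z = 0" by (rule sums_unique2[OF _ sums_zero])
  hence "mellin r (of_nat (Suc m)) = 0" using s by (simp add: disc_transform_def)
  also have "mellin r (of_nat (Suc m)) = (LINT t|unit_lborel. r t * of_real t ^ m)"
    unfolding mellin_def by (intro Bochner_Integration.integral_cong refl) (simp add: powr_nat)
  finally show "(LINT t|unit_lborel. r t * of_real t ^ m) = 0" .
qed

text \<open>By completeness \<open>f\<close> has elements \<open>g\<close> of the span at distance
  at most sqrt e. For N beyond the indices in \<open>g\<close> the residual R is orthogonal to
  \<open>g\<close>, so its squared norm is the inner product of f - g and R, and R is no larger than
  f - g.\<close>

lemma laguerre_Parseval_le:
  assumes f: "f \<in> L2_space unit_lborel"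
    and bd: "\<And>N. (\<Sum>n<N. (cmod (L2_inner unit_lborel f (laguerre n)))\<^sup>2) \<le> B\<^sup>2" and B: "B \<ge> 0"
  shows "L2_norm unit_lborel f \<le> B"
proof -
  define M where "M = unit_lborel"
  obtain p where p: "p \<in> L2_closed_span M (range laguerre)"
    "\<And>g. g \<in> L2_closed_span M (range laguerre) \<Longrightarrow> L2_inner M (\<lambda>x. f x - p x) g = 0"
    using L2_projection_exists[of "range laguerre" M f] f laguerre_L2 unfolding M_def by blast
  have pL: "p \<in> L2_space M" using p(1) by (simp add: L2_closed_span_def)
  have lagV: "laguerre n \<in> L2_closed_span M (range laguerre)" for n
    unfolding L2_closed_span_def
    using laguerre_L2[of n] lin_span_base[of "laguerre n" "range laguerre"]
    by (auto simp: M_def L2_norm_def intro!: bexI[of _ "laguerre n"])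
  have fp0: "L2_norm M (\<lambda>x. f x - p x) = 0"
    unfolding M_def by (rule laguerre_complete) (use f pL p(2)[OF lagV] in \<open>auto simp: M_def intro: L2_space_diff\<close>)
  have "(L2_norm M f)\<^sup>2 \<le> B\<^sup>2 + e" if e: "e > 0" for e
  proof -
    obtain g where g: "g \<in> lin_span (range laguerre)" "L2_norm M (\<lambda>x. p x - g x) < sqrt e"
      using p(1) real_sqrt_gt_zero[OF e] unfolding L2_closed_span_def by blast
    have gL: "g \<in> L2_space M" using lin_span_L2[OF _ g(1)] laguerre_L2 unfolding M_def by blast
    have fg: "L2_norm M (\<lambda>x. f x - g x) \<le> sqrt e"
      using L2_norm_triangle_diff[of f M p g] f pL gL fp0 g(2) by (simp add: M_def)
    obtain c F where cF: "g = (\<lambda>x. \<Sum>h\<in>F. c h * h x)" "finite F" "F \<subseteq> range laguerre"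
      using g(1) by (auto simp: lin_span_def)
    obtain I where I: "finite I" "F = laguerre ` I" using finite_subset_image[OF cF(2,3)] by auto
    obtain N where N: "I \<subseteq> {..<N}" using finite_nat_iff_bounded I by blast
    define R where "R = (\<lambda>x. f x - (\<Sum>n<N. L2_inner M f (laguerre n) * laguerre n x))"
    have Rorth: "L2_inner M R (laguerre m) = 0" if "m < N" for m
      unfolding R_def M_def by (rule orthonormal_residual(1)[OF f laguerre_L2 laguerre_orthonormal that])
    have Rn: "(L2_norm M R)\<^sup>2 = (L2_norm M f)\<^sup>2 - (\<Sum>n<N. (cmod (L2_inner M f (laguerre n)))\<^sup>2)"
      unfolding R_def M_def by (rule orthonormal_residual(2)[OF f laguerre_L2 laguerre_orthonormal])
    have PL: "(\<lambda>x. \<Sum>n<N. L2_inner M f (laguerre n) * laguerre n x) \<in> L2_space M"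
      unfolding M_def by (intro L2_space_sum L2_space_cmult laguerre_L2)
    have RL: "R \<in> L2_space M" unfolding R_def by (intro L2_space_diff PL) (simp add: M_def f)
    have lagR: "L2_inner M (laguerre m) R = 0" if "m < N" for m
      using Rorth[OF that] L2_inner_commute[of M "laguerre m" R] by simp
    have PR: "L2_inner M (\<lambda>x. \<Sum>n<N. L2_inner M f (laguerre n) * laguerre n x) R = 0"
      using RL laguerre_L2 lagR unfolding M_def
      by (subst L2_inner_sum_left) (auto intro: L2_space_cmult simp: L2_inner_cmult_left)
    have gR: "L2_inner M g R = 0"
    proof -
      have "L2_inner M g R = (\<Sum>h\<in>F. c h * L2_inner M h R)"
        unfolding cF(1) using RL laguerre_L2 cF(3) unfolding M_def
        by (subst L2_inner_sum_left) (auto intro!: L2_space_cmult simp: L2_inner_cmult_left)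
      also have "\<dots> = 0" using I N lagR by (intro sum.neutral) auto
      finally show ?thesis .
    qed
    have fL: "f \<in> L2_space M" using f by (simp add: M_def)
    have "of_real ((L2_norm M R)\<^sup>2) = L2_inner M R R" by (rule L2_inner_self[symmetric])
    also have "\<dots> = L2_inner M f R"
      using L2_inner_diff_left[OF fL PL RL] PR by (simp add: R_def[symmetric])
    also have "\<dots> = L2_inner M (\<lambda>x. f x - g x) R"
      using L2_inner_diff_left[OF fL gL RL] gR by simp
    finally have "(L2_norm M R)\<^sup>2 = cmod (L2_inner M (\<lambda>x. f x - g x) R)"
      by (metis abs_power2 norm_of_real)
    also have "\<dots> \<le> L2_norm M (\<lambda>x. f x - g x) * L2_norm M R"
      by (intro L2_Cauchy_Schwarz L2_space_diff fL gL RL)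
    finally have "L2_norm M R * L2_norm M R \<le> L2_norm M (\<lambda>x. f x - g x) * L2_norm M R"
      by (simp add: power2_eq_square)
    hence "L2_norm M R \<le> L2_norm M (\<lambda>x. f x - g x)"
      using mult_right_le_imp_le[of "L2_norm M R" "L2_norm M R" "L2_norm M (\<lambda>x. f x - g x)"] L2_norm_nonneg[of M R]
        L2_norm_nonneg[of M "\<lambda>x. f x - g x"] by linarith
    hence "L2_norm M R \<le> sqrt e" using fg by simp
    hence "(L2_norm M R)\<^sup>2 \<le> (sqrt e)\<^sup>2" by (intro power_mono) auto
    hence "(L2_norm M R)\<^sup>2 \<le> e" using e by simp
    thus ?thesis using Rn bd[of N] by (simp add: M_def)
  qed
  hence "(L2_norm M f)\<^sup>2 \<le> B\<^sup>2" by (rule field_le_epsilon)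
  thus ?thesis using B power2_le_imp_le by (auto simp: M_def)
qed

text \<open>The mean square over a circle of radius r < 1 is at most B^2 and bounds the partial sums
  of |c n|^2 r^(2n); for fixed N, r tends to 1.\<close>

theorem L2_norm_le_disc_bound:
  assumes f: "f \<in> L2_space unit_lborel" and bd: "\<And>z. cmod z < 1 \<Longrightarrow> cmod (disc_transform f z) \<le> B"
  shows "L2_norm unit_lborel f \<le> B"
proof (rule laguerre_Parseval_le[OF f])
  show B: "B \<ge> 0" using order_trans[OF norm_ge_zero bd[of 0]] by simp
  fix N
  define c where "c = (\<lambda>n. L2_inner unit_lborel f (laguerre n))"
  have "(\<Sum>n<N. (cmod (c n))\<^sup>2 * r ^ (2 * n)) \<le> B\<^sup>2" if r: "0 < r" "r < 1" for r
  proof -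
    define J where "J = integral {0..1} (\<lambda>x. (cmod (disc_transform f (of_real r * circ x)))\<^sup>2)"
    have F: "\<And>z. cmod z < 1 \<Longrightarrow> (\<lambda>n. c n * z ^ n) sums disc_transform f z"
      using disc_transform_sums[OF f] by (simp add: c_def)
    have s: "(\<lambda>n. (cmod (c n))\<^sup>2 * r ^ (2 * n)) sums J"
      unfolding J_def by (rule circle_mean_square(1)[OF F r])
    have "(\<Sum>n<N. (cmod (c n))\<^sup>2 * r ^ (2 * n)) \<le> J"
      using sum_le_suminf[OF sums_summable[OF s], of "{..<N}"] sums_unique[OF s] r by auto
    also have "J \<le> integral {0..1} (\<lambda>x::real. B\<^sup>2)"
      unfolding J_def
    proof (rule integral_le)
      show "(\<lambda>x. (cmod (disc_transform f (of_real r * circ x)))\<^sup>2) integrable_on {0..1}"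
        by (intro integrable_continuous_real continuous_intros circle_mean_square(2)[OF F r])
      show "(cmod (disc_transform f (of_real r * circ x)))\<^sup>2 \<le> B\<^sup>2" for x
        using r by (intro power_mono bd) (auto simp: norm_mult)
    qed (intro integrable_continuous_real continuous_intros)
    finally show ?thesis by simp
  qed
  hence "\<forall>\<^sub>F r in at_left 1. (\<Sum>n<N. (cmod (c n))\<^sup>2 * r ^ (2 * n)) \<le> B\<^sup>2"
    by (auto simp: eventually_at_left_field intro!: exI[of _ 0])
  moreover have "((\<lambda>r. \<Sum>n<N. (cmod (c n))\<^sup>2 * r ^ (2 * n)) \<longlongrightarrow> (\<Sum>n<N. (cmod (c n))\<^sup>2 * 1 ^ (2 * n))) (at_left (1::real))"
    by (intro tendsto_intros)
  ultimately have "(\<Sum>n<N. (cmod (c n))\<^sup>2 * 1 ^ (2 * n)) \<le> B\<^sup>2"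
    by (intro tendsto_upperbound[of _ _ "at_left (1::real)"]) auto
  thus "(\<Sum>n<N. (cmod (L2_inner unit_lborel f (laguerre n)))\<^sup>2) \<le> B\<^sup>2" by (simp add: c_def)
qed

section \<open>Dilation averages and Mellin transforms\<close>

lemma quarter_norm_integrable:
  assumes h: "h \<in> L2_space unit_lborel"
  shows "integrable unit_lborel (\<lambda>t. t powr (- (1/4)) * cmod (h t))"
proof -
  have "(\<lambda>t. complex_of_real (t powr (- (1/4)))) \<in> quarter_bounded"
    unfolding quarter_bounded_def by (intro CollectI conjI exI[of _ 1]) auto
  from integrable_norm[OF L2_mult_integrable[OF quarter_bounded_L2[OF this] h]]
  show ?thesis by (simp add: norm_mult)
qed

text \<open>Averages over the dilation-invariant measure da/a. The factor a^(1/4) makes them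
  converge at 0, and 4 is the integral of a^(-3/4). The Fubini identity serves orthogonality, with
  \<open>h = y\<close>, and Mellin transforms, with \<open>h\<close> a power of t.\<close>

lemma averaged_kernel:
  fixes k :: "real \<Rightarrow> real \<Rightarrow> complex"
  assumes meas: "(\<lambda>(a, t). k a t) \<in> borel_measurable (borel \<Otimes>\<^sub>M borel)"
    and bound: "\<And>a t. 0 < a \<Longrightarrow> a < 1 \<Longrightarrow> 0 < t \<Longrightarrow> cmod (k a t) \<le> C * (a powr (1/4) * t powr (- (1/4)))"
  defines "K \<equiv> \<lambda>t. LINT a|unit_lborel. k a t / of_real a"
  shows averaged_kernel_measurable: "K \<in> borel_measurable borel"
    and averaged_kernel_bound: "\<And>t. 0 < t \<Longrightarrow> cmod (K t) \<le> 4 * C * t powr (- (1/4))"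
    and averaged_kernel_Fubini: "\<And>h. h \<in> L2_space unit_lborel \<Longrightarrow>
      (LINT t|unit_lborel. K t * h t) = (LINT a|unit_lborel. (LINT t|unit_lborel. k a t * h t) / of_real a)"
proof -
  have C0: "C \<ge> 0"
  proof -
    have "0 \<le> C * ((1/2) powr (1/4) * (1/2) powr (- (1/4)))"
      using order_trans[OF norm_ge_zero bound[of "1/2" "1/2"]] by simp
    thus ?thesis by (simp add: powr_minus)
  qed
  have b1: "norm (k a t / of_real a) \<le> C * t powr (- (1/4)) * a powr (- (3/4))"
    if "0 < a" "a < 1" "0 < t" for a t
  proof -
    have "norm (k a t / of_real a) \<le> C * (a powr (1/4) * t powr (- (1/4))) / a"
      using bound[OF that] that by (simp add: norm_divide divide_right_mono)
    also have "a powr (1/4) = a powr (- (3/4)) * a"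
      using that powr_add[of a "- (3/4)" 1] by simp
    finally show ?thesis using that by (simp add: mult_ac)
  qed
  have int34: "integrable unit_lborel (\<lambda>a. c * a powr (- (3/4)))" for c
    by (intro integrable_mult_right powr_integral_unit_lborel) simp
  have val34: "(LINT a|unit_lborel. c * a powr (- (3/4))) = c * 4" for c
    by (simp add: powr_integral_unit_lborel(2))
  have [measurable]: "(\<lambda>p. k (fst p) (snd p)) \<in> borel_measurable (borel \<Otimes>\<^sub>M borel)"
    using meas by (simp add: case_prod_beta')
  have m1: "(\<lambda>p. k (snd p) (fst p) / of_real (snd p)) \<in> borel_measurable (borel \<Otimes>\<^sub>M unit_lborel)"
  proof -
    have [measurable]: "(\<lambda>p. (snd p, fst p)) \<in> (borel \<Otimes>\<^sub>M unit_lborel) \<rightarrow>\<^sub>M (borel \<Otimes>\<^sub>M (borel :: real measure))"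
      by (intro measurable_Pair measurable_compose[OF measurable_snd measurable_id_unit_lborel]) auto
    have [measurable]: "(\<lambda>p. snd p) \<in> borel_measurable ((borel :: real measure) \<Otimes>\<^sub>M unit_lborel)"
      by (rule measurable_compose[OF measurable_snd measurable_id_unit_lborel])
    have "(\<lambda>p. k (fst (snd p, fst p)) (snd (snd p, fst p))) \<in> borel_measurable (borel \<Otimes>\<^sub>M unit_lborel)"
      by (rule measurable_compose[of "\<lambda>p. (snd p, fst p)" _ "borel \<Otimes>\<^sub>M borel"]) measurable
    hence [measurable]: "(\<lambda>p. k (snd p) (fst p)) \<in> borel_measurable (borel \<Otimes>\<^sub>M unit_lborel)" by simp
    show ?thesis by measurable
  qed
  show "K \<in> borel_measurable borel"
    unfolding K_def
    by (rule unit_lborel.borel_measurable_lebesgue_integral) (use m1 in \<open>simp add: case_prod_beta'\<close>)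
  show Kb: "cmod (K t) \<le> 4 * C * t powr (- (1/4))" if t: "0 < t" for t
  proof -
    have "cmod (K t) \<le> (LINT a|unit_lborel. C * t powr (- (1/4)) * a powr (- (3/4)))"
      unfolding K_def
    proof (rule Bochner_Integration.integral_norm_bound_integral[OF _ int34])
      show "integrable unit_lborel (\<lambda>a. k a t / of_real a)"
      proof (rule Bochner_Integration.integrable_bound[OF int34])
        show "(\<lambda>a. k a t / of_real a) \<in> borel_measurable unit_lborel"
          using measurable_Pair2[OF m1, of t] by simp
        show "AE a in unit_lborel. norm (k a t / of_real a) \<le> norm (C * t powr (- (1/4)) * a powr (- (3/4)))"
          using b1 t C0 by (intro AE_unit_lborelI) (simp add: abs_mult)
      qed
    qed (use b1 t in auto)
    also have "\<dots> = 4 * C * t powr (- (1/4))" by (subst val34) simp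
    finally show ?thesis .
  qed
  fix h :: "real \<Rightarrow> complex" assume h: "h \<in> L2_space unit_lborel"
  have hm: "h \<in> borel_measurable unit_lborel" by (rule L2_space_measurable[OF h])
  interpret P: pair_sigma_finite unit_lborel unit_lborel ..
  have m2: "(\<lambda>p. k (fst p) (snd p) / of_real (fst p) * h (snd p)) \<in> borel_measurable (unit_lborel \<Otimes>\<^sub>M unit_lborel)"
  proof -
    have [measurable]: "(\<lambda>p. (fst p, snd p)) \<in> (unit_lborel \<Otimes>\<^sub>M unit_lborel) \<rightarrow>\<^sub>M (borel \<Otimes>\<^sub>M (borel :: real measure))"
      by (intro measurable_Pair measurable_compose[OF measurable_snd measurable_id_unit_lborel]
           measurable_compose[OF measurable_fst measurable_id_unit_lborel])
    have [measurable]: "(\<lambda>p. fst p) \<in> borel_measurable (unit_lborel \<Otimes>\<^sub>M unit_lborel)"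
      by (rule measurable_compose[OF measurable_fst measurable_id_unit_lborel])
    have "(\<lambda>p. k (fst (fst p, snd p)) (snd (fst p, snd p))) \<in> borel_measurable (unit_lborel \<Otimes>\<^sub>M unit_lborel)"
      by (rule measurable_compose[of "\<lambda>p. (fst p, snd p)" _ "borel \<Otimes>\<^sub>M borel"]) measurable
    hence [measurable]: "(\<lambda>p. k (fst p) (snd p)) \<in> borel_measurable (unit_lborel \<Otimes>\<^sub>M unit_lborel)" by simp
    have [measurable]: "(\<lambda>p. h (snd p)) \<in> borel_measurable (unit_lborel \<Otimes>\<^sub>M unit_lborel)"
      by (rule measurable_compose[OF measurable_snd hm])
    show ?thesis by measurable
  qed
  define F where "F = (\<lambda>p. k (fst p) (snd p) / of_real (fst p) * h (snd p))"
  define I where "I = (LINT t|unit_lborel. t powr (- (1/4)) * cmod (h t))"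
  have Fm: "F \<in> borel_measurable (unit_lborel \<Otimes>\<^sub>M unit_lborel)" using m2 by (simp add: F_def)
  have Fa: "(\<lambda>t. F (a, t)) \<in> borel_measurable unit_lborel" if "a \<in> {0<..<1}" for a
    using measurable_Pair2[OF Fm, of a] that by simp
  have b2: "norm (F (a, t)) \<le> C * a powr (- (3/4)) * (t powr (- (1/4)) * cmod (h t))"
    if "0 < a" "a < 1" "0 < t" for a t
    using mult_right_mono[OF b1[OF that], of "cmod (h t)"] by (simp add: F_def norm_mult norm_divide mult_ac)
  have int_a: "integrable unit_lborel (\<lambda>t. F (a, t))" if a: "0 < a" "a < 1" for a
  proof (rule Bochner_Integration.integrable_bound[OF integrable_mult_right[OF quarter_norm_integrable[OF h]]])
    show "(\<lambda>t. F (a, t)) \<in> borel_measurable unit_lborel" using Fa a by simp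
    show "AE t in unit_lborel. norm (F (a, t)) \<le> norm (C * a powr (- (3/4)) * (t powr (- (1/4)) * cmod (h t)))"
      using b2[OF a] C0 by (intro AE_unit_lborelI) (simp add: abs_mult)
  qed
  \<comment> \<open>The majorant is a function of \<open>a\<close> times a function of
    \<open>t\<close>, both integrable.\<close>
  have int_prod: "integrable (unit_lborel \<Otimes>\<^sub>M unit_lborel) F"
  proof (rule P.Fubini_integrable[OF Fm])
    show "integrable unit_lborel (\<lambda>a. LINT t|unit_lborel. norm (F (a, t)))"
    proof (rule Bochner_Integration.integrable_bound[OF int34[of "C * I"]])
      show "(\<lambda>a. LINT t|unit_lborel. norm (F (a, t))) \<in> borel_measurable unit_lborel"
        by (rule unit_lborel.borel_measurable_lebesgue_integral) (use Fm in \<open>simp add: case_prod_beta'\<close>)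
      show "AE a in unit_lborel. norm (LINT t|unit_lborel. norm (F (a, t))) \<le> norm (C * I * a powr (- (3/4)))"
      proof (rule AE_unit_lborelI)
        fix a :: real assume a: "0 < a" "a < 1"
        have "(LINT t|unit_lborel. norm (F (a, t))) \<le> (LINT t|unit_lborel. C * a powr (- (3/4)) * (t powr (- (1/4)) * cmod (h t)))"
          by (intro integral_mono_AE integrable_norm int_a a integrable_mult_right quarter_norm_integrable h AE_unit_lborelI b2)
        also have "\<dots> = C * I * a powr (- (3/4))" by (simp add: I_def)
        finally have "(LINT t|unit_lborel. norm (F (a, t))) \<le> C * I * a powr (- (3/4))" .
        moreover have "(LINT t|unit_lborel. norm (F (a, t))) \<ge> 0" by (rule integral_nonneg_AE) simp
        ultimately show "norm (LINT t|unit_lborel. norm (F (a, t))) \<le> norm (C * I * a powr (- (3/4)))" by simp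
      qed
    qed
    show "AE a in unit_lborel. integrable unit_lborel (\<lambda>t. F (a, t))"
      using int_a by (intro AE_unit_lborelI)
  qed
  have "(LINT t|unit_lborel. K t * h t) = (LINT t|unit_lborel. LINT a|unit_lborel. F (a, t))"
  proof (intro Bochner_Integration.integral_cong refl)
    fix t
    have "K t * h t = (LINT a|unit_lborel. k a t / of_real a * h t)"
      unfolding K_def by (rule integral_mult_left_zero[symmetric])
    thus "K t * h t = (LINT a|unit_lborel. F (a, t))" by (simp only: F_def fst_conv snd_conv)
  qed
  also have "\<dots> = (LINT a|unit_lborel. LINT t|unit_lborel. F (a, t))"
    using P.Fubini_integral[of "\<lambda>a t. F (a, t)"] int_prod by simp
  also have "\<dots> = (LINT a|unit_lborel. (LINT t|unit_lborel. k a t * h t) / of_real a)"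
  proof (intro Bochner_Integration.integral_cong refl)
    fix a
    have "(LINT t|unit_lborel. F (a, t)) = (LINT t|unit_lborel. k a t * h t / of_real a)"
      by (intro Bochner_Integration.integral_cong refl) (simp add: F_def)
    thus "(LINT t|unit_lborel. F (a, t)) = (LINT t|unit_lborel. k a t * h t) / of_real a" by simp
  qed
  finally show "(LINT t|unit_lborel. K t * h t) = (LINT a|unit_lborel. (LINT t|unit_lborel. k a t * h t) / of_real a)" .
qed

text \<open>The substitution t = a x leads to 0 < x < 1/a, and the support condition cuts this back
  to 0 < x < 1. The point x = 1 is discarded as a null set.\<close>

lemma mellin_dilation:
  assumes f: "f \<in> borel_measurable borel" and supp: "\<And>t. t > 1 \<Longrightarrow> f t = 0" and a: "0 < a" "a \<le> 1"
  shows "mellin (\<lambda>t. f (t / a)) s = of_real a powr s * mellin f s"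
proof -
  note [measurable] = f
  define g where "g = (\<lambda>t. indicator {0<..<1} t *\<^sub>R (f (t / a) * of_real t powr (s - 1)))"
  have "mellin (\<lambda>t. f (t / a)) s = integral\<^sup>L lborel g"
    by (simp add: mellin_def integral_unit_lborel set_lebesgue_integral_def g_def)
  also have "\<dots> = \<bar>a\<bar> *\<^sub>R (LBINT x. g (0 + a * x))"
    using a by (intro lborel_integral_real_affine) auto
  also have "(LBINT x. g (0 + a * x)) = (LBINT x. of_real a powr (s - 1) * (indicator {0<..<1} x *\<^sub>R (f x * of_real x powr (s - 1))))"
  proof (rule integral_cong_AE)
    have "AE x::real in lborel. x \<noteq> 1" by (rule AE_lborel_singleton)
    thus "AE x in lborel. g (0 + a * x) = of_real a powr (s - 1) * (indicator {0<..<1} x *\<^sub>R (f x * of_real x powr (s - 1)))"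
    proof eventually_elim
      case (elim x)
      consider "x \<le> 0" | "x > 1" | "0 < x" "x < 1" using elim by linarith
      thus ?case
      proof cases
        case 1
        hence "a * x \<le> 0" using a by (simp add: mult_nonneg_nonpos)
        thus ?thesis using 1 by (auto simp: g_def indicator_def)
      next
        case 2
        thus ?thesis using a supp[of x] by (simp add: g_def)
      next
        case 3
        have "a * x < 1" using 3 a by (meson less_le_trans mult_left_le_one_le mult_strict_mono less_imp_le order_le_less_trans)
        moreover have "a * x > 0" using 3 a by simp
        moreover have "(of_real (a * x) :: complex) powr (s - 1) = of_real a powr (s - 1) * of_real x powr (s - 1)"
          using 3 a by (simp add: powr_times_real)
        ultimately show ?thesis using 3 a by (simp add: g_def)
      qed
    qed
  qed (simp_all add: g_def)
  also have "(LBINT x. of_real a powr (s - 1) * (indicator {0<..<1} x *\<^sub>R (f x * of_real x powr (s - 1)))) =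
      of_real a powr (s - 1) * mellin f s"
    unfolding mellin_def integral_unit_lborel set_lebesgue_integral_def by (rule integral_mult_right_zero)
  also have "\<bar>a\<bar> *\<^sub>R (of_real a powr (s - 1) * mellin f s) = (of_real a * of_real a powr (s - 1)) * mellin f s"
    using a by (simp add: scaleR_conv_of_real)
  also have "of_real a * of_real a powr (s - 1) = (of_real a powr s :: complex)"
    using a by (simp add: powr_diff)
  finally show ?thesis .
qed

text \<open>The pairing is bilinear, to fit Mellin transforms. Asking for orthogonality of all
  dilates makes the class stable under averaging; the pointwise bound and Borel measurability single
  out representatives whose dilates can be integrated jointly in both variables.\<close>

definition dilation_orth :: "(real \<Rightarrow> complex) \<Rightarrow> (real \<Rightarrow> complex) set" where
  "dilation_orth y = {f \<in> borel_measurable borel.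
     (\<exists>C. \<forall>t>0. cmod (f t) \<le> C * t powr (- (1/4))) \<and> (\<forall>t>1. f t = 0) \<and>
     (\<forall>\<theta>. 0 < \<theta> \<longrightarrow> \<theta> \<le> 1 \<longrightarrow> (LINT t|unit_lborel. f (t / \<theta>) * y t) = 0)}"

lemma dilation_orth_L2: "f \<in> dilation_orth y \<Longrightarrow> f \<in> L2_space unit_lborel"
  by (rule quarter_bounded_L2) (auto simp: dilation_orth_def quarter_bounded_def)

lemma dilation_quarter_bound:
  assumes C: "\<And>t. t > 0 \<Longrightarrow> cmod (f t) \<le> C * t powr (- (1/4))" and "0 < \<theta>" "0 < t"
  shows "cmod (f (t / \<theta>)) \<le> C * (\<theta> powr (1/4) * t powr (- (1/4)))"
proof -
  have "(t / \<theta>) powr (- (1/4)) = \<theta> powr (1/4) * t powr (- (1/4))"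
    using assms by (simp add: powr_divide powr_minus field_simps)
  thus ?thesis using C[of "t / \<theta>"] assms by simp
qed

lemma dilation_orth_lin:
  assumes f: "f \<in> dilation_orth y" and g: "g \<in> dilation_orth y" and y: "y \<in> L2_space unit_lborel"
  shows "(\<lambda>t. c * f t + d * g t) \<in> dilation_orth y"
proof -
  obtain C D where fm: "f \<in> borel_measurable borel" and gm: "g \<in> borel_measurable borel"
    and C: "\<And>t. t > 0 \<Longrightarrow> cmod (f t) \<le> C * t powr (- (1/4))"
    and D: "\<And>t. t > 0 \<Longrightarrow> cmod (g t) \<le> D * t powr (- (1/4))"
    and z: "\<And>t. t > 1 \<Longrightarrow> f t = 0" "\<And>t. t > 1 \<Longrightarrow> g t = 0"
    and o: "\<And>\<theta>. 0 < \<theta> \<Longrightarrow> \<theta> \<le> 1 \<Longrightarrow> (LINT t|unit_lborel. f (t / \<theta>) * y t) = 0"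
       "\<And>\<theta>. 0 < \<theta> \<Longrightarrow> \<theta> \<le> 1 \<Longrightarrow> (LINT t|unit_lborel. g (t / \<theta>) * y t) = 0"
    using f g unfolding dilation_orth_def by blast
  note [measurable] = fm gm
  have i: "integrable unit_lborel (\<lambda>t. f (t / \<theta>) * y t)" "integrable unit_lborel (\<lambda>t. g (t / \<theta>) * y t)" if "0 < \<theta>" for \<theta>
  proof -
    have "(\<lambda>t. f (t / \<theta>)) \<in> quarter_bounded" unfolding quarter_bounded_def
      using dilation_quarter_bound[OF C that] by (auto intro!: exI[of _ "C * \<theta> powr (1/4)"] simp: mult_ac)
    moreover have "(\<lambda>t. g (t / \<theta>)) \<in> quarter_bounded" unfolding quarter_bounded_def
      using dilation_quarter_bound[OF D that] by (auto intro!: exI[of _ "D * \<theta> powr (1/4)"] simp: mult_ac)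
    ultimately show "integrable unit_lborel (\<lambda>t. f (t / \<theta>) * y t)" "integrable unit_lborel (\<lambda>t. g (t / \<theta>) * y t)"
      using y by (auto intro: L2_mult_integrable quarter_bounded_L2)
  qed
  show ?thesis unfolding dilation_orth_def
  proof (intro CollectI conjI allI impI exI)
    show "(\<lambda>t. c * f t + d * g t) \<in> borel_measurable borel" by measurable
    show "cmod (c * f t + d * g t) \<le> (cmod c * C + cmod d * D) * t powr (- (1/4))" if "t > 0" for t
    proof -
      have "cmod (c * f t + d * g t) \<le> cmod c * cmod (f t) + cmod d * cmod (g t)"
        using norm_triangle_ineq[of "c * f t" "d * g t"] by (simp add: norm_mult)
      also have "\<dots> \<le> cmod c * (C * t powr (- (1/4))) + cmod d * (D * t powr (- (1/4)))"
        using C D that by (intro add_mono mult_left_mono) auto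
      finally show ?thesis by (simp add: algebra_simps)
    qed
    show "c * f t + d * g t = 0" if "t > 1" for t using z that by simp
    show "(LINT t|unit_lborel. (c * f (t / \<theta>) + d * g (t / \<theta>)) * y t) = 0" if "0 < \<theta>" "\<theta> \<le> 1" for \<theta>
    proof -
      have "(LINT t|unit_lborel. (c * f (t / \<theta>) + d * g (t / \<theta>)) * y t) =
        (LINT t|unit_lborel. c * (f (t / \<theta>) * y t) + d * (g (t / \<theta>) * y t))"
        by (intro Bochner_Integration.integral_cong refl) (simp add: algebra_simps)
      also have "\<dots> = 0" using i[OF that(1)] o[OF that]
        by (subst Bochner_Integration.integral_add) auto
      finally show ?thesis .
    qed
  qed
qed

lemma dilation_orth_average:
  fixes k :: "real \<Rightarrow> real \<Rightarrow> complex"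
  assumes meas: "(\<lambda>(a, t). k a t) \<in> borel_measurable (borel \<Otimes>\<^sub>M borel)"
    and bound: "\<And>a t. 0 < a \<Longrightarrow> a < 1 \<Longrightarrow> 0 < t \<Longrightarrow> cmod (k a t) \<le> C * (a powr (1/4) * t powr (- (1/4)))"
    and supp: "\<And>a t. 0 < a \<Longrightarrow> a < 1 \<Longrightarrow> t > 1 \<Longrightarrow> k a t = 0"
    and orth: "\<And>a \<theta>. 0 < a \<Longrightarrow> a < 1 \<Longrightarrow> 0 < \<theta> \<Longrightarrow> \<theta> \<le> 1 \<Longrightarrow> (LINT t|unit_lborel. k a (t / \<theta>) * y t) = 0"
    and y: "y \<in> L2_space unit_lborel"
  shows "(\<lambda>t. LINT a|unit_lborel. k a t / of_real a) \<in> dilation_orth y" (is "?K \<in> _")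
  unfolding dilation_orth_def
proof (intro CollectI conjI allI impI exI)
  show "?K \<in> borel_measurable borel" by (rule averaged_kernel_measurable[OF meas bound])
  show "cmod (?K t) \<le> 4 * C * t powr (- (1/4))" if "0 < t" for t
    by (rule averaged_kernel_bound[OF meas bound that])
  show "?K t = 0" if "t > 1" for t
  proof -
    have "?K t = (LINT a|unit_lborel. 0)"
      by (intro Bochner_Integration.integral_cong refl) (use that supp in simp)
    thus ?thesis by simp
  qed
  fix \<theta> :: real assume \<theta>: "0 < \<theta>" "\<theta> \<le> 1"
  have meas': "(\<lambda>(a, t). k a (t / \<theta>)) \<in> borel_measurable (borel \<Otimes>\<^sub>M borel)"
    using measurable_compose[OF _ meas, of "\<lambda>p. (fst p, snd p / \<theta>)" "borel \<Otimes>\<^sub>M borel"]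
    by (simp add: case_prod_beta')
  have bound': "cmod (k a (t / \<theta>)) \<le> (C * \<theta> powr (1/4)) * (a powr (1/4) * t powr (- (1/4)))"
    if "0 < a" "a < 1" "0 < t" for a t
    using dilation_quarter_bound[of "k a" "C * a powr (1/4)" \<theta> t] bound[OF that(1,2)] \<theta> that by (simp add: mult_ac)
  have "(LINT t|unit_lborel. (LINT a|unit_lborel. k a (t / \<theta>) / of_real a) * y t) =
      (LINT a|unit_lborel. (LINT t|unit_lborel. k a (t / \<theta>) * y t) / of_real a)"
    by (rule averaged_kernel_Fubini[OF meas' bound' y])
  also have "\<dots> = (LINT a|unit_lborel. 0)"
    by (intro Bochner_Integration.integral_cong refl) (use orth \<theta> in simp)
  finally show "(LINT t|unit_lborel. ?K (t / \<theta>) * y t) = 0" by simp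
qed

text \<open>Dilation by a multiplies the Mellin transform by a^s, and the integral of a^(s-1) over
  (0, 1) is 1/s = 1 - z. So the identity minus this operator acts as multiplication by z.\<close>

lemma dilation_orth_integral_operator:
  assumes f: "f \<in> dilation_orth y" and y: "y \<in> L2_space unit_lborel"
  shows "(\<lambda>t. LINT a|unit_lborel. f (t / a) / of_real a) \<in> dilation_orth y" (is "?V \<in> _")
    and "Re s > 1/2 \<Longrightarrow> mellin (\<lambda>t. LINT a|unit_lborel. f (t / a) / of_real a) s = mellin f s / s"
proof -
  obtain C where fm: "f \<in> borel_measurable borel"
    and C: "\<And>t. t > 0 \<Longrightarrow> cmod (f t) \<le> C * t powr (- (1/4))"
    and z: "\<And>t. t > 1 \<Longrightarrow> f t = 0"
    and o: "\<And>\<theta>. 0 < \<theta> \<Longrightarrow> \<theta> \<le> 1 \<Longrightarrow> (LINT t|unit_lborel. f (t / \<theta>) * y t) = 0"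
    using f unfolding dilation_orth_def by blast
  note [measurable] = fm
  have meas: "(\<lambda>(a, t). f (t / a)) \<in> borel_measurable (borel \<Otimes>\<^sub>M borel)"
    by (simp add: case_prod_beta')
  have bound: "cmod (f (t / a)) \<le> C * (a powr (1/4) * t powr (- (1/4)))" if "0 < a" "a < 1" "0 < t" for a t
    by (rule dilation_quarter_bound[OF C]) (use that in auto)
  show "?V \<in> dilation_orth y"
  proof (rule dilation_orth_average[OF meas bound _ _ y])
    show "f (t / a) = 0" if "0 < a" "a < 1" "t > 1" for a t
      using that by (intro z) (simp add: field_simps)
    show "(LINT t|unit_lborel. f (t / \<theta> / a) * y t) = 0" if "0 < a" "a < 1" "0 < \<theta>" "\<theta> \<le> 1" for a \<theta>
    proof -
      have "\<theta> * a \<le> 1" using that by (simp add: mult_le_one)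
      thus ?thesis using o[of "\<theta> * a"] that by simp
    qed
  qed
  assume s: "Re s > 1/2"
  hence s0: "s \<noteq> 0" by auto
  have "mellin ?V s = (LINT a|unit_lborel. (LINT t|unit_lborel. f (t / a) * of_real t powr (s - 1)) / of_real a)"
    unfolding mellin_def by (rule averaged_kernel_Fubini[OF meas bound powr_kernel_L2(1)[OF s]])
  also have "\<dots> = (LINT a|unit_lborel. mellin f s * (of_real (ln a) ^ 0 * of_real a powr (s - 1)))"
  proof (intro Bochner_Integration.integral_cong refl)
    fix a assume "a \<in> space unit_lborel"
    hence a: "0 < a" "a < 1" by auto
    have "(LINT t|unit_lborel. f (t / a) * of_real t powr (s - 1)) = of_real a powr s * mellin f s"
      using mellin_dilation[OF fm z, of a s] a by (simp add: mellin_def)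
    thus "(LINT t|unit_lborel. f (t / a) * of_real t powr (s - 1)) / of_real a = mellin f s * (of_real (ln a) ^ 0 * of_real a powr (s - 1))"
      using a by (simp add: powr_diff)
  qed
  also have "\<dots> = mellin f s * mellin (\<lambda>t. of_real (ln t) ^ 0) s" by (simp add: mellin_def)
  also have "\<dots> = mellin f s / s" using mellin_ln_power[OF s, of 0] by simp
  finally show "mellin ?V s = mellin f s / s" .
qed

section \<open>Mellin transforms of floor functions and of \<open>rho\<close>\<close>

lemma mellin_cutoff:
  assumes b: "0 < b" "b \<le> 1" and s: "Re s > 1/2"
  shows "integrable unit_lborel (\<lambda>t. of_bool (t \<le> b) * of_real t powr (s - 1))"
    and "mellin (\<lambda>t. of_bool (t \<le> b)) s = of_real b powr s / s"
    and "(LINT t|unit_lborel. norm (of_bool (t \<le> b) * of_real t powr (s - 1))) = b powr Re s / Re s"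
proof -
  have qb: "(\<lambda>t. of_bool (t \<le> b)) \<in> quarter_bounded"
  proof -
    have "1 \<le> t powr (- (1/4))" if "0 < t" "t < 1" for t :: real
      using powr_mono'[of "- (1/4)" 0 t] that by simp
    hence "cmod (of_bool (t \<le> b)) \<le> 1 * t powr (- (1/4))" if "0 < t" "t < 1" for t :: real
      using that by (auto intro: order_trans[OF _ \<open>\<And>t. 0 < t \<Longrightarrow> t < 1 \<Longrightarrow> 1 \<le> t powr (- (1/4))\<close>])
    thus ?thesis unfolding quarter_bounded_def by (intro CollectI conjI) (measurable, blast)
  qed
  show "integrable unit_lborel (\<lambda>t. of_bool (t \<le> b) * of_real t powr (s - 1))"
    by (rule mellin_integrable[OF quarter_bounded_L2[OF qb] s])
  have *: "mellin (\<lambda>t. of_bool (t \<le> b)) s = of_real b powr s / s" if s: "Re s > 1/2" for s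
  proof -
    have "mellin (\<lambda>t. of_bool (t \<le> b)) s = mellin (\<lambda>t. (\<lambda>u. of_bool (u \<le> 1)) (t / b)) s"
      using b by (simp add: divide_le_eq)
    also have "\<dots> = of_real b powr s * mellin (\<lambda>u. of_bool (u \<le> 1)) s"
      by (rule mellin_dilation) (use b in auto)
    also have "mellin (\<lambda>u. of_bool (u \<le> 1)) s = mellin (\<lambda>t. of_real (ln t) ^ 0) s"
      unfolding mellin_def by (intro Bochner_Integration.integral_cong refl) auto
    also have "\<dots> = 1 / s" using mellin_ln_power[OF s, of 0] by simp
    finally show ?thesis by simp
  qed
  from *[OF s] show "mellin (\<lambda>t. of_bool (t \<le> b)) s = of_real b powr s / s" .
  define \<sigma> where "\<sigma> = Re s"
  have \<sigma>: "Re (of_real \<sigma> :: complex) > 1/2" using s by (simp add: \<sigma>_def)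
  have "complex_of_real (LINT t|unit_lborel. norm (of_bool (t \<le> b) * of_real t powr (s - 1))) =
      (LINT t|unit_lborel. of_real (norm (of_bool (t \<le> b) * of_real t powr (s - 1))))"
    by (rule integral_complex_of_real[symmetric])
  also have "\<dots> = mellin (\<lambda>t. of_bool (t \<le> b)) (of_real \<sigma>)"
    unfolding mellin_def
  proof (intro Bochner_Integration.integral_cong refl)
    fix t assume "t \<in> space unit_lborel"
    hence t: "0 < t" by simp
    have "complex_of_real (t powr (\<sigma> - 1)) = of_real t powr (of_real \<sigma> - 1)"
      using t powr_of_real[of t "\<sigma> - 1"] by simp
    thus "complex_of_real (norm (of_bool (t \<le> b) * of_real t powr (s - 1))) = of_bool (t \<le> b) * of_real t powr (of_real \<sigma> - 1)"
      using t cmod_powr_kernel[OF t, of "s - 1"] by (auto simp: \<sigma>_def)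
  qed
  also have "\<dots> = of_real (b powr \<sigma> / \<sigma>)"
    using *[OF \<sigma>] b powr_of_real[of b \<sigma>] by simp
  finally show "(LINT t|unit_lborel. norm (of_bool (t \<le> b) * of_real t powr (s - 1))) = b powr Re s / Re s"
    unfolding of_real_eq_iff \<sigma>_def .
qed

lemma floor_sums:
  assumes "x \<ge> 0" shows "(\<lambda>n. of_bool (real (Suc n) \<le> x)) sums (of_int \<lfloor>x\<rfloor> :: complex)"
    and "finite {n. real (Suc n) \<le> x}"
proof -
  have eq: "{n. real (Suc n) \<le> x} = {..<nat \<lfloor>x\<rfloor>}"
  proof -
    have "real (Suc n) \<le> x \<longleftrightarrow> n < nat \<lfloor>x\<rfloor>" for n
      using assms by linarith
    thus ?thesis by auto
  qed
  show fin: "finite {n. real (Suc n) \<le> x}" by (simp only: eq finite_lessThan)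
  have "(\<lambda>n. if n \<in> {n. real (Suc n) \<le> x} then 1 else 0 :: complex) sums (\<Sum>n\<in>{n. real (Suc n) \<le> x}. 1)"
    by (rule sums_If_finite_set[OF fin])
  also have "(\<Sum>n\<in>{n. real (Suc n) \<le> x}. 1 :: complex) = of_nat (nat \<lfloor>x\<rfloor>)"
    by (simp only: eq sum_constant card_lessThan mult_1_right)
  also have "\<dots> = of_int \<lfloor>x\<rfloor>" using assms by simp
  finally show "(\<lambda>n. of_bool (real (Suc n) \<le> x)) sums (of_int \<lfloor>x\<rfloor> :: complex)"
    by (simp add: of_bool_def)
qed

text \<open>The floor of a/t counts the n >= 1 with t <= a/n, and the integral is taken term by
  term. Absolute convergence confines this to Re s > 1; the formulas built on it are continued
  analytically in \<open>disc_transform_eqI\<close>.\<close>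

lemma mellin_floor:
  assumes a: "0 < a" "a \<le> 1" and s: "Re s > 1"
  shows "integrable unit_lborel (\<lambda>t. of_int \<lfloor>a / t\<rfloor> * of_real t powr (s - 1))"
    and "mellin (\<lambda>t. of_int \<lfloor>a / t\<rfloor>) s = of_real a powr s * zeta_series s / s"
proof -
  define b where "b = (\<lambda>n. a / real (Suc n))"
  have b: "0 < b n" "b n \<le> 1" for n using a by (auto simp: b_def field_simps)
  have s': "Re s > 1/2" using s by simp
  define g where "g = (\<lambda>n t. of_bool (t \<le> b n) * complex_of_real t powr (s - 1))"
  have gi: "integrable unit_lborel (g n)" for n unfolding g_def by (rule mellin_cutoff(1)[OF b s'])
  have sums_g: "(\<lambda>n. g n t) sums (of_int \<lfloor>a / t\<rfloor> * of_real t powr (s - 1))" if t: "0 < t" for t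
  proof -
    have "(\<lambda>n. of_bool (real (Suc n) \<le> a / t) * complex_of_real t powr (s - 1)) sums (of_int \<lfloor>a / t\<rfloor> * of_real t powr (s - 1))"
      by (intro sums_mult2 floor_sums) (use a t in auto)
    moreover have "real (Suc n) \<le> a / t \<longleftrightarrow> t \<le> b n" for n
      unfolding b_def using t by (simp add: field_simps)
    ultimately show ?thesis by (simp add: g_def)
  qed
  have summ: "AE t in unit_lborel. summable (\<lambda>n. norm (g n t))"
  proof (rule AE_unit_lborelI)
    fix t :: real assume t: "0 < t"
    have "real (Suc n) \<le> a / t \<longleftrightarrow> t \<le> b n" for n
      unfolding b_def using t by (simp add: field_simps)
    hence "finite {n. t \<le> b n}" using floor_sums(2)[of "a / t"] a t by simp
    thus "summable (\<lambda>n. norm (g n t))"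
      by (rule summable_finite) (simp add: g_def)
  qed
  have "summable (\<lambda>n. LINT t|unit_lborel. norm (g n t))"
  proof -
    have "(LINT t|unit_lborel. norm (g n t)) = (a powr Re s / Re s) * real (Suc n) powr (- Re s)" for n
    proof -
      have "(LINT t|unit_lborel. norm (g n t)) = b n powr Re s / Re s"
        unfolding g_def by (rule mellin_cutoff(3)[OF b s'])
      thus ?thesis using a by (simp add: b_def powr_divide powr_minus field_simps)
    qed
    thus ?thesis using s by (simp only:) (intro summable_mult summable_powr_Suc)
  qed
  note summ' = this
  have eq: "(\<Sum>n. g n t) = of_int \<lfloor>a / t\<rfloor> * of_real t powr (s - 1)" if "t \<in> space unit_lborel" for t
    using sums_g[of t] that by (simp add: sums_iff)
  have "integrable unit_lborel (\<lambda>t. \<Sum>n. g n t)"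
    by (rule integrable_suminf[OF gi summ summ'])
  also have "?this \<longleftrightarrow> integrable unit_lborel (\<lambda>t. of_int \<lfloor>a / t\<rfloor> * of_real t powr (s - 1))"
    by (intro Bochner_Integration.integrable_cong refl eq)
  finally show "integrable unit_lborel (\<lambda>t. of_int \<lfloor>a / t\<rfloor> * of_real t powr (s - 1))" .
  have "(\<lambda>n. integral\<^sup>L unit_lborel (g n)) sums (LINT t|unit_lborel. (\<Sum>n. g n t))"
    by (rule sums_integral[OF gi summ summ'])
  also have "(LINT t|unit_lborel. (\<Sum>n. g n t)) = mellin (\<lambda>t. of_int \<lfloor>a / t\<rfloor>) s"
    unfolding mellin_def by (intro Bochner_Integration.integral_cong refl eq)
  finally have gs: "(\<lambda>n. integral\<^sup>L unit_lborel (g n)) sums mellin (\<lambda>t. of_int \<lfloor>a / t\<rfloor>) s" .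
  have gn: "integral\<^sup>L unit_lborel (g n) = of_real a powr s / s * (1 / of_nat (Suc n) powr s)" for n
  proof -
    have "integral\<^sup>L unit_lborel (g n) = mellin (\<lambda>t. of_bool (t \<le> b n)) s" by (simp add: mellin_def g_def[abs_def])
    also have "\<dots> = of_real (b n) powr s / s" by (rule mellin_cutoff(2)[OF b s'])
    also have "(of_real (b n) :: complex) powr s = of_real a powr s / of_nat (Suc n) powr s"
    proof -
      have "(of_real (b n * real (Suc n)) :: complex) powr s = of_real (b n) powr s * of_real (real (Suc n)) powr s"
        unfolding of_real_mult by (rule powr_times_real) (use b[of n] in \<open>auto simp: less_imp_le\<close>)
      moreover have "b n * real (Suc n) = a" by (simp add: b_def)
      ultimately show ?thesis by (simp add: nonzero_eq_divide_eq del: of_nat_Suc)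
    qed
    finally show ?thesis by simp
  qed
  have "(\<lambda>n. of_real a powr s / s * (1 / of_nat (Suc n) powr s)) sums mellin (\<lambda>t. of_int \<lfloor>a / t\<rfloor>) s"
    using gs unfolding gn .
  moreover have "(\<lambda>n. of_real a powr s / s * (1 / of_nat (Suc n) powr s)) sums (of_real a powr s / s * zeta_series s)"
    by (intro sums_mult zeta_series_sums s)
  ultimately show "mellin (\<lambda>t. of_int \<lfloor>a / t\<rfloor>) s = of_real a powr s * zeta_series s / s"
    using sums_unique2 by fastforce
qed

text \<open>The linear parts a/t of the two fractional parts cancel.\<close>

lemma rho_eq_floor: "t \<noteq> 0 \<Longrightarrow> rho a t = of_real a * of_int \<lfloor>1 / t\<rfloor> - of_int \<lfloor>a / t\<rfloor>"
proof -
  assume "t \<noteq> 0"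
  have "frac (a / t) - a * frac (1 / t) = a * of_int \<lfloor>1 / t\<rfloor> - of_int \<lfloor>a / t\<rfloor>"
    by (simp add: frac_def algebra_simps)
  hence "rho a t = of_real (a * of_int \<lfloor>1 / t\<rfloor> - of_int \<lfloor>a / t\<rfloor>)" unfolding rho_def by (rule arg_cong)
  thus ?thesis by simp
qed

lemma mellin_rho:
  assumes a: "0 < a" "a \<le> 1" and s: "Re s > 1"
  shows "mellin (rho a) s = (of_real a - of_real a powr s) * zeta_series s / s"
proof -
  have s0: "s \<noteq> 0" using s by auto
  have "mellin (rho a) s = (LINT t|unit_lborel. of_real a * (of_int \<lfloor>1 / t\<rfloor> * of_real t powr (s - 1)) - of_int \<lfloor>a / t\<rfloor> * of_real t powr (s - 1))"
    unfolding mellin_def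
    by (intro Bochner_Integration.integral_cong refl) (simp add: rho_eq_floor algebra_simps)
  also have "\<dots> = of_real a * mellin (\<lambda>t. of_int \<lfloor>1 / t\<rfloor>) s - mellin (\<lambda>t. of_int \<lfloor>a / t\<rfloor>) s"
    using mellin_floor(1)[OF a s] mellin_floor(1)[of 1 s] s
    by (subst Bochner_Integration.integral_diff) (auto simp: mellin_def)
  also have "\<dots> = (of_real a - of_real a powr s) * zeta_series s / s"
    using mellin_floor(2)[OF a s] mellin_floor(2)[of 1 s] s by (simp add: algebra_simps diff_divide_distrib)
  finally show ?thesis .
qed

lemma frac_le_self: "x \<ge> 0 \<Longrightarrow> frac x \<le> (x :: real)"
  by (simp add: frac_def)

lemma rho_supp: assumes "0 \<le> a" "a \<le> 1" "t > 1" shows "rho a t = 0"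
proof -
  have "frac (a / t) = a / t" "frac (1 / t) = 1 / t" using assms by (auto simp: frac_eq divide_less_eq)
  thus ?thesis by (simp add: rho_def)
qed

text \<open>With x = a/t the modulus is at most min(1, x), which is at most x^(1/4).\<close>

lemma rho_bound:
  assumes a: "0 < a" "a \<le> 1" and t: "0 < t"
  shows "cmod (rho a t) \<le> a powr (1/4) * t powr (- (1/4))"
proof -
  define x where "x = a / t"
  have x: "x > 0" using a t by (simp add: x_def)
  have f1: "frac x \<ge> 0" "frac x \<le> x" "frac x \<le> 1" using x frac_le_self[of x] frac_lt_1[of x] by auto
  have f2: "a * frac (1 / t) \<ge> 0" "a * frac (1 / t) \<le> x" "a * frac (1 / t) \<le> 1"
  proof -
    show "a * frac (1 / t) \<ge> 0" using a by simp
    have "a * frac (1 / t) \<le> a * (1 / t)" using a t by (intro mult_left_mono frac_le_self) auto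
    thus "a * frac (1 / t) \<le> x" by (simp add: x_def)
    have "a * frac (1 / t) \<le> 1 * 1" using a frac_lt_1[of "1 / t"] by (intro mult_mono) auto
    thus "a * frac (1 / t) \<le> 1" by simp
  qed
  have "cmod (rho a t) = \<bar>frac x - a * frac (1 / t)\<bar>" unfolding rho_def norm_of_real x_def ..
  also have "\<dots> \<le> min 1 x"
  proof -
    have "\<bar>frac x - a * frac (1 / t)\<bar> \<le> 1" "\<bar>frac x - a * frac (1 / t)\<bar> \<le> x" using f1 f2 by linarith+
    thus ?thesis by simp
  qed
  also have "\<dots> \<le> x powr (1/4)"
  proof (cases "x \<le> 1")
    case True
    have "x powr 1 \<le> x powr (1/4)" using x True by (intro powr_mono') auto
    thus ?thesis using x True by simp
  next
    case False
    thus ?thesis using ge_one_powr_ge_zero[of x "1/4"] by simp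
  qed
  also have "x powr (1/4) = a powr (1/4) * t powr (- (1/4))"
    using a t by (simp add: x_def powr_divide powr_minus field_simps)
  finally show ?thesis .
qed

lemma rho_measurable: "(\<lambda>(a, t). rho a t) \<in> borel_measurable (borel \<Otimes>\<^sub>M borel)"
  unfolding rho_def frac_def by measurable

lemma rho_measurable_borel: "rho a \<in> borel_measurable borel"
  unfolding rho_def[abs_def] frac_def by measurable

lemma rho_L2: assumes "0 < a" "a \<le> 1" shows "rho a \<in> L2_space unit_lborel"
  using rho_bound[OF assms] rho_measurable_borel
  by (intro quarter_bounded_L2) (auto simp: quarter_bounded_def)

text \<open>The two multiples of the fractional part of 1/t cancel. For 0 < \<theta> <= 1 the dilate
  thus stays in the span of the functions \<open>rho\<close>, which is the source of the dilation
  invariance.\<close>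

lemma rho_dilate: "\<theta> \<noteq> 0 \<Longrightarrow> rho a (t / \<theta>) = rho (a * \<theta>) t - of_real a * rho \<theta> t"
  unfolding rho_def by (simp add: algebra_simps)

lemma rho_1: "rho 1 t = 0"
  by (simp add: rho_def)

text \<open>Dividing the factor a - a^s of the transform by a and integrating leaves 1 -
  1/s.\<close>

definition rho_average :: "real \<Rightarrow> complex" where
  "rho_average t = (LINT a|unit_lborel. rho a t / of_real a)"

lemma rho_average_dilation_orth:
  assumes y: "y \<in> L2_space unit_lborel"
    and orth: "\<And>a. 0 < a \<Longrightarrow> a < 1 \<Longrightarrow> (LINT t|unit_lborel. rho a t * y t) = 0"
  shows "rho_average \<in> dilation_orth y"
  unfolding rho_average_def[abs_def]
proof (rule dilation_orth_average[OF rho_measurable, where C = 1])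
  have orth': "(LINT t|unit_lborel. rho a t * y t) = 0" if "0 < a" "a \<le> 1" for a
    using orth[of a] that by (cases "a = 1") (auto simp: rho_1)
  show "(LINT t|unit_lborel. rho a (t / \<theta>) * y t) = 0" if a: "0 < a" "a < 1" and \<theta>: "0 < \<theta>" "\<theta> \<le> 1" for a \<theta>
  proof -
    have a\<theta>: "0 < a * \<theta>" "a * \<theta> \<le> 1" using a \<theta> by (auto simp: mult_le_one)
    have "(LINT t|unit_lborel. rho a (t / \<theta>) * y t) = (LINT t|unit_lborel. rho (a * \<theta>) t * y t - of_real a * (rho \<theta> t * y t))"
      by (intro Bochner_Integration.integral_cong refl) (use \<theta> in \<open>simp add: rho_dilate algebra_simps\<close>)
    also have "\<dots> = 0"
      using orth'[OF a\<theta>] orth'[OF \<theta>] L2_mult_integrable[OF rho_L2[OF a\<theta>] y] L2_mult_integrable[OF rho_L2[OF \<theta>] y]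
      by (subst Bochner_Integration.integral_diff) auto
    finally show ?thesis .
  qed
qed (use rho_bound rho_supp y in auto)

lemma mellin_rho_average:
  assumes s: "Re s > 1"
  shows "mellin rho_average s = zeta_series s * (1 - 1 / s) / s"
proof -
  have s': "Re s > 1/2" and s0: "s \<noteq> 0" using s by auto
  have "mellin rho_average s = (LINT a|unit_lborel. (LINT t|unit_lborel. rho a t * of_real t powr (s - 1)) / of_real a)"
    unfolding mellin_def rho_average_def
    by (rule averaged_kernel_Fubini[OF rho_measurable _ powr_kernel_L2(1)[OF s'], where C = 1]) (use rho_bound in simp)
  also have "\<dots> = (LINT a|unit_lborel. zeta_series s / s * (1 - of_real a powr (s - 1)))"
  proof (intro Bochner_Integration.integral_cong refl)
    fix a assume "a \<in> space unit_lborel"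
    hence a: "0 < a" "a < 1" by auto
    have "(LINT t|unit_lborel. rho a t * of_real t powr (s - 1)) = (of_real a - of_real a powr s) * zeta_series s / s"
      using mellin_rho[of a s] a s by (simp add: mellin_def)
    moreover have "of_real a powr s = of_real a * (of_real a powr (s - 1) :: complex)"
      using a by (simp add: powr_diff)
    ultimately show "(LINT t|unit_lborel. rho a t * of_real t powr (s - 1)) / of_real a = zeta_series s / s * (1 - of_real a powr (s - 1))"
      using a s0 by (simp add: field_simps)
  qed
  also have "\<dots> = zeta_series s / s * (LINT a|unit_lborel. 1 - of_real a powr (s - 1))"
    by (rule integral_mult_right_zero)
  also have "(LINT a|unit_lborel. 1 - complex_of_real a powr (s - 1)) =
      (LINT a|unit_lborel. 1) - mellin (\<lambda>t. of_real (ln t) ^ 0) s"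
    using L2_integrable[OF powr_kernel_L2(1)[OF s']]
    by (subst Bochner_Integration.integral_diff) (auto simp: mellin_def)
  also have "(LINT a|unit_lborel. 1 :: complex) = 1"
    using emeasure_unit_lborel by (simp add: measure_def)
  also have "mellin (\<lambda>t. of_real (ln t) ^ 0) s = 1 / s" using mellin_ln_power[OF s', of 0] by simp
  finally show ?thesis by simp
qed

section \<open>The norm of the projection\<close>

text \<open>At \<open>z = 1\<close> the junk value \<open>1 / 0 = 0\<close> yields \<open>zeta_disc 3 1 = 0\<close>, which is the limit of
  \<open>zeta_disc 3\<close> there.\<close>

definition zeta_disc :: "nat \<Rightarrow> complex \<Rightarrow> complex" where
  "zeta_disc k z = zeta_reg (1 / (1 - z)) * (1 - z) ^ k"

lemma zeta_disc_holomorphic: "zeta_disc k holomorphic_on - {1}"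
proof -
  have "(zeta_reg \<circ> (\<lambda>z. 1 / (1 - z))) holomorphic_on - {1}"
    by (intro holomorphic_on_compose_gen[OF _ zeta_reg_holomorphic] holomorphic_intros) auto
  hence "(\<lambda>z. zeta_reg (1 / (1 - z))) holomorphic_on - {1}" by (simp add: o_def)
  thus ?thesis unfolding zeta_disc_def[abs_def] by (intro holomorphic_intros)
qed

lemma zeta_disc_holomorphic_ball: "zeta_disc k holomorphic_on ball 0 1"
  by (rule holomorphic_on_subset[OF zeta_disc_holomorphic]) auto

lemma zeta_disc_0 [simp]: "zeta_disc k 0 = 1"
  by (simp add: zeta_disc_def zeta_reg_def)

section \<open>Zeros of zeta as points of the disc\<close>

definition to_disc :: "complex \<Rightarrow> complex" where
  "to_disc \<rho> = 1 - 1 / \<rho>"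

lemma Re_gt_half_norm: "Re \<rho> > 1/2 \<Longrightarrow> cmod (1 - \<rho>) < cmod \<rho>"
proof -
  assume "Re \<rho> > 1/2"
  hence "(cmod (1 - \<rho>))\<^sup>2 < (cmod \<rho>)\<^sup>2" unfolding cmod_power2 by (simp add: power2_eq_square algebra_simps)
  thus ?thesis by (rule power2_less_imp_less) simp
qed

lemma zeta_zeros_right_nonzero: "\<rho> \<in> zeta_zeros_right \<Longrightarrow> \<rho> \<noteq> 0"
  by (auto simp: zeta_zeros_right_def)

lemma cmod_to_disc: "\<rho> \<noteq> 0 \<Longrightarrow> cmod (to_disc \<rho>) = cmod ((1 - \<rho>) / \<rho>)"
proof -
  assume "\<rho> \<noteq> 0"
  hence "to_disc \<rho> = - ((1 - \<rho>) / \<rho>)" by (simp add: to_disc_def field_simps)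
  thus ?thesis by (simp only: norm_minus_cancel)
qed

lemma to_disc_in_ball: assumes "\<rho> \<in> zeta_zeros_right" shows "cmod (to_disc \<rho>) < 1"
proof -
  have "\<rho> \<noteq> 0" "cmod (1 - \<rho>) < cmod \<rho>"
    using assms Re_gt_half_norm[of \<rho>] by (auto simp: zeta_zeros_right_def)
  thus ?thesis by (simp add: cmod_to_disc norm_divide)
qed

lemma inj_on_to_disc: "inj_on to_disc A"
  by (auto simp: inj_on_def to_disc_def divide_inverse)

lemma zeta_disc_zero:
  assumes "cmod z < 1" "zeta_disc k z = 0"
  obtains \<rho> where "\<rho> \<in> zeta_zeros_right" "z = to_disc \<rho>"
proof
  have z1: "z \<noteq> 1" using assms by auto
  have "zeta_reg (1 / (1 - z)) = 0" using assms z1 by (simp add: zeta_disc_def)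
  thus "1 / (1 - z) \<in> zeta_zeros_right" using zeta_reg_zeros Re_inverse_gt_half assms(1) by blast
  show "z = to_disc (1 / (1 - z))" by (simp add: to_disc_def)
qed

text \<open>For \<phi> z = 1 / (1 - z) one has \<phi> z - \<rho> = \<rho> / (1 - z) * (z - w), so
  the change of variable multiplies the linear factor by a nonvanishing one.\<close>

lemma zorder_zeta_disc:
  assumes \<rho>: "\<rho> \<in> zeta_zeros_right"
  shows "zorder (zeta_disc k) (to_disc \<rho>) = zorder riemann_zeta \<rho>"
proof -
  define w where "w = to_disc \<rho>"
  have \<rho>0: "\<rho> \<noteq> 0" by (rule zeta_zeros_right_nonzero[OF \<rho>])
  have w1: "w \<noteq> 1" "1 - w \<noteq> 0" "\<rho> = 1 / (1 - w)" using \<rho>0 by (auto simp: w_def to_disc_def)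
  have "zeta_reg 1 \<noteq> 0" by (simp add: zeta_reg_def)
  hence ex: "\<exists>w\<in>UNIV. zeta_reg w \<noteq> 0" by blast
  define n where "n = nat (zorder zeta_reg \<rho>)"
  from zorder_exist_zero[OF zeta_reg_holomorphic open_UNIV connected_UNIV UNIV_I ex, of \<rho>] obtain r p where
    r: "r > 0" and p: "p holomorphic_on cball \<rho> r"
    "\<And>w. w \<in> cball \<rho> r \<Longrightarrow> zeta_reg w = p w * (w - \<rho>) ^ n \<and> p w \<noteq> 0"
    unfolding n_def by blast
  have zo: "zorder zeta_reg \<rho> = int n"
    using zorder_exist_zero[OF zeta_reg_holomorphic open_UNIV connected_UNIV UNIV_I ex, of \<rho>]
    by (auto split: if_splits simp: n_def)
  define \<phi> where "\<phi> = (\<lambda>z::complex. 1 / (1 - z))"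
  define S where "S = (- {1}) \<inter> \<phi> -` ball \<rho> r"
  have "continuous_on (- {1}) \<phi>" unfolding \<phi>_def by (intro continuous_intros) auto
  hence openS: "open S" unfolding S_def by (intro continuous_open_preimage) auto
  have "zorder (zeta_disc k) w = int n"
  proof (rule zorder_eqI[OF openS])
    show "w \<in> S" using w1 r by (simp add: S_def \<phi>_def)
    define g where "g = (\<lambda>z. p (\<phi> z) * (\<rho> / (1 - z)) ^ n * (1 - z) ^ k)"
    have "(p \<circ> \<phi>) holomorphic_on S"
    proof (rule holomorphic_on_compose_gen[OF _ p(1)])
      show "\<phi> holomorphic_on S" unfolding \<phi>_def by (intro holomorphic_intros) (auto simp: S_def)
      show "\<phi> ` S \<subseteq> cball \<rho> r" by (auto simp: S_def)
    qed
    hence "(\<lambda>z. p (\<phi> z)) holomorphic_on S" by (simp add: o_def)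
    thus "g holomorphic_on S" unfolding g_def by (intro holomorphic_intros) (auto simp: S_def)
    show "g w \<noteq> 0" using p(2)[of \<rho>] r w1 \<rho>0 by (simp add: g_def \<phi>_def)
    fix z assume z: "z \<in> S" "z \<noteq> w"
    hence z1: "1 - z \<noteq> 0" by (auto simp: S_def)
    have "zeta_reg (\<phi> z) = p (\<phi> z) * (\<phi> z - \<rho>) ^ n" using p(2)[of "\<phi> z"] z by (auto simp: S_def)
    also have "\<phi> z - \<rho> = \<rho> / (1 - z) * (z - w)"
      unfolding w1(3) \<phi>_def using z1 w1(2) by (simp add: field_simps)
    finally show "zeta_disc k z = g z * (z - w) powi int n"
    proof -
      assume e: "zeta_reg (\<phi> z) = p (\<phi> z) * (\<rho> / (1 - z) * (z - w)) ^ n"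
      have "zeta_disc k z = zeta_reg (\<phi> z) * (1 - z) ^ k" by (simp only: zeta_disc_def \<phi>_def)
      thus ?thesis unfolding e g_def by (simp only: power_mult_distrib power_int_of_nat mult_ac)
    qed
  qed
  thus ?thesis using zorder_zeta_reg[OF \<rho>] zo by (simp add: w_def)
qed

abbreviation one_fun :: "real \<Rightarrow> complex" where "one_fun \<equiv> indicator {0<..1}"

lemma one_fun_L2: "one_fun \<in> L2_space unit_lborel"
proof -
  have "one_fun \<in> borel_measurable unit_lborel" by (intro measurable_unit_lborel) measurable
  moreover have "integrable unit_lborel (\<lambda>t. (cmod (one_fun t))\<^sup>2) \<longleftrightarrow> integrable unit_lborel (\<lambda>t. 1 :: real)"
    by (intro Bochner_Integration.integrable_cong refl) auto
  ultimately show ?thesis by (simp add: L2_space_def)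
qed

lemma inner_one_fun: "L2_inner unit_lborel f one_fun = disc_transform f 0"
  unfolding L2_inner_def disc_transform_def mellin_def
  by (simp, intro Bochner_Integration.integral_cong refl) auto

lemma disc_transform_lin:
  assumes "f \<in> L2_space unit_lborel" "g \<in> L2_space unit_lborel" "cmod z < 1"
  shows "disc_transform (\<lambda>t. c * f t + d * g t) z = c * disc_transform f z + d * disc_transform g z"
proof -
  have s: "Re (1 / (1 - z)) > 1/2" using Re_inverse_gt_half assms by blast
  have "mellin (\<lambda>t. c * f t + d * g t) (1 / (1 - z)) = c * mellin f (1 / (1 - z)) + d * mellin g (1 / (1 - z))"
    unfolding mellin_def using mellin_integrable[OF assms(1) s] mellin_integrable[OF assms(2) s]
    by (simp add: distrib_right mult.assoc)
  thus ?thesis by (simp add: disc_transform_def add_divide_distrib)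
qed

text \<open>Identities derived for Re s > 1 hold on a nonempty open part of the disc and spread by
  the identity theorem.\<close>

lemma disc_transform_eqI:
  assumes f: "f \<in> L2_space unit_lborel" and g: "g holomorphic_on ball 0 1"
    and eq: "\<And>s. Re s > 1 \<Longrightarrow> s * mellin f s = g (to_disc s)" and z: "cmod z < 1"
  shows "disc_transform f z = g z"
proof (rule analytic_continuation_open[where s = "ball 0 1 \<inter> (\<lambda>z. 1 / (1 - z)) -` {s. Re s > 1}" and s' = "ball 0 1"
      and f = "disc_transform f" and g = g])
  have "continuous_on (ball 0 1) (\<lambda>z::complex. 1 / (1 - z))" by (intro continuous_intros) auto
  thus "open (ball 0 1 \<inter> (\<lambda>z::complex. 1 / (1 - z)) -` {s. Re s > 1})"
    by (intro continuous_open_preimage open_halfspace_Re_gt) auto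
  have "1/2 \<in> ball 0 1 \<inter> (\<lambda>z::complex. 1 / (1 - z)) -` {s. Re s > 1}" by (simp add: norm_divide)
  thus "ball 0 1 \<inter> (\<lambda>z::complex. 1 / (1 - z)) -` {s. Re s > 1} \<noteq> {}" by blast
  show "disc_transform f z = g z" if "z \<in> ball 0 1 \<inter> (\<lambda>z. 1 / (1 - z)) -` {s. Re s > 1}" for z
  proof -
    have "1 / (1 - z) * mellin f (1 / (1 - z)) = g (to_disc (1 / (1 - z)))" using that by (intro eq) auto
    thus ?thesis by (simp add: disc_transform_def to_disc_def)
  qed
qed (use disc_transform_holomorphic[OF f] g z in auto)

lemma sub_mean_value:
  assumes H: "H holomorphic_on ball 0 1" and r: "0 < r" "r < 1"
  shows "(cmod (H 0))\<^sup>2 \<le> integral {0..1} (\<lambda>x. (cmod (H (of_real r * circ x)))\<^sup>2)"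
proof -
  \<comment> \<open>Rotates (H 0)^2 to its modulus; for \<open>H 0 = 0\<close> it is 0, so in
    general only |c| <= 1 is used.\<close>
  define c where "c = cnj (sgn ((H 0)\<^sup>2))"
  define L where "L = (\<lambda>z. c * (H z)\<^sup>2)"
  have "((\<lambda>x. Re (L (of_real r * circ x))) has_integral Re (L 0)) {0..1}"
    by (rule mean_value_Re[OF _ r]) (auto simp: L_def intro!: holomorphic_intros H)
  moreover have "(\<lambda>x. (cmod (H (of_real r * circ x)))\<^sup>2) integrable_on {0..1}"
    using r by (intro integrable_continuous_real continuous_intros
        continuous_on_compose2[OF holomorphic_on_imp_continuous_on[OF H]]) (auto simp: norm_mult)
  hence "((\<lambda>x. (cmod (H (of_real r * circ x)))\<^sup>2) has_integral
      integral {0..1} (\<lambda>x. (cmod (H (of_real r * circ x)))\<^sup>2)) {0..1}" by (rule integrable_integral)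
  ultimately have "Re (L 0) \<le> integral {0..1} (\<lambda>x. (cmod (H (of_real r * circ x)))\<^sup>2)"
  proof (rule has_integral_le)
    fix x
    have "cmod c \<le> 1" by (simp add: c_def norm_sgn)
    hence "cmod (L z) \<le> (cmod (H z))\<^sup>2" for z
      by (simp add: L_def norm_mult norm_power mult_left_le_one_le)
    thus "Re (L (of_real r * circ x)) \<le> (cmod (H (of_real r * circ x)))\<^sup>2"
      using complex_Re_le_cmod order_trans by blast
  qed
  moreover have "Re (L 0) = (cmod (H 0))\<^sup>2"
  proof -
    have "cnj (sgn u) * u = of_real (cmod u)" for u :: complex
    proof -
      have "cnj (sgn u) * u = (u * cnj u) / of_real (cmod u)" by (simp add: sgn_eq)
      also have "u * cnj u = of_real ((cmod u)\<^sup>2)" by (rule complex_norm_square[symmetric])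
      finally show ?thesis by (simp add: power2_eq_square)
    qed
    thus ?thesis by (simp add: L_def c_def norm_power)
  qed
  ultimately show ?thesis by simp
qed

section \<open>The upper bound for the norm of the projection\<close>

definition zero_prod :: "complex set \<Rightarrow> real" where
  "zero_prod F = (\<Prod>\<rho>\<in>F. cmod ((1 - \<rho>) / \<rho>) ^ nat (zorder riemann_zeta \<rho>))"

lemma zero_prod_nonneg: "zero_prod F \<ge> 0"
  unfolding zero_prod_def by (intro prod_nonneg) auto

lemma disc_transform_lin_span_rho:
  assumes f: "f \<in> lin_span (rho ` {0<..<1})"
  obtains b where "b holomorphic_on ball 0 1"
    "\<And>z. cmod z < 1 \<Longrightarrow> disc_transform f z = zeta_disc 0 z * b z"
proof -
  obtain c A where A: "f = (\<lambda>x. \<Sum>h\<in>A. c h * h x)" "finite A" "A \<subseteq> rho ` {0<..<1}"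
    using f by (auto simp: lin_span_def)
  obtain \<alpha> where \<alpha>: "\<And>h. h \<in> A \<Longrightarrow> 0 < \<alpha> h \<and> \<alpha> h < (1::real) \<and> h = rho (\<alpha> h)"
  proof -
    have "\<exists>a. 0 < a \<and> a < 1 \<and> h = rho a" if hA: "h \<in> A" for h
    proof -
      obtain a where "h = rho a" "a \<in> {0<..<1}" using A(3) hA by blast
      thus ?thesis by auto
    qed
    thus thesis using that by metis
  qed
  have hL2: "h \<in> L2_space unit_lborel" if "h \<in> A" for h
    using \<alpha>[OF that] rho_L2[of "\<alpha> h"] by simp
  have fL2: "f \<in> L2_space unit_lborel" unfolding A(1) by (intro L2_space_sum L2_space_cmult hL2)
  \<comment> \<open>\<open>E\<close> vanishes at 1, which cancels the pole of zeta; the entire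
    quotient \<open>Q\<close> carries all dependence on the coefficients.\<close>
  define E where "E = (\<lambda>s. \<Sum>h\<in>A. c h * (of_real (\<alpha> h) - of_real (\<alpha> h) powr s))"
  have E: "E holomorphic_on UNIV" unfolding E_def
    by (intro holomorphic_intros)
  have E1: "E 1 = 0" unfolding E_def using \<alpha> by (intro sum.neutral) auto
  define Q where "Q = (\<lambda>s. if s = 1 then deriv E 1 else (E s - E 1) / (s - 1))"
  have Q: "Q holomorphic_on UNIV" unfolding Q_def by (rule pole_lemma_open[OF E open_UNIV])
  have QE: "E s = (s - 1) * Q s" for s by (simp add: Q_def E1)
  define b where "b = (\<lambda>z. Q (1 / (1 - z)))"
  have "(Q \<circ> (\<lambda>z. 1 / (1 - z))) holomorphic_on ball 0 1"
    by (intro holomorphic_on_compose_gen[OF _ Q] holomorphic_intros) auto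
  hence b: "b holomorphic_on ball 0 1" by (simp add: o_def b_def)
  show thesis
  proof (rule that[OF b])
    fix z :: complex assume z: "cmod z < 1"
    show "disc_transform f z = zeta_disc 0 z * b z"
    proof (rule disc_transform_eqI[OF fL2 _ _ z])
      show "(\<lambda>z. zeta_disc 0 z * b z) holomorphic_on ball 0 1"
        by (intro holomorphic_intros zeta_disc_holomorphic_ball b)
      fix s :: complex assume s: "Re s > 1"
      hence s0: "s \<noteq> 0" "s \<noteq> 1" by auto
      have "mellin f s = (\<Sum>h\<in>A. c h * mellin h s)"
        unfolding A(1) by (rule mellin_sum[OF hL2]) (use s in auto)
      also have "\<dots> = (\<Sum>h\<in>A. c h * ((of_real (\<alpha> h) - of_real (\<alpha> h) powr s) * zeta_series s / s))"
      proof (intro sum.cong refl)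
        fix h assume "h \<in> A"
        from \<alpha>[OF this] show "c h * mellin h s = c h * ((of_real (\<alpha> h) - of_real (\<alpha> h) powr s) * zeta_series s / s)"
          using mellin_rho[of "\<alpha> h" s] s by simp
      qed
      also have "\<dots> = E s * zeta_series s / s" by (simp add: E_def sum_distrib_right sum_divide_distrib mult.assoc)
      finally have "s * mellin f s = (s - 1) * zeta_series s * Q s" using s0 by (simp add: QE)
      also have "\<dots> = zeta_disc 0 (to_disc s) * b (to_disc s)"
        using s s0 by (simp add: zeta_disc_def b_def to_disc_def zeta_reg_def riemann_zeta_eq_series)
      finally show "s * mellin f s = zeta_disc 0 (to_disc s) * b (to_disc s)" .
    qed
  qed
qed

text \<open>Nothing is known about the cofactor \<open>b\<close> on the unit circle, so the Blaschke
  factors are divided out at radius r, where they have modulus 1, and r tends to 1 at the end. The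
  squared modulus of the quotient H at 0 is at most its mean over the circle, which is that of the
  transform.\<close>

lemma lin_span_rho_bound:
  assumes f: "f \<in> lin_span (rho ` {0<..<1})" and F: "finite F" "F \<subseteq> zeta_zeros_right"
  shows "cmod (L2_inner unit_lborel f one_fun) \<le> zero_prod F * L2_norm unit_lborel f"
proof -
  have fL2: "f \<in> L2_space unit_lborel"
    by (rule lin_span_L2[OF _ f]) (auto intro!: rho_L2)
  obtain b where b: "b holomorphic_on ball 0 1"
    "\<And>z. cmod z < 1 \<Longrightarrow> disc_transform f z = zeta_disc 0 z * b z"
    using disc_transform_lin_span_rho[OF f] by blast
  define W where "W = to_disc ` F"
  have W: "finite W" "\<And>w. w \<in> W \<Longrightarrow> cmod w < 1" using F to_disc_in_ball by (auto simp: W_def)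
  define P where "P = (\<lambda>r. \<Prod>w\<in>W. (cmod w / r) ^ nat (zorder (zeta_disc 0) w))"
  have P1: "P 1 = zero_prod F"
    unfolding P_def W_def zero_prod_def prod.reindex[OF inj_on_to_disc] o_def
  proof (intro prod.cong refl)
    fix \<rho> assume "\<rho> \<in> F"
    hence \<rho>: "\<rho> \<in> zeta_zeros_right" using F by auto
    show "(cmod (to_disc \<rho>) / 1) ^ nat (zorder (zeta_disc 0) (to_disc \<rho>)) = cmod ((1 - \<rho>) / \<rho>) ^ nat (zorder riemann_zeta \<rho>)"
      using zorder_zeta_disc[OF \<rho>] cmod_to_disc[OF zeta_zeros_right_nonzero[OF \<rho>]] by simp
  qed
  have bd: "cmod (disc_transform f 0) \<le> P r * L2_norm unit_lborel f"
    if r: "0 < r" "r < 1" "\<And>w. w \<in> W \<Longrightarrow> cmod w < r" for r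
  proof -
    have "W \<subseteq> ball 0 r" using r by auto
    moreover have "zeta_disc 0 0 \<noteq> 0" by simp
    ultimately obtain h B where
      h: "h holomorphic_on ball 0 1"
      and B: "\<And>z. cmod z \<le> r \<Longrightarrow> zeta_disc 0 z = B z * h z" "\<And>z. cmod z = r \<Longrightarrow> cmod (B z) = 1"
        "cmod (B 0) = P r"
      unfolding P_def using blaschke_division[OF zeta_disc_holomorphic_ball[of 0] _ r(1,2) W(1)] by blast
    define H where "H = (\<lambda>z. h z * b z)"
    have TH: "disc_transform f z = B z * H z" if "cmod z \<le> r" for z
      using b(2)[of z] B(1)[OF that] that r by (simp add: H_def)
    have "(cmod (H 0))\<^sup>2 \<le> integral {0..1} (\<lambda>x. (cmod (H (of_real r * circ x)))\<^sup>2)"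
      by (rule sub_mean_value[OF _ r(1,2)]) (auto simp: H_def intro!: holomorphic_intros h b)
    also have "\<dots> = integral {0..1} (\<lambda>x. (cmod (disc_transform f (of_real r * circ x)))\<^sup>2)"
    proof (rule Henstock_Kurzweil_Integration.integral_cong)
      fix x
      have "cmod (of_real r * circ x) = r" using r by (simp add: norm_mult)
      thus "(cmod (H (of_real r * circ x)))\<^sup>2 = (cmod (disc_transform f (of_real r * circ x)))\<^sup>2"
        using TH B(2) by (simp add: norm_mult)
    qed
    also have "\<dots> \<le> (L2_norm unit_lborel f)\<^sup>2" by (rule disc_transform_circle_mean[OF fL2 r(1,2)])
    finally have "cmod (H 0) \<le> L2_norm unit_lborel f" by (rule power2_le_imp_le) simp
    hence "cmod (B 0) * cmod (H 0) \<le> cmod (B 0) * L2_norm unit_lborel f" by (intro mult_left_mono) auto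
    thus ?thesis using TH[of 0] r B(3) by (simp add: norm_mult)
  qed
  define r0 where "r0 = Max (insert 0 (cmod ` W))"
  have r0: "r0 < 1" "0 \<le> r0" "\<And>w. w \<in> W \<Longrightarrow> cmod w \<le> r0"
    unfolding r0_def using W by auto
  have "\<forall>\<^sub>F r in at_left 1. cmod (disc_transform f 0) \<le> P r * L2_norm unit_lborel f"
    unfolding eventually_at_left_field
  proof (intro exI[of _ r0] conjI allI impI r0(1))
    fix r assume "r0 < r" "r < 1"
    thus "cmod (disc_transform f 0) \<le> P r * L2_norm unit_lborel f"
      using r0 by (intro bd) (auto intro: le_less_trans)
  qed
  moreover have "((\<lambda>r. P r * L2_norm unit_lborel f) \<longlongrightarrow> P 1 * L2_norm unit_lborel f) (at_left 1)"
    unfolding P_def by (intro tendsto_intros) auto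
  ultimately have "cmod (disc_transform f 0) \<le> P 1 * L2_norm unit_lborel f"
    by (intro tendsto_lowerbound[of _ _ "at_left (1::real)"]) auto
  thus ?thesis by (simp add: inner_one_fun P1)
qed

lemma NB_bound:
  assumes g: "g \<in> NB" and F: "finite F" "F \<subseteq> zeta_zeros_right"
  shows "cmod (L2_inner unit_lborel g one_fun) \<le> zero_prod F * L2_norm unit_lborel g"
proof (rule field_le_epsilon)
  fix e :: real assume e: "e > 0"
  \<comment> \<open>The approximation error enters once through the inner product with 1 and once
    through the norm of \<open>u\<close>; \<open>K + 1\<close> avoids division by 0.\<close>
  define K where "K = L2_norm unit_lborel one_fun + zero_prod F"
  have K: "K \<ge> 0" unfolding K_def using zero_prod_nonneg by (intro add_nonneg_nonneg) auto
  have "e / (K + 1) > 0" using K e by simp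
  then obtain u where u: "u \<in> lin_span (rho ` {0<..<1})" "L2_norm unit_lborel (\<lambda>x. g x - u x) < e / (K + 1)"
    using g unfolding NB_def L2_closed_span_def by blast
  have gL: "g \<in> L2_space unit_lborel" using g unfolding NB_def L2_closed_span_def by blast
  have uL: "u \<in> L2_space unit_lborel" by (rule lin_span_L2[OF _ u(1)]) (auto intro!: rho_L2)
  define d where "d = L2_norm unit_lborel (\<lambda>x. g x - u x)"
  have "L2_inner unit_lborel g one_fun = L2_inner unit_lborel (\<lambda>x. g x - u x) one_fun + L2_inner unit_lborel u one_fun"
    using L2_inner_diff_left[OF gL uL one_fun_L2] by simp
  hence "cmod (L2_inner unit_lborel g one_fun) \<le> cmod (L2_inner unit_lborel (\<lambda>x. g x - u x) one_fun) + cmod (L2_inner unit_lborel u one_fun)"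
    by (metis norm_triangle_ineq)
  also have "cmod (L2_inner unit_lborel (\<lambda>x. g x - u x) one_fun) \<le> d * L2_norm unit_lborel one_fun"
    unfolding d_def by (intro L2_Cauchy_Schwarz L2_space_diff gL uL one_fun_L2)
  also have "cmod (L2_inner unit_lborel u one_fun) \<le> zero_prod F * L2_norm unit_lborel u"
    by (rule lin_span_rho_bound[OF u(1) F])
  also have "zero_prod F * L2_norm unit_lborel u \<le> zero_prod F * (d + L2_norm unit_lborel g)"
    using L2_norm_triangle_diff[OF uL gL L2_space_zero] zero_prod_nonneg
    by (intro mult_left_mono) (simp_all add: d_def L2_norm_diff_commute[of _ u])
  finally have "cmod (L2_inner unit_lborel g one_fun) \<le> d * K + zero_prod F * L2_norm unit_lborel g"
    by (simp add: K_def algebra_simps)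
  also have "d * K \<le> e / (K + 1) * K" using u(2) K by (intro mult_right_mono) (auto simp: d_def)
  also have "\<dots> \<le> e" using K e by (simp add: field_simps)
  finally show "cmod (L2_inner unit_lborel g one_fun) \<le> zero_prod F * L2_norm unit_lborel g + e" by simp
qed

lemma NB_proj:
  defines "p \<equiv> L2_proj unit_lborel NB one_fun"
  shows "p \<in> NB" "\<And>g. g \<in> NB \<Longrightarrow> L2_inner unit_lborel (\<lambda>x. one_fun x - p x) g = 0"
proof -
  have "rho ` {0<..<1} \<subseteq> L2_space unit_lborel" by (auto intro!: rho_L2)
  from L2_projection_exists[OF this one_fun_L2] obtain p0 where
    "p0 \<in> NB" "\<And>g. g \<in> NB \<Longrightarrow> L2_inner unit_lborel (\<lambda>x. one_fun x - p0 x) g = 0"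
    unfolding NB_def by blast
  hence "\<exists>p. p \<in> NB \<and> (\<forall>g\<in>NB. L2_inner unit_lborel (\<lambda>x. one_fun x - p x) g = 0)" by blast
  from someI_ex[OF this] show "p \<in> NB" "\<And>g. g \<in> NB \<Longrightarrow> L2_inner unit_lborel (\<lambda>x. one_fun x - p x) g = 0"
    unfolding p_def L2_proj_def by blast+
qed

lemma NB_L2: "g \<in> NB \<Longrightarrow> g \<in> L2_space unit_lborel"
  by (simp add: NB_def L2_closed_span_def)

text \<open>For p = P(1) the inner product of p and 1 is the squared norm of p, so the bound on
  \<open>NB\<close> can be divided by the norm.\<close>

lemma proj_norm_le:
  assumes F: "finite F" "F \<subseteq> zeta_zeros_right"
  shows "L2_norm unit_lborel (L2_proj unit_lborel NB one_fun) \<le> zero_prod F"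
proof -
  define p where "p = L2_proj unit_lborel NB one_fun"
  have p: "p \<in> NB" "L2_inner unit_lborel (\<lambda>x. one_fun x - p x) p = 0" using NB_proj by (auto simp: p_def)
  have "L2_inner unit_lborel one_fun p = of_real ((L2_norm unit_lborel p)\<^sup>2)"
    using p(2) L2_inner_diff_left[OF one_fun_L2 NB_L2[OF p(1)] NB_L2[OF p(1)]] by (simp add: L2_inner_self)
  hence "L2_inner unit_lborel p one_fun = of_real ((L2_norm unit_lborel p)\<^sup>2)"
    by (subst L2_inner_commute) simp
  hence "(L2_norm unit_lborel p)\<^sup>2 \<le> zero_prod F * L2_norm unit_lborel p"
    using NB_bound[OF p(1) F] by (simp only: norm_of_real abs_power2)
  hence "L2_norm unit_lborel p \<le> zero_prod F"
    using zero_prod_nonneg[of F] L2_norm_nonneg[of unit_lborel p]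
    by (cases "L2_norm unit_lborel p = 0") (auto simp: power2_eq_square mult_le_cancel_right)
  thus ?thesis by (simp add: p_def)
qed

section \<open>The lower bound for the norm of the projection\<close>

text \<open>Both |s| and |1 - s| are at most 1/d for d = |1 - z|, so two factors 1 - z compensate
  the growth of \<open>zeta_reg\<close> and the third gives the limit 0 at z = 1.\<close>

lemma zeta_disc_growth:
  obtains C where "C \<ge> 0" "\<And>z. cmod z \<le> 1 \<Longrightarrow> cmod (zeta_disc 3 z) \<le> cmod (1 - z) ^ 3 + C * cmod (1 - z)"
proof -
  obtain C where C: "C \<ge> 0" "\<And>s. Re s \<ge> 1/2 \<Longrightarrow> cmod (zeta_reg s) \<le> 1 + C * (cmod (1 - s) * cmod s)"
    using zeta_reg_growth by blast
  show thesis
  proof (rule that[OF C(1)])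
    fix z :: complex assume z: "cmod z \<le> 1"
    show "cmod (zeta_disc 3 z) \<le> cmod (1 - z) ^ 3 + C * cmod (1 - z)"
    proof (cases "z = 1")
      case False
      define d where "d = cmod (1 - z)"
      have d: "d > 0" using False by (simp add: d_def)
      define s where "s = 1 / (1 - z)"
      have "(cmod z)\<^sup>2 \<le> 1" using z by (simp add: abs_square_le_1)
      hence "2 * Re s - 1 \<ge> 0" unfolding s_def two_Re_inverse[OF False] by simp
      hence s: "Re s \<ge> 1/2" by simp
      have ns: "cmod s = 1 / d" by (simp add: s_def d_def norm_divide)
      have "1 - s = - z / (1 - z)" using False by (simp add: s_def field_simps)
      hence n1s: "cmod (1 - s) = cmod z / d" by (simp only: norm_divide norm_minus_cancel d_def)
      have "cmod (1 - s) \<le> 1 / d" unfolding n1s using z d by (intro divide_right_mono) auto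
      hence "cmod (1 - s) * cmod s \<le> 1 / d * (1 / d)" unfolding ns using d by (intro mult_right_mono) auto
      hence "C * (cmod (1 - s) * cmod s) \<le> C * (1 / d * (1 / d))" using C(1) by (intro mult_left_mono)
      hence "cmod (zeta_reg s) \<le> 1 + C * (1 / d * (1 / d))" using C(2)[OF s] by linarith
      hence "cmod (zeta_reg s) * d ^ 3 \<le> (1 + C * (1 / d * (1 / d))) * d ^ 3"
        using d by (intro mult_right_mono) auto
      also have "\<dots> = d ^ 3 + C * d" using d by (simp add: field_simps power3_eq_cube)
      finally show ?thesis by (simp add: zeta_disc_def norm_mult norm_power s_def d_def)
    qed (simp add: zeta_disc_def)
  qed
qed

lemma zeta_disc_continuous: "continuous_on (cball 0 1) (zeta_disc 3)"
  unfolding continuous_on_eq_continuous_within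
proof
  fix z :: complex assume z: "z \<in> cball 0 1"
  show "continuous (at z within cball 0 1) (zeta_disc 3)"
  proof (cases "z = 1")
    case False
    have "isCont (zeta_disc 3) z"
      using holomorphic_on_imp_continuous_on[OF zeta_disc_holomorphic[of 3]] False
      by (subst (asm) continuous_on_eq_continuous_at) auto
    thus ?thesis by (rule continuous_at_imp_continuous_at_within)
  next
    case True
    obtain C where C: "\<And>z. cmod z \<le> 1 \<Longrightarrow> cmod (zeta_disc 3 z) \<le> cmod (1 - z) ^ 3 + C * cmod (1 - z)"
      using zeta_disc_growth by blast
    have "((\<lambda>z. cmod (1 - z) ^ 3 + C * cmod (1 - z)) \<longlongrightarrow> cmod (1 - 1) ^ 3 + C * cmod (1 - 1)) (at 1 within cball 0 1)"
      by (intro tendsto_intros)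
    hence t: "((\<lambda>z::complex. cmod (1 - z) ^ 3 + C * cmod (1 - z)) \<longlongrightarrow> 0) (at 1 within cball 0 1)" by simp
    have "(zeta_disc 3 \<longlongrightarrow> 0) (at 1 within cball 0 1)"
      by (rule Lim_null_comparison[OF _ t]) (use C in \<open>auto simp: eventually_at_filter\<close>)
    thus ?thesis using True by (simp add: continuous_within zeta_disc_def)
  qed
qed

text \<open>At z = 1 no holomorphy is available for \<open>radial_log_decay\<close>. On the radius s
  = 1/\<eta> is real, and the modulus lies between \<eta>^2 (1 - \<eta>) and a constant.\<close>

lemma zeta_disc_radial:
  shows "((\<lambda>\<eta>. \<eta> * ln (cmod (zeta_disc 3 (of_real (1 - \<eta>))))) \<longlongrightarrow> 0) (at_right 0)"
    and "\<forall>\<^sub>F \<eta> in at_right 0. zeta_disc 3 (of_real (1 - \<eta>)) \<noteq> 0"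
proof -
  obtain C where C: "C \<ge> 0" "\<And>z. cmod z \<le> 1 \<Longrightarrow> cmod (zeta_disc 3 z) \<le> cmod (1 - z) ^ 3 + C * cmod (1 - z)"
    using zeta_disc_growth by blast
  have ev: "\<forall>\<^sub>F \<eta>::real in at_right 0. 0 < \<eta> \<and> \<eta> < 1"
    by (auto simp: eventually_at_right_field intro!: exI[of _ 1])
  have lower: "\<eta>\<^sup>2 * (1 - \<eta>) \<le> cmod (zeta_disc 3 (of_real (1 - \<eta>)))" if "0 < \<eta>" "\<eta> < 1" for \<eta>
  proof -
    have "1 / \<eta> - 1 \<le> cmod (zeta_reg (of_real (1 / \<eta>)))" using that by (intro zeta_reg_real_lower) simp
    hence "(1 / \<eta> - 1) * \<eta> ^ 3 \<le> cmod (zeta_reg (of_real (1 / \<eta>))) * \<eta> ^ 3"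
      using that by (intro mult_right_mono) auto
    moreover have "(1 / \<eta> - 1) * \<eta> ^ 3 = \<eta>\<^sup>2 * (1 - \<eta>)"
      using that by (simp add: field_simps power2_eq_square power3_eq_cube)
    moreover have "cmod (zeta_disc 3 (of_real (1 - \<eta>))) = cmod (zeta_reg (of_real (1 / \<eta>))) * \<eta> ^ 3"
      using that by (simp add: zeta_disc_def norm_mult norm_power)
    ultimately show ?thesis by simp
  qed
  have upper: "cmod (zeta_disc 3 (of_real (1 - \<eta>))) \<le> 1 + C" if "0 < \<eta>" "\<eta> < 1" for \<eta>
  proof -
    have "cmod (of_real (1 - \<eta>)) \<le> 1" "cmod (1 - of_real (1 - \<eta>)) = \<eta>"
      using that by (simp_all del: of_real_diff add: norm_of_real) (use that in simp)
    hence "cmod (zeta_disc 3 (of_real (1 - \<eta>))) \<le> \<eta> ^ 3 + C * \<eta>" using C(2) by metis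
    also have "\<dots> \<le> 1 + C * 1" using that C(1) by (intro add_mono mult_left_mono power_le_one) auto
    finally show ?thesis by simp
  qed
  have pos: "0 < \<eta>\<^sup>2 * (1 - \<eta>)" if "0 < \<eta>" "\<eta> < 1" for \<eta> :: real using that by simp
  show "\<forall>\<^sub>F \<eta> in at_right 0. zeta_disc 3 (of_real (1 - \<eta>)) \<noteq> 0"
    using ev
  proof eventually_elim
    case (elim \<eta>)
    thus ?case using lower[of \<eta>] pos[of \<eta>] by (metis norm_zero not_le)
  qed
  show "((\<lambda>\<eta>. \<eta> * ln (cmod (zeta_disc 3 (of_real (1 - \<eta>))))) \<longlongrightarrow> 0) (at_right 0)"
  proof (rule tendsto_sandwich)
    show "\<forall>\<^sub>F \<eta> in at_right 0. \<eta> * ln (\<eta>\<^sup>2 * (1 - \<eta>)) \<le> \<eta> * ln (cmod (zeta_disc 3 (of_real (1 - \<eta>))))"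
      using ev
    proof eventually_elim
      case (elim \<eta>)
      thus ?case using lower[of \<eta>] pos[of \<eta>] by (intro mult_left_mono ln_mono) auto
    qed
    show "\<forall>\<^sub>F \<eta> in at_right 0. \<eta> * ln (cmod (zeta_disc 3 (of_real (1 - \<eta>)))) \<le> \<eta> * ln (1 + C)"
      using ev
    proof eventually_elim
      case (elim \<eta>)
      have "0 < cmod (zeta_disc 3 (of_real (1 - \<eta>)))" using lower[of \<eta>] pos[of \<eta>] elim by linarith
      thus ?case using upper[of \<eta>] elim by (intro mult_left_mono ln_mono) auto
    qed
    show "((\<lambda>\<eta>::real. \<eta> * ln (\<eta>\<^sup>2 * (1 - \<eta>))) \<longlongrightarrow> 0) (at_right 0)" by real_asymp
    have "((\<lambda>\<eta>::real. \<eta> * ln (1 + C)) \<longlongrightarrow> 0 * ln (1 + C)) (at_right 0)" by (intro tendsto_intros)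
    thus "((\<lambda>\<eta>::real. \<eta> * ln (1 + C)) \<longlongrightarrow> 0) (at_right 0)" by simp
  qed
qed

lemma dilation_orth_integral_transform:
  assumes f: "f \<in> dilation_orth y" and y: "y \<in> L2_space unit_lborel" and z: "cmod z < 1"
  shows "disc_transform (\<lambda>t. LINT a|unit_lborel. f (t / a) / of_real a) z = (1 - z) * disc_transform f z"
proof -
  have "z \<noteq> 1" using z by auto
  thus ?thesis
    using dilation_orth_integral_operator(2)[OF f y Re_inverse_gt_half[OF z]]
    by (simp add: disc_transform_def)
qed

text \<open>Horner's scheme.\<close>

lemma dilation_orth_poly:
  fixes q :: "complex poly"
  assumes f: "f \<in> dilation_orth y" and y: "y \<in> L2_space unit_lborel"
  shows "\<exists>g\<in>dilation_orth y. \<forall>z. cmod z < 1 \<longrightarrow> disc_transform g z = poly q z * disc_transform f z"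
proof (induction q)
  case 0
  have "(\<lambda>t. 0 * f t + 0 * f t) \<in> dilation_orth y" by (rule dilation_orth_lin[OF f f y])
  thus ?case by (intro bexI[of _ "\<lambda>t. 0 * f t + 0 * f t"]) (simp_all add: disc_transform_def mellin_def)
next
  case (pCons a q)
  then obtain g where g: "g \<in> dilation_orth y"
    "\<And>z. cmod z < 1 \<Longrightarrow> disc_transform g z = poly q z * disc_transform f z" by blast
  define V where "V = (\<lambda>t. LINT a|unit_lborel. g (t / a) / of_real a)"
  have V: "V \<in> dilation_orth y" unfolding V_def by (rule dilation_orth_integral_operator(1)[OF g(1) y])
  \<comment> \<open>The transform of \<open>S\<close> is z times that of \<open>g\<close>, since
    passing to \<open>V\<close> multiplies by 1 - z.\<close>
  define S where "S = (\<lambda>t. 1 * g t + (-1) * V t)"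
  have S: "S \<in> dilation_orth y" unfolding S_def by (rule dilation_orth_lin[OF g(1) V y])
  have "disc_transform (\<lambda>t. a * f t + 1 * S t) z = poly (pCons a q) z * disc_transform f z" if z: "cmod z < 1" for z
  proof -
    have "disc_transform S z = 1 * disc_transform g z + (-1) * disc_transform V z"
      unfolding S_def by (rule disc_transform_lin[OF dilation_orth_L2[OF g(1)] dilation_orth_L2[OF V] z])
    also have "disc_transform V z = (1 - z) * disc_transform g z"
      unfolding V_def by (rule dilation_orth_integral_transform[OF g(1) y z])
    finally have "disc_transform S z = z * (poly q z * disc_transform f z)"
      by (simp add: g(2)[OF z] algebra_simps)
    thus ?thesis
      by (subst disc_transform_lin[OF dilation_orth_L2[OF f] dilation_orth_L2[OF S] z]) (simp add: algebra_simps)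
  qed
  moreover have "(\<lambda>t. a * f t + 1 * S t) \<in> dilation_orth y" by (rule dilation_orth_lin[OF f S y])
  ultimately show ?case by blast
qed

lemma disc_transform_rho_average:
  assumes avg: "rho_average \<in> L2_space unit_lborel" and z: "cmod z < 1"
  shows "disc_transform rho_average z = zeta_disc 1 z"
proof (rule disc_transform_eqI[OF avg zeta_disc_holomorphic_ball _ z])
  fix s :: complex assume s: "Re s > 1"
  hence s0: "s \<noteq> 0" "s \<noteq> 1" by auto
  have "s * mellin rho_average s = zeta_series s * (1 - 1 / s)" using s0 by (simp add: mellin_rho_average[OF s])
  also have "\<dots> = zeta_disc 1 (to_disc s)"
    using s s0 by (simp add: zeta_disc_def to_disc_def zeta_reg_def riemann_zeta_eq_series field_simps)
  finally show "s * mellin rho_average s = zeta_disc 1 (to_disc s)" .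
qed

lemma proj_norm_ge:
  assumes \<beta>: "\<beta> > 0" "\<And>F. finite F \<Longrightarrow> F \<subseteq> zeta_zeros_right \<Longrightarrow> \<beta> \<le> zero_prod F"
  shows "\<beta> \<le> L2_norm unit_lborel (L2_proj unit_lborel NB one_fun)"
proof (rule field_le_epsilon)
  fix e :: real assume e: "e > 0"
  define p where "p = L2_proj unit_lborel NB one_fun"
  have pNB: "p \<in> NB" and orth: "\<And>g. g \<in> NB \<Longrightarrow> L2_inner unit_lborel (\<lambda>x. one_fun x - p x) g = 0"
    using NB_proj by (auto simp: p_def)
  have pL: "p \<in> L2_space unit_lborel" by (rule NB_L2[OF pNB])
  \<comment> \<open>Conjugated so that the bilinear pairing in \<open>dilation_orth\<close> becomes
    the inner product with 1 - P(1).\<close>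
  define y where "y = (\<lambda>t. cnj (one_fun t - p t))"
  have y: "y \<in> L2_space unit_lborel" unfolding y_def by (intro L2_space_cnj L2_space_diff one_fun_L2 pL)
  have rho_orth: "(LINT t|unit_lborel. rho a t * y t) = 0" if a: "0 < a" "a < 1" for a
  proof -
    have "rho a \<in> NB" unfolding NB_def L2_closed_span_def
      using a rho_L2[of a] lin_span_base[of "rho a" "rho ` {0<..<1}"]
      by (auto simp: L2_norm_def intro!: bexI[of _ "rho a"])
    hence "L2_inner unit_lborel (rho a) (\<lambda>x. one_fun x - p x) = 0"
      by (subst L2_inner_commute) (simp add: orth)
    thus ?thesis by (simp add: L2_inner_def y_def)
  qed
  have avg: "rho_average \<in> dilation_orth y" by (rule rho_average_dilation_orth[OF y rho_orth])
  \<comment> \<open>The polynomial 1 - 2 z + z^2 = (1 - z)^2 raises the exponent from 1 to 3, which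
    makes the transform continuous on the closed disc.\<close>
  obtain g0 where g0: "g0 \<in> dilation_orth y" "\<And>z. cmod z < 1 \<Longrightarrow> disc_transform g0 z = zeta_disc 3 z"
  proof -
    obtain g where "g \<in> dilation_orth y"
      "\<And>z. cmod z < 1 \<Longrightarrow> disc_transform g z = poly [:1, -2, 1:] z * disc_transform rho_average z"
      using dilation_orth_poly[OF avg y] by blast
    moreover have "poly [:1, -2, 1:] z * zeta_disc 1 z = zeta_disc 3 z" for z
      by (simp add: zeta_disc_def power3_eq_cube algebra_simps)
    ultimately show thesis
      using that disc_transform_rho_average[OF dilation_orth_L2[OF avg]] by simp
  qed
  obtain q :: "complex poly" where q: "\<And>z. cmod z \<le> 1 \<Longrightarrow> cmod (poly q z * zeta_disc 3 z) \<le> 1"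
    "\<beta> - e \<le> cmod (poly q 0)"
  proof (rule outer_polynomial[OF zeta_disc_continuous zeta_disc_holomorphic _ connected_minus_1 _ zeta_disc_0 zeta_disc_radial \<beta>(1) _ e])
    show "\<beta> \<le> (\<Prod>w\<in>F. cmod w ^ nat (zorder (zeta_disc 3) w))"
      if F: "finite F" "F \<subseteq> {z \<in> ball 0 1. zeta_disc 3 z = 0}" for F
    proof -
      have "F \<subseteq> to_disc ` zeta_zeros_right"
      proof
        fix w assume "w \<in> F"
        hence "cmod w < 1" "zeta_disc 3 w = 0" using F(2) by auto
        thus "w \<in> to_disc ` zeta_zeros_right" by (rule zeta_disc_zero) auto
      qed
      then obtain Z where Z: "Z \<subseteq> zeta_zeros_right" "finite Z" "F = to_disc ` Z"
        using finite_subset_image[OF F(1)] by metis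
      have "(\<Prod>w\<in>F. cmod w ^ nat (zorder (zeta_disc 3) w)) = zero_prod Z"
        unfolding Z(3) zero_prod_def prod.reindex[OF inj_on_to_disc] o_def
      proof (intro prod.cong refl)
        fix \<rho> assume "\<rho> \<in> Z"
        hence \<rho>: "\<rho> \<in> zeta_zeros_right" using Z by auto
        show "cmod (to_disc \<rho>) ^ nat (zorder (zeta_disc 3) (to_disc \<rho>)) = cmod ((1 - \<rho>) / \<rho>) ^ nat (zorder riemann_zeta \<rho>)"
          using zorder_zeta_disc[OF \<rho>] cmod_to_disc[OF zeta_zeros_right_nonzero[OF \<rho>]] by simp
      qed
      thus ?thesis using \<beta>(2)[OF Z(2,1)] by simp
    qed
  qed (auto intro: that)
  obtain f where f: "f \<in> dilation_orth y"
    "\<And>z. cmod z < 1 \<Longrightarrow> disc_transform f z = poly q z * disc_transform g0 z"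
    using dilation_orth_poly[OF g0(1) y] by blast
  have fL: "f \<in> L2_space unit_lborel" by (rule dilation_orth_L2[OF f(1)])
  have fn: "L2_norm unit_lborel f \<le> 1"
    by (rule L2_norm_le_disc_bound[OF fL]) (simp add: f(2) g0(2) q(1))
  \<comment> \<open>The dilation \<theta> = 1 gives the orthogonality of \<open>f\<close>
    itself.\<close>
  have "(LINT t|unit_lborel. f (t / 1) * y t) = 0"
    using f(1) unfolding dilation_orth_def by (auto dest: spec[of _ 1])
  hence "L2_inner unit_lborel f (\<lambda>x. one_fun x - p x) = 0" by (simp add: L2_inner_def y_def)
  hence "L2_inner unit_lborel (\<lambda>x. one_fun x - p x) f = 0" by (subst L2_inner_commute) simp
  hence "L2_inner unit_lborel one_fun f = L2_inner unit_lborel p f"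
    using L2_inner_diff_left[OF one_fun_L2 pL fL] by simp
  hence "cmod (L2_inner unit_lborel f one_fun) = cmod (L2_inner unit_lborel p f)"
    by (subst L2_inner_commute) simp
  also have "\<dots> \<le> L2_norm unit_lborel p * L2_norm unit_lborel f" by (rule L2_Cauchy_Schwarz[OF pL fL])
  also have "\<dots> \<le> L2_norm unit_lborel p * 1" by (intro mult_left_mono fn) simp
  finally have "cmod (poly q 0) \<le> L2_norm unit_lborel p"
    by (simp add: inner_one_fun f(2) g0(2))
  thus "\<beta> \<le> L2_norm unit_lborel (L2_proj unit_lborel NB one_fun) + e"
    using q(2) by (simp add: p_def)
qed

text \<open>All factors are at most 1, so the products decrease along inclusion and their limit is
  the infimum.\<close>

lemma zero_prod_mono:
  assumes "F \<subseteq> F'" "finite F'" "F' \<subseteq> zeta_zeros_right"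
  shows "zero_prod F' \<le> zero_prod F"
proof -
  have le1: "cmod ((1 - \<rho>) / \<rho>) ^ n \<le> 1" if "\<rho> \<in> F'" for \<rho> n
    using to_disc_in_ball[of \<rho>] cmod_to_disc[of \<rho>] zeta_zeros_right_nonzero[of \<rho>] that assms(3)
    by (intro power_le_one) auto
  have "zero_prod F' = zero_prod (F' - F) * zero_prod F"
    unfolding zero_prod_def by (rule prod.subset_diff[OF assms(1,2)])
  also have "zero_prod (F' - F) \<le> 1" unfolding zero_prod_def by (intro prod_le_1) (use le1 in auto)
  hence "zero_prod (F' - F) * zero_prod F \<le> 1 * zero_prod F"
    by (intro mult_right_mono zero_prod_nonneg)
  finally show ?thesis by simp
qed

theorem theorem1p2:
  "((\<lambda>F. \<Prod>\<rho>\<in>F. cmod ((1 - \<rho>) / \<rho>) ^ nat (zorder riemann_zeta \<rho>))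
      \<longlongrightarrow> L2_norm unit_lborel (L2_proj unit_lborel NB (indicator {0<..1})))
    (finite_subsets_at_top zeta_zeros_right)"
proof -
  define N where "N = L2_norm unit_lborel (L2_proj unit_lborel NB one_fun)"
  have "(zero_prod \<longlongrightarrow> N) (finite_subsets_at_top zeta_zeros_right)"
  proof (rule order_tendstoI)
    fix a assume "a < N"
    thus "\<forall>\<^sub>F F in finite_subsets_at_top zeta_zeros_right. a < zero_prod F"
      using proj_norm_le unfolding N_def
      by (intro eventually_finite_subsets_at_top_weakI) (auto intro: less_le_trans)
  next
    fix a assume a: "N < a"
    have "a > 0" using a L2_norm_nonneg unfolding N_def by (rule le_less_trans[rotated])
    \<comment> \<open>If no finite product were below \<open>a\<close>, then \<open>a\<close>, being
      positive, would be an admissible \<beta> in \<open>proj_norm_ge\<close>.\<close>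
    have "\<exists>F. finite F \<and> F \<subseteq> zeta_zeros_right \<and> zero_prod F < a"
    proof (rule ccontr)
      assume "\<not> ?thesis"
      hence "a \<le> zero_prod F" if "finite F" "F \<subseteq> zeta_zeros_right" for F using that not_less by blast
      from proj_norm_ge[OF \<open>a > 0\<close> this] a show False by (simp add: N_def)
    qed
    then obtain F where F: "finite F" "F \<subseteq> zeta_zeros_right" "zero_prod F < a" by blast
    show "\<forall>\<^sub>F F in finite_subsets_at_top zeta_zeros_right. zero_prod F < a"
      unfolding eventually_finite_subsets_at_top
      using F zero_prod_mono by (intro exI[of _ F]) (auto intro: le_less_trans)
  qed
  thus ?thesis unfolding zero_prod_def N_def .
qed

end
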